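(* Let $c\in\mathbb{R}$ and let $p,q,r$ be real-valued (Lebesgue) measurable functions on $[c,\infty)$ such that $p>0$ and $r>0$ a.e. on $[c,\infty)$ and $1/p,\,q,\,r\in L^1([c,d];dx)$ for all $d\in[c,\infty)$. Assume that $p\in AC([c,c+\rho])$ for all $\rho>0$ and that $r^{-1}(p')^2,\ r^{-1}\in L^1_{\mathrm{loc}}((c,\infty))$. Let $\ell=\frac1r\left(-\frac{d}{dx}p\frac{d}{dx}+q\right)$ on $[c,\infty)$, and suppose that the associated minimal operator $T_{\min,c,\infty}$ in $L^2((c,\infty);r\,dx)$ (with Dirichlet boundary condition at $c$) is bounded from below. If $$\|p/r\|_{L^\infty((\rho/2,\rho))}=O(\rho^2)\quad\text{as }\rho\uparrow\infty,$$ then $\ell$ is in the limit point case at $\infty$.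
   Context: $AC([c,d])$ denotes the set of absolutely continuous functions on $[c,d]$. For (complex-valued) $u$ with $u,pu'\in AC([c,d])$ for all $d\in[c,\infty)$, set $\ell u=r^{-1}\left(-(pu')'+qu\right)$. Define $$\mathcal{D}_{\max,c,\infty}=\{u\in L^2([c,\infty);r\,dx)\,:\,u,pu'\in AC([c,d])\text{ for all }d\in[c,\infty);\ u(c)=0;\ \ell u\in L^2([c,\infty);r\,dx)\},$$ $$\mathcal{D}_{\min,c,\infty}=\{u\in\mathcal{D}_{\max,c,\infty}\,:\,\mathrm{supp}(u)\subset[c,\infty)\text{ is compact}\}.$$ The minimal operator is $T_{\min,c,\infty}u=\ell u$ with domain $\mathcal{D}_{\min,c,\infty}$, and the maximal operator is $T_{\max,c,\infty}u=\ell u$ with domain $\mathcal{D}_{\max,c,\infty}$; both act in $L^2((c,\infty);r\,dx)$. The operator $T_{\min,c,\infty}$ is densely defined and $T_{\min,c,\infty}^*=T_{\max,c,\infty}$. Bounded from below means that there is $\gamma\in\mathbb{R}$ such that $\int_c^\infty \overline{u}\,(\ell u)\,r\,dx\ge\gamma\int_c^\infty|u|^2\,r\,dx$ for all $u\in\mathcal{D}_{\min,c,\infty}$. The expression $\ell$ is in the limit point case at $\infty$ if, for every $z\in\mathbb{C}\setminus\mathbb{R}$, the space of solutions $u$ of $\ell u=zu$ (with $u,pu'\in AC([c,d])$ for all $d\in[c,\infty)$) lying in $L^2([c,\infty);r\,dx)$ is one-dimensional; equivalently, $T_{\min,c,\infty}$ is essentially self-adjoint, i.e. its closure, which then equals $T_{\max,c,\infty}$,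 is self-adjoint. *)

theory Defs
  imports "HOL-Analysis.Analysis" "HOL-Probability.Essential_Supremum"
    "HOL-Library.Function_Algebras"
begin

text \<open>
  Functions on the half-line \<open>{c..}\<close> are rendered as total functions on the reals; their
  values to the left of \<open>c\<close> play no role.
\<close>

definition abs_continuous_on_interval :: "real \<Rightarrow> real \<Rightarrow> (real \<Rightarrow> 'a::real_normed_vector) \<Rightarrow> bool"
  where "abs_continuous_on_interval a b f \<longleftrightarrow>
    (\<forall>\<epsilon>>0. \<exists>\<delta>>0. \<forall>(n::nat) s t.
       (\<forall>i<n. a \<le> s i \<and> s i \<le> t i \<and> t i \<le> b) \<longrightarrow>
       disjoint_family_on (\<lambda>i. {s i<..<t i}) {..<n} \<longrightarrow>
       (\<Sum>i<n. t i - s i) < \<delta> \<longrightarrow>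
       (\<Sum>i<n. norm (f (t i) - f (s i))) < \<epsilon>)"

definition L1_loc :: "real set \<Rightarrow> (real \<Rightarrow> real) \<Rightarrow> bool"
  where "L1_loc S f \<longleftrightarrow> (\<forall>K. compact K \<longrightarrow> K \<subseteq> S \<longrightarrow> f absolutely_integrable_on K)"

text \<open>Membership in \<open>L\<^sup>2([c,\<infinity>); r dx)\<close>, for a weight \<open>r\<close> that is positive almost everywhere.\<close>

definition L2_weighted :: "(real \<Rightarrow> real) \<Rightarrow> real \<Rightarrow> (real \<Rightarrow> complex) \<Rightarrow> bool"
  where "L2_weighted r c f \<longleftrightarrow>
    f \<in> borel_measurable (lebesgue_on {c..}) \<and>
    integrable (lebesgue_on {c..}) (\<lambda>x. (cmod (f x))\<^sup>2 * r x)"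

text \<open>
  For locally absolutely continuous \<open>u\<close>, the product \<open>p u'\<close> is only defined almost everywhere;
  that it belongs to \<open>AC\<close> means that it agrees almost everywhere with a function \<open>v\<close> which is
  absolutely continuous on every \<open>[c,d]\<close>. By continuity such a \<open>v\<close> is unique on \<open>[c,\<infinity>)\<close>, so
  the choice made in \<open>quasi_deriv\<close> is immaterial there.
\<close>

definition is_quasi_deriv ::
  "(real \<Rightarrow> real) \<Rightarrow> real \<Rightarrow> (real \<Rightarrow> complex) \<Rightarrow> (real \<Rightarrow> complex) \<Rightarrow> bool"
  where "is_quasi_deriv p c u v \<longleftrightarrow>
    (\<forall>d\<ge>c. abs_continuous_on_interval c d v) \<and>
    (AE x in lebesgue_on {c..}.
       u differentiable (at x) \<and> v x = of_real (p x) * vector_derivative u (at x))"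

definition quasi_deriv :: "(real \<Rightarrow> real) \<Rightarrow> real \<Rightarrow> (real \<Rightarrow> complex) \<Rightarrow> real \<Rightarrow> complex"
  where "quasi_deriv p c u = (SOME v. is_quasi_deriv p c u v)"

definition ell_regular :: "(real \<Rightarrow> real) \<Rightarrow> real \<Rightarrow> (real \<Rightarrow> complex) \<Rightarrow> bool"
  where "ell_regular p c u \<longleftrightarrow>
    (\<forall>d\<ge>c. abs_continuous_on_interval c d u) \<and> (\<exists>v. is_quasi_deriv p c u v)"

text \<open>
  The expression \<open>\<ell>u = (-(pu')' + qu) / r\<close>, meaningful for \<open>u\<close> with \<open>ell_regular p c u\<close> and
  then determined up to null sets on \<open>[c,\<infinity>)\<close>.
\<close>

definition ell ::
  "(real \<Rightarrow> real) \<Rightarrow> (real \<Rightarrow> real) \<Rightarrow> (real \<Rightarrow> real) \<Rightarrow> real \<Rightarrow> (real \<Rightarrow> complex) \<Rightarrow> real \<Rightarrow> complex"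
  where "ell p q r c u x =
    (- vector_derivative (quasi_deriv p c u) (at x) + of_real (q x) * u x) / of_real (r x)"

definition D_max ::
  "(real \<Rightarrow> real) \<Rightarrow> (real \<Rightarrow> real) \<Rightarrow> (real \<Rightarrow> real) \<Rightarrow> real \<Rightarrow> (real \<Rightarrow> complex) set"
  where "D_max p q r c =
    {u. L2_weighted r c u \<and> ell_regular p c u \<and> u c = 0 \<and> L2_weighted r c (ell p q r c u)}"

definition D_min ::
  "(real \<Rightarrow> real) \<Rightarrow> (real \<Rightarrow> real) \<Rightarrow> (real \<Rightarrow> real) \<Rightarrow> real \<Rightarrow> (real \<Rightarrow> complex) set"
  where "D_min p q r c = {u \<in> D_max p q r c. compact (closure {x \<in> {c..}. u x \<noteq> 0})}"

text \<open>
  The quadratic form of the symmetric minimal operator is real-valued, so comparing the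
  real part is the same as the inequality between the integrals themselves.
\<close>

definition T_min_bounded_below ::
  "(real \<Rightarrow> real) \<Rightarrow> (real \<Rightarrow> real) \<Rightarrow> (real \<Rightarrow> real) \<Rightarrow> real \<Rightarrow> bool"
  where "T_min_bounded_below p q r c \<longleftrightarrow>
    (\<exists>\<gamma>::real. \<forall>u \<in> D_min p q r c.
       Re (LINT x|lebesgue_on {c..}. cnj (u x) * ell p q r c u x * of_real (r x))
         \<ge> \<gamma> * (LINT x|lebesgue_on {c..}. (cmod (u x))\<^sup>2 * r x))"

definition fun_scale :: "complex \<Rightarrow> (real \<Rightarrow> complex) \<Rightarrow> real \<Rightarrow> complex"
  where "fun_scale a f = (\<lambda>x. a * f x)"

lemma vector_space_fun_scale: "vector_space fun_scale"
  by unfold_locales (auto simp: fun_scale_def fun_eq_iff algebra_simps)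

text \<open>
  Functions on \<open>[c,\<infinity>)\<close> are represented here by their extensions by zero, so that each of them
  is counted only once in the dimension.
\<close>

definition L2_solutions ::
  "(real \<Rightarrow> real) \<Rightarrow> (real \<Rightarrow> real) \<Rightarrow> (real \<Rightarrow> real) \<Rightarrow> real \<Rightarrow> complex \<Rightarrow> (real \<Rightarrow> complex) set"
  where "L2_solutions p q r c z =
    {u. (\<forall>x<c. u x = 0) \<and> ell_regular p c u \<and> L2_weighted r c u \<and>
        (AE x in lebesgue_on {c..}. ell p q r c u x = z * u x)}"

definition limit_point_at_infinity ::
  "(real \<Rightarrow> real) \<Rightarrow> (real \<Rightarrow> real) \<Rightarrow> (real \<Rightarrow> real) \<Rightarrow> real \<Rightarrow> bool"
  where "limit_point_at_infinity p q r c \<longleftrightarrow>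
    (\<forall>z. z \<notin> \<real> \<longrightarrow> vector_space.dim fun_scale (L2_solutions p q r c z) = 1)"

end

theory Submission
  imports Defs
begin

text \<open>
  Let \<open>y\<close> solve \<open>\<ell>y = (\<gamma> - 1)y\<close>, \<open>y(c) = 0\<close>, where \<open>\<gamma>\<close> is a lower bound of the minimal operator. If \<open>y\<close>
  were square integrable, then for a smooth cutoff \<open>\<phi>\<close> falling from 1 to 0 on \<open>(\<rho>/2, \<rho>)\<close> the form of
  \<open>\<ell>\<close> at \<open>\<phi>y\<close> equals \<open>(\<gamma> - 1)\<parallel>\<phi>y\<parallel>\<^sup>2 + \<integral> p \<phi>'\<^sup>2 |y|\<^sup>2\<close>, whence \<open>\<parallel>\<phi>y\<parallel>\<^sup>2 \<le> \<integral> p \<phi>'\<^sup>2 |y|\<^sup>2\<close>. As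
  \<open>p \<le> C \<rho>\<^sup>2 r\<close> and \<open>|\<phi>'| \<le> 3/\<rho>\<close> there, the right-hand side is at most \<open>9C\<close> times the integral of
  \<open>|y|\<^sup>2 r\<close> over \<open>(\<rho>/2, \<infinity>)\<close>, which tends to 0, so \<open>y = 0\<close>. Hence some real spectral parameter has a
  solution that is not square integrable; by Weyl's alternative, for no \<open>z\<close> are all solutions square
  integrable, and for nonreal \<open>z\<close> a nonzero square integrable one exists as a limit of solutions
  vanishing at \<open>c + n\<close>.

  The hypotheses only give absolute continuity, so all of this rests on the fundamental theorem of
  calculus for absolutely continuous functions: the total variation of such a function is again
  absolutely continuous, hence the Stieltjes measures of its monotone parts have Radon-Nikodym
  densities, and indefinite integrals are differentiable almost everywhere.
\<close>

section \<open>Absolutely continuous functions\<close>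

text \<open>The parameter is shifted below \<open>\<gamma>\<close> so that the form inequality
  leaves one full copy of the norm of the cut-off solution on the left; at \<open>\<gamma>\<close>
  itself it would only say that the other term is nonnegative. The obstacle is that the lower bound
  is available on \<open>D_min\<close> alone, so \<open>\<phi>y\<close> has to lie in the operator
  domain and not merely in the form domain. The defect of \<open>\<phi>y\<close> in the equation of
  \<open>y\<close> is \<open>-(2 \<phi>' (p y') + (p \<phi>')' y) / r\<close>. Its square
  integrability with weight \<open>r\<close> is where the local integrability of \<open>1/r\<close>
  and \<open>(p')^2 / r\<close> enters, and the existence of \<open>(p \<phi>')'\<close> asks for a
  cutoff whose derivative is absolutely continuous. The constant 3 is the slope
  \<open>2/\<rho>\<close> of a linear ramp times the maximum \<open>3/2\<close> of
  \<open>|6 t^2 - 6 t|\<close> on \<open>[0,1]\<close>. Since \<open>quasi_deriv\<close> is a choice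
  and \<open>ell\<close> is determined only almost everywhere, all computations run on pairs of a
  function and an explicit quasi-derivative, and are translated back by uniqueness of continuous
  representatives.\<close>

lemma integral_has_vector_derivative_AE:
  fixes w :: "real \<Rightarrow> 'a::euclidean_space"
  assumes w: "\<And>a b. w integrable_on {a..b}"
  obtains N where "negligible N"
    "\<And>x a. x \<notin> N \<Longrightarrow> a < x \<Longrightarrow> ((\<lambda>x. integral {a..x} w) has_vector_derivative w x) (at x)"
proof -
  have w1: "w integrable_on cbox a b" for a b using w by simp
  \<comment> \<open>The averages in \<open>integrable_ccontinuous_explicit\<close> run over
    intervals to the right of the point; applied to the reflected function it controls those to the
    left.\<close>
  have w2: "(\<lambda>x. w (-x)) integrable_on cbox a b" for a b
    using Henstock_Kurzweil_Integration.integrable_reflect_real[where f=w and a="-b" and b="-a"] w by simp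
  obtain N1 where N1: "negligible N1" "\<And>x e. \<lbrakk>x \<notin> N1; 0 < e\<rbrakk> \<Longrightarrow>
      \<exists>d>0. \<forall>h. 0 < h \<and> h < d \<longrightarrow>
         norm(integral (cbox x (x + h *\<^sub>R One)) w /\<^sub>R h ^ DIM(real) - w x) < e"
    using integrable_ccontinuous_explicit[OF w1] by blast
  obtain N2 where N2: "negligible N2" "\<And>x e. \<lbrakk>x \<notin> N2; 0 < e\<rbrakk> \<Longrightarrow>
      \<exists>d>0. \<forall>h. 0 < h \<and> h < d \<longrightarrow>
         norm(integral (cbox x (x + h *\<^sub>R One)) (\<lambda>x. w (-x)) /\<^sub>R h ^ DIM(real) - w (-x)) < e"
    using integrable_ccontinuous_explicit[OF w2] by blast
  show ?thesis
  proof
    have "negligible (uminus ` N2)"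
      by (intro negligible_differentiable_image_negligible[OF _ N2(1)])
        (auto intro: differentiable_on_minus differentiable_on_ident)
    then show "negligible (N1 \<union> uminus ` N2)" using N1(1) by simp
  next
    fix x a assume x: "x \<notin> N1 \<union> uminus ` N2" and ax: "a < x"
    then have x1: "x \<notin> N1" and x2: "- x \<notin> N2" by force+
    define F where "F = (\<lambda>x. integral {a..x} w)"
    have F_diff: "F z - F y = integral {y..z} w" if "a \<le> y" "y \<le> z" for y z
      using Henstock_Kurzweil_Integration.integral_combine[OF that w] by (simp add: F_def algebra_simps)
    have est: "\<exists>d>0. \<forall>y. norm (y - x) < d \<longrightarrow>
        norm (F y - F x - (y - x) *\<^sub>R w x) \<le> e * norm (y - x)" if e: "e > 0" for e
    proof -
      obtain d1 where d1: "d1 > 0" "\<And>h. 0 < h \<Longrightarrow> h < d1 \<Longrightarrow>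
         norm (integral {x..x + h} w /\<^sub>R h - w x) < e"
        using N1(2)[OF x1 e] by auto
      obtain d2 where d2: "d2 > 0" "\<And>h. 0 < h \<Longrightarrow> h < d2 \<Longrightarrow>
         norm (integral {-x..-x + h} (\<lambda>x. w (-x)) /\<^sub>R h - w x) < e"
        using N2(2)[OF x2 e] by auto
      have scale: "norm (I - h *\<^sub>R w x) \<le> e * h" if "norm (I /\<^sub>R h - w x) < e" "h > 0" for h I
      proof -
        have "I - h *\<^sub>R w x = h *\<^sub>R (I /\<^sub>R h - w x)"
          using that by (simp add: algebra_simps)
        then show ?thesis using that by (simp add: mult.commute less_imp_le)
      qed
      show ?thesis
      proof (intro exI[of _ "min (min d1 d2) (x - a)"] conjI allI impI)
        show "0 < min (min d1 d2) (x - a)" using d1 d2 ax by simp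
        fix y assume y: "norm (y - x) < min (min d1 d2) (x - a)"
        consider "y = x" | "y > x" | "y < x" by linarith
        then show "norm (F y - F x - (y - x) *\<^sub>R w x) \<le> e * norm (y - x)"
        proof cases
          case 1 then show ?thesis by simp
        next
          case 2
          then have "norm (integral {x..x + (y - x)} w /\<^sub>R (y - x) - w x) < e"
            using y by (intro d1(2)) auto
          then have "norm (integral {x..y} w - (y - x) *\<^sub>R w x) \<le> e * (y - x)"
            using scale[where I="integral {x..y} w" and h="y - x"] 2 by simp
          then show ?thesis using F_diff[of x y] 2 ax by simp
        next
          case 3
          then have "norm (integral {-x..-x + (x - y)} (\<lambda>x. w (-x)) /\<^sub>R (x - y) - w x) < e"
            using y by (intro d2(2)) auto
          then have "norm (integral {y..x} w /\<^sub>R (x - y) - w x) < e"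
            using Henstock_Kurzweil_Integration.integral_reflect_real[where a=y and b=x and f=w] by simp
          then have "norm (integral {y..x} w - (x - y) *\<^sub>R w x) \<le> e * (x - y)"
            using scale[where I="integral {y..x} w" and h="x - y"] 3 by simp
          moreover have "integral {y..x} w = F x - F y" using F_diff[of y x] 3 y by auto
          moreover have "F y - F x - (y - x) *\<^sub>R w x = - (F x - F y - (x - y) *\<^sub>R w x)"
            by (simp add: algebra_simps)
          ultimately show ?thesis using 3 by (simp only: norm_minus_cancel) simp
        qed
      qed
    qed
    have "(F has_derivative (\<lambda>h. h *\<^sub>R w x)) (at x)"
      unfolding has_derivative_at_alt by (intro conjI bounded_linear_scaleR_left allI impI est)
    then show "((\<lambda>x. integral {a..x} w) has_vector_derivative w x) (at x)"
      unfolding has_vector_derivative_def F_def .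
  qed
qed

text \<open>The definition numbers the intervals by \<open>{..<n}\<close>. Transport along a
  bijection frees the index type, which serves the pairs \<open>(i, j)\<close> of a refined family
  and families of intervals indexed by themselves.\<close>

lemma abs_continuous_on_interval_finite_index:
  assumes "abs_continuous_on_interval a b f" "\<epsilon> > 0"
  obtains \<delta> where "\<delta> > 0"
    "\<And>(I::'i set) s t. \<lbrakk>finite I; \<And>i. i \<in> I \<Longrightarrow> a \<le> s i \<and> s i \<le> t i \<and> t i \<le> b;
        disjoint_family_on (\<lambda>i. {s i<..<t i}) I; (\<Sum>i\<in>I. t i - s i) < \<delta>\<rbrakk>
      \<Longrightarrow> (\<Sum>i\<in>I. norm (f (t i) - f (s i))) < \<epsilon>"
proof -
  obtain \<delta> where \<delta>: "\<delta> > 0" "\<And>(n::nat) s t. \<lbrakk>\<forall>i<n. a \<le> s i \<and> s i \<le> t i \<and> t i \<le> b;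
       disjoint_family_on (\<lambda>i. {s i<..<t i}) {..<n}; (\<Sum>i<n. t i - s i) < \<delta>\<rbrakk> \<Longrightarrow>
       (\<Sum>i<n. norm (f (t i) - f (s i))) < \<epsilon>"
    using assms(1)[unfolded abs_continuous_on_interval_def, rule_format, OF assms(2)] by blast
  show ?thesis
  proof (rule that[OF \<delta>(1)])
    fix I :: "'i set" and s t
    assume I: "finite I" "\<And>i. i \<in> I \<Longrightarrow> a \<le> s i \<and> s i \<le> t i \<and> t i \<le> b"
      "disjoint_family_on (\<lambda>i. {s i<..<t i}) I" "(\<Sum>i\<in>I. t i - s i) < \<delta>"
    obtain h where h: "bij_betw h {..<card I} I"
      using ex_bij_betw_nat_finite[OF I(1)] by (auto simp: atLeast0LessThan)
    have hI: "h i \<in> I" if "i < card I" for i using bij_betwE[OF h] that by auto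
    have "(\<Sum>i<card I. norm (f (t (h i)) - f (s (h i)))) < \<epsilon>"
    proof (rule \<delta>(2))
      show "\<forall>i<card I. a \<le> s (h i) \<and> s (h i) \<le> t (h i) \<and> t (h i) \<le> b" using I(2) hI by blast
      show "disjoint_family_on (\<lambda>i. {s (h i)<..<t (h i)}) {..<card I}"
        unfolding disjoint_family_on_def
      proof (intro ballI impI)
        fix m n assume mn: "m \<in> {..<card I}" "n \<in> {..<card I}" "m \<noteq> n"
        then have "h m \<noteq> h n" using bij_betw_imp_inj_on[OF h] by (auto dest: inj_onD)
        then show "{s (h m)<..<t (h m)} \<inter> {s (h n)<..<t (h n)} = {}"
          using I(3) hI mn unfolding disjoint_family_on_def by blast
      qed
      show "(\<Sum>i<card I. t (h i) - s (h i)) < \<delta>"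
        using sum.reindex_bij_betw[OF h, of "\<lambda>i. t i - s i"] I(4) by simp
    qed
    then show "(\<Sum>i\<in>I. norm (f (t i) - f (s i))) < \<epsilon>"
      using sum.reindex_bij_betw[OF h, of "\<lambda>i. norm (f (t i) - f (s i))"] by simp
  qed
qed

lemma abs_continuous_on_interval_subset:
  "abs_continuous_on_interval a b f \<Longrightarrow> a \<le> a' \<Longrightarrow> b' \<le> b \<Longrightarrow> abs_continuous_on_interval a' b' f"
  unfolding abs_continuous_on_interval_def by (meson order.trans)

lemma abs_continuous_on_interval_imp_continuous_on:
  assumes f: "abs_continuous_on_interval a b f"
  shows "continuous_on {a..b} f"
  unfolding continuous_on_iff
proof (intro ballI allI impI)
  fix x e :: real assume x: "x \<in> {a..b}" and e: "e > 0"
  obtain d where d: "d > 0" "\<And>(I::unit set) s t. \<lbrakk>finite I; \<And>i. i \<in> I \<Longrightarrow> a \<le> s i \<and> s i \<le> t i \<and> t i \<le> b;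
        disjoint_family_on (\<lambda>i. {s i<..<t i}) I; (\<Sum>i\<in>I. t i - s i) < d\<rbrakk>
      \<Longrightarrow> (\<Sum>i\<in>I. norm (f (t i) - f (s i))) < e"
    using abs_continuous_on_interval_finite_index[OF f e] by blast
  show "\<exists>d>0. \<forall>x'\<in>{a..b}. dist x' x < d \<longrightarrow> dist (f x') (f x) < e"
  proof (intro exI[of _ d] conjI ballI impI d(1))
    fix y assume y: "y \<in> {a..b}" "dist y x < d"
    have "(\<Sum>i\<in>{()}. norm (f (max x y) - f (min x y))) < e"
      by (rule d(2)) (use x y in \<open>auto simp: disjoint_family_on_def dist_real_def max_def min_def\<close>)
    then show "dist (f y) (f x) < e"
      by (auto simp: dist_norm max_def min_def norm_minus_commute split: if_splits)
  qed
qed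

section \<open>Total variation of absolutely continuous functions\<close>

text \<open>Variation sums run over disjoint interval families, as in the definition of absolute
  continuity: clamping the endpoints then splits a family at an intermediate point.\<close>

definition variation_sums :: "(real \<Rightarrow> real) \<Rightarrow> real \<Rightarrow> real \<Rightarrow> real set"
  where "variation_sums f x y = {\<Sum>i<n. \<bar>f (t i) - f (s i)\<bar> | (n::nat) s t.
     (\<forall>i<n. x \<le> s i \<and> s i \<le> t i \<and> t i \<le> y) \<and> disjoint_family_on (\<lambda>i. {s i<..<t i}) {..<n}}"

definition total_variation :: "(real \<Rightarrow> real) \<Rightarrow> real \<Rightarrow> real \<Rightarrow> real"
  where "total_variation f x y = Sup (variation_sums f x y)"

lemma sum_length_disjoint_le:
  fixes s t :: "'i \<Rightarrow> real"
  assumes "finite I" "\<And>i. i \<in> I \<Longrightarrow> u \<le> s i \<and> s i \<le> t i \<and> t i \<le> v" "u \<le> v"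
    and dj: "disjoint_family_on (\<lambda>i. {s i<..<t i}) I"
  shows "(\<Sum>i\<in>I. t i - s i) \<le> v - u"
proof -
  have "(\<Sum>i\<in>I. t i - s i) = (\<Sum>i\<in>I. measure lborel {s i<..<t i})"
    using assms(2) by (intro sum.cong) auto
  also have "\<dots> = measure lborel (\<Union>i\<in>I. {s i<..<t i})"
    using assms by (intro measure_finite_Union[symmetric]) auto
  also have "\<dots> \<le> measure lborel {u..v}"
  proof (rule measure_mono_fmeasurable)
    show "(\<Union>i\<in>I. {s i<..<t i}) \<subseteq> {u..v}" using assms(2) by fastforce
    show "(\<Union>i\<in>I. {s i<..<t i}) \<in> sets lborel" using assms(1) by auto
    show "{u..v} \<in> fmeasurable lborel" by (metis box_real(2) fmeasurable_cbox)
  qed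
  finally show ?thesis using \<open>u \<le> v\<close> by simp
qed

lemma zero_in_variation_sums: "0 \<in> variation_sums f x y"
  unfolding variation_sums_def
  by (intro CollectI exI[of _ "0::nat"]) (auto simp: disjoint_family_on_def)

lemma variation_sums_split:
  assumes "S \<in> variation_sums f x z" "x \<le> y" "y \<le> z"
  obtains S1 S2 where "S1 \<in> variation_sums f x y" "S2 \<in> variation_sums f y z" "S \<le> S1 + S2"
proof -
  obtain n :: nat and s t where S: "S = (\<Sum>i<n. \<bar>f (t i) - f (s i)\<bar>)"
    and st: "\<forall>i<n. x \<le> s i \<and> s i \<le> t i \<and> t i \<le> z"
    and dj: "disjoint_family_on (\<lambda>i. {s i<..<t i}) {..<n}"
    using assms(1) unfolding variation_sums_def by auto
  show ?thesis
  proof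
    show "(\<Sum>i<n. \<bar>f (min y (t i)) - f (min y (s i))\<bar>) \<in> variation_sums f x y"
      unfolding variation_sums_def
    proof (intro CollectI exI conjI, rule refl)
      show "\<forall>i<n. x \<le> min y (s i) \<and> min y (s i) \<le> min y (t i) \<and> min y (t i) \<le> y"
        using st assms by auto
      show "disjoint_family_on (\<lambda>i. {min y (s i)<..<min y (t i)}) {..<n}"
        using dj by (fastforce simp: disjoint_family_on_def)
    qed
    show "(\<Sum>i<n. \<bar>f (max y (t i)) - f (max y (s i))\<bar>) \<in> variation_sums f y z"
      unfolding variation_sums_def
    proof (intro CollectI exI conjI, rule refl)
      show "\<forall>i<n. y \<le> max y (s i) \<and> max y (s i) \<le> max y (t i) \<and> max y (t i) \<le> z"
        using st assms by auto
      show "disjoint_family_on (\<lambda>i. {max y (s i)<..<max y (t i)}) {..<n}"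
        using dj by (fastforce simp: disjoint_family_on_def)
    qed
    \<comment> \<open>Term by term: an interval on one side of \<open>y\<close> degenerates in the
      other family, and one containing \<open>y\<close> is cut there, so the triangle inequality
      applies.\<close>
    show "S \<le> (\<Sum>i<n. \<bar>f (min y (t i)) - f (min y (s i))\<bar>) + (\<Sum>i<n. \<bar>f (max y (t i)) - f (max y (s i))\<bar>)"
      unfolding S sum.distrib[symmetric]
      by (intro sum_mono) (auto simp: min_def max_def)
  qed
qed

lemma variation_sums_append:
  assumes "S \<in> variation_sums f x y" "x \<le> y" "y \<le> z"
  shows "S + \<bar>f z - f y\<bar> \<in> variation_sums f x z"
proof -
  obtain n :: nat and s t where S: "S = (\<Sum>i<n. \<bar>f (t i) - f (s i)\<bar>)"
    and st: "\<forall>i<n. x \<le> s i \<and> s i \<le> t i \<and> t i \<le> y"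
    and dj: "disjoint_family_on (\<lambda>i. {s i<..<t i}) {..<n}"
    using assms(1) unfolding variation_sums_def by auto
  have eq: "S + \<bar>f z - f y\<bar> = (\<Sum>i<Suc n. \<bar>f ((t(n := z)) i) - f ((s(n := y)) i)\<bar>)"
    unfolding S by simp
  show ?thesis unfolding variation_sums_def
  proof (intro CollectI exI conjI, rule eq)
    show "\<forall>i<Suc n. x \<le> (s(n := y)) i \<and> (s(n := y)) i \<le> (t(n := z)) i \<and> (t(n := z)) i \<le> z"
      using st assms by (auto simp: less_Suc_eq)
    show "disjoint_family_on (\<lambda>i. {(s(n := y)) i<..<(t(n := z)) i}) {..<Suc n}"
      unfolding disjoint_family_on_def
    proof (intro ballI impI)
      fix k l assume kl: "k \<in> {..<Suc n}" "l \<in> {..<Suc n}" "k \<noteq> l"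
      have below: "{s i<..<t i} \<inter> {y<..<z} = {}" if "i < n" for i using st that by fastforce
      show "{(s(n := y)) k<..<(t(n := z)) k} \<inter> {(s(n := y)) l<..<(t(n := z)) l} = {}"
      proof (cases "k = n \<or> l = n")
        case True then show ?thesis using below[of k] below[of l] kl by (auto simp: less_Suc_eq)
      next
        case False then show ?thesis using dj kl by (simp add: disjoint_family_on_def less_Suc_eq)
      qed
    qed
  qed
qed

text \<open>With tolerance 1, every subinterval shorter than \<open>d\<close> has variation at most
  1, because the lengths of a disjoint family inside it add up to less than \<open>d\<close>.
  Bolzano's bisection principle carries boundedness over to long intervals, with
  \<open>variation_sums_split\<close> as the gluing step.\<close>

lemma abs_continuous_bdd_variation:
  assumes f: "abs_continuous_on_interval a b f" and "a \<le> x" "x \<le> y" "y \<le> b"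
  shows "bdd_above (variation_sums f x y)"
proof -
  obtain d where d: "d > 0" "\<And>(n::nat) s t. \<lbrakk>\<forall>i<n. a \<le> s i \<and> s i \<le> t i \<and> t i \<le> b;
       disjoint_family_on (\<lambda>i. {s i<..<t i}) {..<n}; (\<Sum>i<n. t i - s i) < d\<rbrakk> \<Longrightarrow>
       (\<Sum>i<n. norm (f (t i) - f (s i))) < 1"
    using f[unfolded abs_continuous_on_interval_def, rule_format, OF zero_less_one] by blast
  have "a \<le> x \<longrightarrow> y \<le> b \<longrightarrow> bdd_above (variation_sums f x y)"
    using \<open>x \<le> y\<close>
  proof (induction rule: Bolzano[consumes 1, case_names trans local])
    case (trans x y z)
    show ?case
    proof (intro impI)
      assume xz: "a \<le> x" "z \<le> b"
      obtain B1 where B1: "\<And>S. S \<in> variation_sums f x y \<Longrightarrow> S \<le> B1"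
        using trans xz by (auto simp: bdd_above_def)
      obtain B2 where B2: "\<And>S. S \<in> variation_sums f y z \<Longrightarrow> S \<le> B2"
        using trans xz by (auto simp: bdd_above_def)
      show "bdd_above (variation_sums f x z)"
      proof (rule bdd_aboveI[of _ "B1 + B2"])
        fix S assume "S \<in> variation_sums f x z"
        then obtain S1 S2 where "S1 \<in> variation_sums f x y" "S2 \<in> variation_sums f y z" "S \<le> S1 + S2"
          using variation_sums_split trans by blast
        then show "S \<le> B1 + B2" using B1[of S1] B2[of S2] by linarith
      qed
    qed
  next
    case (local x)
    show ?case
    proof (intro exI[of _ d] conjI allI impI d(1))
      fix u v assume uv: "u \<le> x \<and> x \<le> v \<and> v - u < d" "a \<le> u" "v \<le> b"
      show "bdd_above (variation_sums f u v)"
      proof (rule bdd_aboveI[of _ 1])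
        fix S assume "S \<in> variation_sums f u v"
        then obtain n :: nat and s t where S: "S = (\<Sum>i<n. \<bar>f (t i) - f (s i)\<bar>)"
          and st: "\<forall>i<n. u \<le> s i \<and> s i \<le> t i \<and> t i \<le> v"
          and dj: "disjoint_family_on (\<lambda>i. {s i<..<t i}) {..<n}"
          unfolding variation_sums_def by auto
        have "(\<Sum>i<n. t i - s i) \<le> v - u"
          using st dj uv by (intro sum_length_disjoint_le) auto
        also have "\<dots> < d" using uv by simp
        finally have "(\<Sum>i<n. t i - s i) < d" .
        moreover have "\<forall>i<n. a \<le> s i \<and> s i \<le> t i \<and> t i \<le> b" using st uv by force
        ultimately have "(\<Sum>i<n. norm (f (t i) - f (s i))) < 1" using d(2) dj by blast
        then show "S \<le> 1" by (simp add: S)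
      qed
    qed
  qed
  with assms show ?thesis by simp
qed

text \<open>Any family on \<open>{a..x}\<close> can be lengthened by the interval from
  \<open>x\<close> to \<open>y\<close>. The inequality makes both the total variation
  \<open>V\<close> and \<open>V - f\<close> nondecreasing, which is what the Jordan decomposition
  needs.\<close>

lemma total_variation_ge_diff:
  assumes f: "abs_continuous_on_interval a b f" and "a \<le> x" "x \<le> y" "y \<le> b"
  shows "total_variation f a x + \<bar>f y - f x\<bar> \<le> total_variation f a y"
proof -
  have "S \<le> total_variation f a y - \<bar>f y - f x\<bar>" if "S \<in> variation_sums f a x" for S
  proof -
    have "S + \<bar>f y - f x\<bar> \<le> total_variation f a y"
      unfolding total_variation_def
      using assms by (intro cSup_upper variation_sums_append[OF that] abs_continuous_bdd_variation[OF f]) auto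
    then show ?thesis by simp
  qed
  then have "total_variation f a x \<le> total_variation f a y - \<bar>f y - f x\<bar>"
    unfolding total_variation_def[of f a x] using zero_in_variation_sums[of f a x]
    by (intro cSup_least) auto
  then show ?thesis by simp
qed

lemma total_variation_subadd:
  assumes f: "abs_continuous_on_interval a b f" and "a \<le> x" "x \<le> y" "y \<le> b"
  shows "total_variation f a y \<le> total_variation f a x + total_variation f x y"
  unfolding total_variation_def[of f a y]
proof (rule cSup_least)
  show "variation_sums f a y \<noteq> {}" using zero_in_variation_sums[of f a y] by auto
  fix S assume "S \<in> variation_sums f a y"
  then obtain S1 S2 where S: "S1 \<in> variation_sums f a x" "S2 \<in> variation_sums f x y" "S \<le> S1 + S2"
    using variation_sums_split assms by blast
  have "S1 \<le> total_variation f a x" "S2 \<le> total_variation f x y"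
    unfolding total_variation_def
    by (rule cSup_upper[OF S(1) abs_continuous_bdd_variation[OF f]]; use assms in simp)
       (rule cSup_upper[OF S(2) abs_continuous_bdd_variation[OF f]]; use assms in simp)
  then show "S \<le> total_variation f a x + total_variation f x y" using S(3) by linarith
qed

text \<open>Inside each given interval some finite family almost realises the variation there. All
  these families together are again disjoint and have no more total length than the given intervals,
  so the absolute continuity of \<open>f\<close> controls their sum.\<close>

lemma abs_continuous_total_variation:
  assumes f: "abs_continuous_on_interval a b f"
  shows "abs_continuous_on_interval a b (total_variation f a)"
  unfolding abs_continuous_on_interval_def
proof (intro allI impI)
  fix \<epsilon> :: real assume \<epsilon>: "\<epsilon> > 0"
  obtain \<delta> where \<delta>: "\<delta> > 0" "\<And>(I::(nat \<times> nat) set) s t. \<lbrakk>finite I; \<And>i. i \<in> I \<Longrightarrow> a \<le> s i \<and> s i \<le> t i \<and> t i \<le> b;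
        disjoint_family_on (\<lambda>i. {s i<..<t i}) I; (\<Sum>i\<in>I. t i - s i) < \<delta>\<rbrakk>
      \<Longrightarrow> (\<Sum>i\<in>I. norm (f (t i) - f (s i))) < \<epsilon> / 2"
    by (rule abs_continuous_on_interval_finite_index[OF f half_gt_zero[OF \<epsilon>]]) blast
  show "\<exists>\<delta>>0. \<forall>(n::nat) s t. (\<forall>i<n. a \<le> s i \<and> s i \<le> t i \<and> t i \<le> b) \<longrightarrow>
       disjoint_family_on (\<lambda>i. {s i<..<t i}) {..<n} \<longrightarrow> (\<Sum>i<n. t i - s i) < \<delta> \<longrightarrow>
       (\<Sum>i<n. norm (total_variation f a (t i) - total_variation f a (s i))) < \<epsilon>"
  proof (intro exI[of _ \<delta>] conjI allI impI \<delta>(1))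
    fix n :: nat and s t :: "nat \<Rightarrow> real"
    assume st: "\<forall>i<n. a \<le> s i \<and> s i \<le> t i \<and> t i \<le> b"
      and dj: "disjoint_family_on (\<lambda>i. {s i<..<t i}) {..<n}" and len: "(\<Sum>i<n. t i - s i) < \<delta>"
    \<comment> \<open>Each of the \<open>n\<close> intervals may lose \<open>\<eta>\<close>, in
      total less than \<open>\<epsilon> / 2\<close>; the \<open>+ 1\<close> keeps the denominator
      positive for \<open>n = 0\<close>.\<close>
    define \<eta> where "\<eta> = \<epsilon> / (2 * (real n + 1))"
    have \<eta>: "\<eta> > 0" "real n * \<eta> < \<epsilon> / 2" using \<epsilon> by (auto simp: \<eta>_def field_simps)
    define Q where "Q = (\<lambda>i m s' t'. (\<forall>j<m. s i \<le> s' j \<and> s' j \<le> t' j \<and> t' j \<le> t i) \<and>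
        disjoint_family_on (\<lambda>j. {s' j<..<t' j}) {..<m::nat} \<and>
        total_variation f (s i) (t i) < (\<Sum>j<m. \<bar>f (t' j) - f (s' j)\<bar>) + \<eta>)"
    have "\<exists>m s' t'. Q i m s' t'" for i
    proof -
      have "\<exists>S\<in>variation_sums f (s i) (t i). total_variation f (s i) (t i) - \<eta> < S"
        using \<eta>(1) zero_in_variation_sums[of f "s i" "t i"]
        unfolding total_variation_def by (intro less_cSupD) auto
      then obtain m :: nat and s' t' where
        "total_variation f (s i) (t i) - \<eta> < (\<Sum>j<m. \<bar>f (t' j) - f (s' j)\<bar>)"
        "\<forall>j<m. s i \<le> s' j \<and> s' j \<le> t' j \<and> t' j \<le> t i"
        "disjoint_family_on (\<lambda>j. {s' j<..<t' j}) {..<m}"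
        unfolding variation_sums_def by blast
      then have "Q i m s' t'" unfolding Q_def by simp
      then show ?thesis by blast
    qed
    then obtain m s' t' where mst: "\<And>i. Q i (m i) (s' i) (t' i)"
      by metis
    have mst1: "s i \<le> s' i j \<and> s' i j \<le> t' i j \<and> t' i j \<le> t i" if "j < m i" for i j
      using mst[of i] that unfolding Q_def by blast
    have mst2: "disjoint_family_on (\<lambda>j. {s' i j<..<t' i j}) {..<m i}" for i
      using mst[of i] unfolding Q_def by blast
    have mst3: "total_variation f (s i) (t i) < (\<Sum>j<m i. \<bar>f (t' i j) - f (s' i j)\<bar>) + \<eta>" for i
      using mst[of i] unfolding Q_def by blast
    define I where "I = Sigma {..<n} (\<lambda>i. {..<m i})"
    have "(\<Sum>k\<in>I. norm (f (case_prod t' k) - f (case_prod s' k))) < \<epsilon> / 2"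
    proof (rule \<delta>(2))
      show "finite I" by (auto simp: I_def)
      show "a \<le> case_prod s' k \<and> case_prod s' k \<le> case_prod t' k \<and> case_prod t' k \<le> b" if "k \<in> I" for k
        using that mst1 st unfolding I_def by force
      show "disjoint_family_on (\<lambda>k. {case_prod s' k<..<case_prod t' k}) I"
        unfolding disjoint_family_on_def
      proof (intro ballI impI)
        fix k l assume kl: "k \<in> I" "l \<in> I" "k \<noteq> l"
        obtain i j where k: "k = (i, j)" by force
        obtain i' j' where l: "l = (i', j')" by force
        have ij: "i < n" "j < m i" "i' < n" "j' < m i'" using kl by (auto simp: I_def k l)
        show "{case_prod s' k<..<case_prod t' k} \<inter> {case_prod s' l<..<case_prod t' l} = {}"
        proof (cases "i = i'")
          case True
          then have "j \<noteq> j'" using kl k l by auto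
          then show ?thesis using mst2[of i] ij True unfolding k l disjoint_family_on_def by auto
        next
          case False
          have "{s i<..<t i} \<inter> {s i'<..<t i'} = {}"
            using dj ij False by (auto simp: disjoint_family_on_def)
          then show ?thesis using mst1[of j i] mst1[of j' i'] ij unfolding k l by fastforce
        qed
      qed
      have "(\<Sum>k\<in>I. case_prod t' k - case_prod s' k) = (\<Sum>i<n. \<Sum>j<m i. t' i j - s' i j)"
        unfolding I_def by (subst sum.Sigma) (auto simp: case_prod_beta)
      also have "\<dots> \<le> (\<Sum>i<n. t i - s i)"
      proof (rule sum_mono)
        fix i assume "i \<in> {..<n}" then have i: "i < n" by simp
        show "(\<Sum>j<m i. t' i j - s' i j) \<le> t i - s i"
          using mst1[of _ i] mst2[of i] st i by (intro sum_length_disjoint_le) auto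
      qed
      finally show "(\<Sum>k\<in>I. case_prod t' k - case_prod s' k) < \<delta>" using len by linarith
    qed
    moreover have "(\<Sum>k\<in>I. norm (f (case_prod t' k) - f (case_prod s' k)))
        = (\<Sum>i<n. \<Sum>j<m i. \<bar>f (t' i j) - f (s' i j)\<bar>)"
      unfolding I_def by (subst sum.Sigma) (auto simp: case_prod_beta)
    moreover have "(\<Sum>i<n. norm (total_variation f a (t i) - total_variation f a (s i)))
        \<le> (\<Sum>i<n. (\<Sum>j<m i. \<bar>f (t' i j) - f (s' i j)\<bar>) + \<eta>)"
    proof (rule sum_mono)
      fix i assume "i \<in> {..<n}" then have i: "i < n" by simp
      have "total_variation f a (s i) \<le> total_variation f a (t i)"
        using total_variation_ge_diff[OF f, of "s i" "t i"] st i by fastforce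
      moreover have "total_variation f a (t i) \<le> total_variation f a (s i) + total_variation f (s i) (t i)"
        using total_variation_subadd[OF f, of "s i" "t i"] st i by blast
      ultimately show "norm (total_variation f a (t i) - total_variation f a (s i))
          \<le> (\<Sum>j<m i. \<bar>f (t' i j) - f (s' i j)\<bar>) + \<eta>"
        using mst3[of i] by simp
    qed
    ultimately show "(\<Sum>i<n. norm (total_variation f a (t i) - total_variation f a (s i))) < \<epsilon>"
      using \<eta>(2) by (simp add: sum.distrib)
  qed
qed

section \<open>Stability of absolute continuity under dominated increments\<close>

text \<open>The hypothesis is summed over a short family, so a single estimate serves differences,
  products and Lipschitz images. The three functions may take values in different spaces.\<close>

lemma abs_continuous_on_interval_dominated:
  fixes f :: "real \<Rightarrow> 'a::real_normed_vector" and h :: "real \<Rightarrow> 'b::real_normed_vector"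
    and g :: "real \<Rightarrow> 'c::real_normed_vector"
  assumes f: "abs_continuous_on_interval a b f" and h: "abs_continuous_on_interval a b h"
    and le: "\<And>x y. a \<le> x \<Longrightarrow> x \<le> y \<Longrightarrow> y \<le> b \<Longrightarrow>
        norm (g y - g x) \<le> B * norm (f y - f x) + B * norm (h y - h x)"
  shows "abs_continuous_on_interval a b g"
  unfolding abs_continuous_on_interval_def
proof (intro allI impI)
  fix \<epsilon> :: real assume \<epsilon>: "\<epsilon> > 0"
  \<comment> \<open>No sign is imposed on \<open>B\<close>, hence \<open>\<bar>B\<bar> + 1\<close>
    as a positive substitute; the 2 accounts for the two sums.\<close>
  define \<eta> where "\<eta> = \<epsilon> / (2 * (\<bar>B\<bar> + 1))"
  have \<eta>: "\<eta> > 0" using \<epsilon> by (simp add: \<eta>_def)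
  obtain \<delta>1 where \<delta>1: "\<delta>1 > 0" "\<And>(n::nat) s t. \<lbrakk>\<forall>i<n. a \<le> s i \<and> s i \<le> t i \<and> t i \<le> b;
       disjoint_family_on (\<lambda>i. {s i<..<t i}) {..<n}; (\<Sum>i<n. t i - s i) < \<delta>1\<rbrakk> \<Longrightarrow>
       (\<Sum>i<n. norm (f (t i) - f (s i))) < \<eta>"
    using f[unfolded abs_continuous_on_interval_def, rule_format, OF \<eta>] by blast
  obtain \<delta>2 where \<delta>2: "\<delta>2 > 0" "\<And>(n::nat) s t. \<lbrakk>\<forall>i<n. a \<le> s i \<and> s i \<le> t i \<and> t i \<le> b;
       disjoint_family_on (\<lambda>i. {s i<..<t i}) {..<n}; (\<Sum>i<n. t i - s i) < \<delta>2\<rbrakk> \<Longrightarrow>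
       (\<Sum>i<n. norm (h (t i) - h (s i))) < \<eta>"
    using h[unfolded abs_continuous_on_interval_def, rule_format, OF \<eta>] by blast
  show "\<exists>\<delta>>0. \<forall>(n::nat) s t. (\<forall>i<n. a \<le> s i \<and> s i \<le> t i \<and> t i \<le> b) \<longrightarrow>
       disjoint_family_on (\<lambda>i. {s i<..<t i}) {..<n} \<longrightarrow> (\<Sum>i<n. t i - s i) < \<delta> \<longrightarrow>
       (\<Sum>i<n. norm (g (t i) - g (s i))) < \<epsilon>"
  proof (intro exI[of _ "min \<delta>1 \<delta>2"] conjI allI impI)
    show "0 < min \<delta>1 \<delta>2" using \<delta>1 \<delta>2 by simp
    fix n :: nat and s t :: "nat \<Rightarrow> real"
    assume st: "\<forall>i<n. a \<le> s i \<and> s i \<le> t i \<and> t i \<le> b"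
      and dj: "disjoint_family_on (\<lambda>i. {s i<..<t i}) {..<n}"
      and len: "(\<Sum>i<n. t i - s i) < min \<delta>1 \<delta>2"
    let ?F = "\<Sum>i<n. norm (f (t i) - f (s i))" and ?H = "\<Sum>i<n. norm (h (t i) - h (s i))"
    have F: "?F < \<eta>" using \<delta>1(2)[OF st dj] len by simp
    have H: "?H < \<eta>" using \<delta>2(2)[OF st dj] len by simp
    have "(\<Sum>i<n. norm (g (t i) - g (s i)))
        \<le> (\<Sum>i<n. B * norm (f (t i) - f (s i)) + B * norm (h (t i) - h (s i)))"
      using st by (intro sum_mono le) auto
    also have "\<dots> = B * (?F + ?H)"
      by (simp add: sum.distrib sum_distrib_left distrib_left)
    also have "\<dots> \<le> \<bar>B\<bar> * (?F + ?H)"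
      by (intro mult_right_mono add_nonneg_nonneg sum_nonneg) auto
    also have "\<dots> \<le> \<bar>B\<bar> * (2 * \<eta>)" using F H by (intro mult_left_mono) auto
    also have "\<dots> < (\<bar>B\<bar> + 1) * (2 * \<eta>)" using \<eta> by simp
    also have "\<dots> = \<epsilon>" by (simp add: \<eta>_def add_nonneg_eq_0_iff field_simps)
    finally show "(\<Sum>i<n. norm (g (t i) - g (s i))) < \<epsilon>" .
  qed
qed

lemma abs_continuous_on_interval_lipschitz_compose:
  assumes f: "abs_continuous_on_interval a b f"
    and "\<And>x y. a \<le> x \<Longrightarrow> x \<le> y \<Longrightarrow> y \<le> b \<Longrightarrow> norm (g y - g x) \<le> B * norm (f y - f x)"
  shows "abs_continuous_on_interval a b g"
proof (rule abs_continuous_on_interval_dominated[OF f f])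
  fix x y assume "a \<le> x" "x \<le> y" "y \<le> b"
  then show "norm (g y - g x) \<le> B/2 * norm (f y - f x) + B/2 * norm (f y - f x)"
    using assms(2) by simp
qed

lemma abs_continuous_on_interval_mult:
  fixes f h :: "real \<Rightarrow> 'a::real_normed_algebra"
  assumes f: "abs_continuous_on_interval a b f" and h: "abs_continuous_on_interval a b h"
  shows "abs_continuous_on_interval a b (\<lambda>x. f x * h x)"
proof -
  have "compact (f ` {a..b})" "compact (h ` {a..b})"
    using abs_continuous_on_interval_imp_continuous_on[OF f]
      abs_continuous_on_interval_imp_continuous_on[OF h] by (auto intro: compact_continuous_image)
  then have "bounded (f ` {a..b})" "bounded (h ` {a..b})" by (auto intro: compact_imp_bounded)
  then obtain B1 B2 where B: "\<forall>x\<in>{a..b}. norm (f x) \<le> B1" "\<forall>x\<in>{a..b}. norm (h x) \<le> B2"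
    unfolding bounded_iff by auto
  define B where "B = max B1 B2"
  show ?thesis
  proof (rule abs_continuous_on_interval_dominated[OF f h, where B = B])
    fix x y assume xy: "a \<le> x" "x \<le> y" "y \<le> b"
    have "f y * h y - f x * h x = (f y - f x) * h y + f x * (h y - h x)" by (simp add: algebra_simps)
    then have "norm (f y * h y - f x * h x) \<le> norm (f y - f x) * norm (h y) + norm (f x) * norm (h y - h x)"
      by (metis norm_triangle_le add_mono norm_mult_ineq)
    also have "\<dots> \<le> norm (f y - f x) * B + B * norm (h y - h x)"
      using bspec[OF B(1), of x] bspec[OF B(2), of y] xy
      by (intro add_mono mult_left_mono mult_right_mono) (simp_all add: B_def le_max_iff_disj)
    finally show "norm (f y * h y - f x * h x) \<le> B * norm (f y - f x) + B * norm (h y - h x)"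
      by (simp add: mult.commute)
  qed
qed

section \<open>The fundamental theorem of calculus for absolutely continuous functions\<close>

text \<open>Outer regularity encloses a bounded null set in an open \<open>T\<close> of small
  length. The mass of nonoverlapping closed intervals inside \<open>T\<close> is the sum of the
  increments of \<open>G\<close> over them, which absolute continuity makes small.\<close>

lemma mono_continuous_interval_measure_ac:
  fixes G :: "real \<Rightarrow> real"
  assumes mono: "\<And>x y. x \<le> y \<Longrightarrow> G x \<le> G y" and cont: "continuous_on UNIV G"
    and ac: "\<And>a b. abs_continuous_on_interval a b G"
  shows "absolutely_continuous lborel (interval_measure G)"
  unfolding absolutely_continuous_def
proof (rule subsetI)
  let ?M = "interval_measure G"
  have Icc: "emeasure ?M {a..b} = G b - G a" if "a \<le> b" for a b
    by (rule emeasure_interval_measure_Icc[OF that mono cont])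
  have bounded: "emeasure ?M S = 0" if S: "S \<in> null_sets lborel" "S \<subseteq> {l..u}" "l < u" for S l u
  proof -
    have "emeasure ?M S \<le> ennreal \<epsilon>" if \<epsilon>: "\<epsilon> > 0" for \<epsilon>
    proof -
      obtain \<delta> where \<delta>: "\<delta> > 0" "\<And>(I::real set set) s t. \<lbrakk>finite I; \<And>i. i \<in> I \<Longrightarrow> l \<le> s i \<and> s i \<le> t i \<and> t i \<le> u;
          disjoint_family_on (\<lambda>i. {s i<..<t i}) I; (\<Sum>i\<in>I. t i - s i) < \<delta>\<rbrakk>
        \<Longrightarrow> (\<Sum>i\<in>I. norm (G (t i) - G (s i))) < \<epsilon>"
        by (rule abs_continuous_on_interval_finite_index[OF ac \<epsilon>]) blast
      have Sb: "S \<in> sets borel" using S(1) by auto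
      obtain T where T: "open T" "S \<subseteq> T" "emeasure lborel (T - S) < ennreal \<delta>"
        using outer_regular_lborel[OF Sb \<delta>(1)] by blast
      have "emeasure lborel T \<le> emeasure lborel (T - S) + emeasure lborel S"
        using T Sb by (intro order.trans[OF _ emeasure_subadditive] emeasure_mono) auto
      then have T\<delta>: "emeasure lborel T < ennreal \<delta>" using T(3) S(1) by (auto simp: null_setsD1)
      \<comment> \<open>Every interval of the covering is tagged by a point of \<open>S\<close>, so
        this gauge forces it into \<open>T\<close>.\<close>
      define g where "g = (\<lambda>x. if x \<in> S then T else UNIV)"
      have "gauge g" using T by (auto simp: gauge_def g_def)
      obtain \<D> where D: "countable \<D>" "\<Union>\<D> \<subseteq> cbox l u"
        "\<And>K. K \<in> \<D> \<Longrightarrow> interior K \<noteq> {} \<and> (\<exists>c d. K = cbox c d)"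
        "pairwise (\<lambda>A B. interior A \<inter> interior B = {}) \<D>"
        "\<And>K. K \<in> \<D> \<Longrightarrow> \<exists>x \<in> S \<inter> K. K \<subseteq> g x" "S \<subseteq> \<Union>\<D>"
        by (rule covering_lemma[of S l u g]) (use S(2,3) \<open>gauge g\<close> in auto)
      have K: "K = {Inf K..Sup K} \<and> Inf K < Sup K \<and> K \<subseteq> T" if KD: "K \<in> \<D>" for K
      proof -
        obtain c d where cd: "K = cbox c d" using D(3)[OF KD] by blast
        have "c < d" using D(3)[OF KD] unfolding cd by auto
        moreover have "K \<subseteq> T" using D(5)[OF KD] by (auto simp: g_def split: if_splits)
        ultimately show ?thesis unfolding cd by auto
      qed
      have meas: "K \<in> fmeasurable ?M" if "K \<in> \<D>" for K
        using K[OF that] Icc[of "Inf K" "Sup K"] by (metis fmeasurableI less_imp_le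
            sets_interval_measure atLeastAtMost_borel ennreal_less_top infinity_ennreal_def)
      \<comment> \<open>Absolute continuity sees only finite families; a bound uniform over the
        finite subfamilies passes to the countable union.\<close>
      have fin: "measure ?M (\<Union>I') \<le> \<epsilon>" if I': "I' \<subseteq> \<D>" "finite I'" for I'
      proof -
        have dj: "disjoint_family_on (\<lambda>K. {Inf K<..<Sup K}) I'"
          unfolding disjoint_family_on_def
        proof (intro ballI impI)
          fix A B assume AB: "A \<in> I'" "B \<in> I'" "A \<noteq> B"
          then have "interior A \<inter> interior B = {}" using D(4) I' by (auto simp: pairwise_def)
          moreover have "interior A = {Inf A<..<Sup A}" "interior B = {Inf B<..<Sup B}"
            using K AB I' by (metis interior_atLeastAtMost_real subsetD)+
          ultimately show "{Inf A<..<Sup A} \<inter> {Inf B<..<Sup B} = {}" by simp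
        qed
        have "measure ?M (\<Union>I') \<le> (\<Sum>K\<in>I'. measure ?M K)"
          using measure_UNION_le[of I' "\<lambda>K. K" ?M, OF I'(2) fmeasurableD[OF meas]] I'(1) by auto
        also have "\<dots> = (\<Sum>K\<in>I'. norm (G (Sup K) - G (Inf K)))"
        proof (rule sum.cong)
          fix A assume "A \<in> I'"
          then have A: "A = {Inf A..Sup A}" "Inf A < Sup A" using K I' by blast+
          have "emeasure ?M A = ennreal (G (Sup A) - G (Inf A))" using Icc[of "Inf A" "Sup A"] A by simp
          then show "measure ?M A = norm (G (Sup A) - G (Inf A))"
            using mono[of "Inf A" "Sup A"] A by (simp add: measure_def)
        qed simp
        also have "\<dots> < \<epsilon>"
        proof (rule \<delta>(2)[OF I'(2) _ dj])
          show "l \<le> Inf A \<and> Inf A \<le> Sup A \<and> Sup A \<le> u" if A: "A \<in> I'" for A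
          proof -
            have "Inf A < Sup A" "A = {Inf A..Sup A}" "A \<subseteq> cbox l u" using K A I' D(2) by blast+
            then have "Inf A \<in> cbox l u" "Sup A \<in> cbox l u"
              by (metis atLeastAtMost_iff order_refl less_imp_le subsetD)+
            then show ?thesis using \<open>Inf A < Sup A\<close> by simp
          qed
          have KI: "Inf K < Sup K" if "K \<in> I'" for K using K I'(1) that by blast
          have "(\<Sum>K\<in>I'. ennreal (Sup K - Inf K)) = (\<Sum>K\<in>I'. emeasure lborel {Inf K<..<Sup K})"
            using KI by (intro sum.cong) (simp_all add: less_imp_le)
          also have "\<dots> = emeasure lborel (\<Union>K\<in>I'. {Inf K<..<Sup K})"
            using dj I'(2) by (intro sum_emeasure) auto
          also have "\<dots> \<le> emeasure lborel T"
          proof (rule emeasure_mono)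
            show "(\<Union>K\<in>I'. {Inf K<..<Sup K}) \<subseteq> T"
            proof (rule UN_least)
              fix A assume "A \<in> I'"
              then have "{Inf A..Sup A} \<subseteq> T" using K I'(1) by (metis subsetD)
              then show "{Inf A<..<Sup A} \<subseteq> T" by (meson greaterThanLessThan_subseteq_atLeastAtMost_iff order.refl order.trans)
            qed
          qed (use T in auto)
          also have "\<dots> < ennreal \<delta>" by (rule T\<delta>)
          finally have "(\<Sum>K\<in>I'. ennreal (Sup K - Inf K)) < ennreal \<delta>" .
          moreover have "(\<Sum>K\<in>I'. ennreal (Sup K - Inf K)) = ennreal (\<Sum>K\<in>I'. Sup K - Inf K)"
            using KI by (intro sum_ennreal) (simp add: less_imp_le)
          ultimately show "(\<Sum>K\<in>I'. Sup K - Inf K) < \<delta>"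
            using \<delta>(1) by (metis ennreal_leI not_le)
        qed
        finally show ?thesis by simp
      qed
      have "\<Union>\<D> \<in> fmeasurable ?M" "measure ?M (\<Union>\<D>) \<le> \<epsilon>"
        by (rule fmeasurable_Union_bound[OF D(1) meas fin]; assumption)
           (rule measure_Union_bound[OF D(1) meas fin]; assumption)
      then have "emeasure ?M (\<Union>\<D>) \<le> ennreal \<epsilon>"
        by (simp add: emeasure_eq_measure2 fmeasurableD2 ennreal_leI)
      moreover have "emeasure ?M S \<le> emeasure ?M (\<Union>\<D>)"
        using D(6) \<open>\<Union>\<D> \<in> fmeasurable ?M\<close> by (intro emeasure_mono) (auto dest: fmeasurableD)
      ultimately show ?thesis by (rule order.trans[rotated])
    qed
    then show ?thesis by (metis add_0 ennreal_le_epsilon le_zero_eq)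
  qed
  fix N :: "real set" assume N: "N \<in> null_sets lborel"
  \<comment> \<open>The claim above concerns bounded sets, so \<open>N\<close> is exhausted by
    bounded pieces; the extra 1 keeps the interval nondegenerate for \<open>k = 0\<close>.\<close>
  have "N \<inter> {-real k - 1..real k + 1} \<in> null_sets ?M" for k :: nat
  proof -
    have "N \<inter> {-real k - 1..real k + 1} \<in> null_sets lborel"
      using N by (intro null_set_Int2) auto
    then show ?thesis using bounded[of "N \<inter> {-real k - 1..real k + 1}" "-real k - 1" "real k + 1"]
      by (auto simp: null_sets_def)
  qed
  then have "(\<Union>k. N \<inter> {-real k - 1..real k + 1}) \<in> null_sets ?M" by (intro null_sets_UN)
  moreover have "(\<Union>k. N \<inter> {-real k - 1..real k + 1}) = N"
  proof (intro equalityI subsetI)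
    fix x assume "x \<in> N"
    obtain k :: nat where "\<bar>x\<bar> \<le> real k" using real_arch_simple by blast
    then show "x \<in> (\<Union>k. N \<inter> {-real k - 1..real k + 1})" using \<open>x \<in> N\<close> by (auto intro!: exI[of _ k])
  qed auto
  ultimately show "N \<in> null_sets ?M" by simp
qed

text \<open>The integrand is the Radon-Nikodym density of the Stieltjes measure of
  \<open>F\<close>.\<close>

lemma mono_abs_continuous_integral:
  fixes F :: "real \<Rightarrow> real"
  assumes F: "abs_continuous_on_interval a b F" and "a \<le> b"
    and mono: "\<And>x y. a \<le> x \<Longrightarrow> x \<le> y \<Longrightarrow> y \<le> b \<Longrightarrow> F x \<le> F y"
  obtains w where "w absolutely_integrable_on {a..b}"
    "\<And>x. x \<in> {a..b} \<Longrightarrow> (w has_integral (F x - F a)) {a..x}"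
proof -
  \<comment> \<open>Clamping continues \<open>F\<close> by constants to a monotone continuous
    function on the whole line, where the Stieltjes measure lives.\<close>
  define cl where "cl = (\<lambda>x. max a (min b x))"
  define G where "G = F \<circ> cl"
  have cl: "a \<le> cl x" "cl x \<le> b" "x \<le> y \<Longrightarrow> cl x \<le> cl y" for x y
    using \<open>a \<le> b\<close> by (auto simp: cl_def)
  have G_eq: "G x = F x" if "x \<in> {a..b}" for x using that by (simp add: G_def cl_def)
  have G_mono: "G x \<le> G y" if "x \<le> y" for x y unfolding G_def o_def by (intro mono cl that)
  have "continuous_on UNIV cl" unfolding cl_def by (intro continuous_intros)
  moreover have "continuous_on (cl ` UNIV) F"
    by (rule continuous_on_subset[OF abs_continuous_on_interval_imp_continuous_on[OF F]]) (use cl in auto)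
  ultimately have G_cont: "continuous_on UNIV G" unfolding G_def by (rule continuous_on_compose)
  have G_ac: "abs_continuous_on_interval l u G" for l u
    unfolding abs_continuous_on_interval_def
  proof (intro allI impI)
    fix \<epsilon> :: real assume \<epsilon>: "\<epsilon> > 0"
    obtain \<delta> where \<delta>: "\<delta> > 0" "\<And>(n::nat) s t. \<lbrakk>\<forall>i<n. a \<le> s i \<and> s i \<le> t i \<and> t i \<le> b;
       disjoint_family_on (\<lambda>i. {s i<..<t i}) {..<n}; (\<Sum>i<n. t i - s i) < \<delta>\<rbrakk> \<Longrightarrow>
       (\<Sum>i<n. norm (F (t i) - F (s i))) < \<epsilon>"
      using F[unfolded abs_continuous_on_interval_def, rule_format, OF \<epsilon>] by blast
    show "\<exists>\<delta>>0. \<forall>(n::nat) s t. (\<forall>i<n. l \<le> s i \<and> s i \<le> t i \<and> t i \<le> u) \<longrightarrow>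
       disjoint_family_on (\<lambda>i. {s i<..<t i}) {..<n} \<longrightarrow> (\<Sum>i<n. t i - s i) < \<delta> \<longrightarrow>
       (\<Sum>i<n. norm (G (t i) - G (s i))) < \<epsilon>"
    proof (intro exI[of _ \<delta>] conjI allI impI \<delta>(1))
      fix n :: nat and s t :: "nat \<Rightarrow> real"
      assume st: "\<forall>i<n. l \<le> s i \<and> s i \<le> t i \<and> t i \<le> u"
        and dj: "disjoint_family_on (\<lambda>i. {s i<..<t i}) {..<n}" and len: "(\<Sum>i<n. t i - s i) < \<delta>"
      show "(\<Sum>i<n. norm (G (t i) - G (s i))) < \<epsilon>"
        unfolding G_def o_def
      proof (rule \<delta>(2))
        show "\<forall>i<n. a \<le> cl (s i) \<and> cl (s i) \<le> cl (t i) \<and> cl (t i) \<le> b" using cl st by simp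
        \<comment> \<open>A point strictly inside a clamped interval already lies strictly inside
          the original one.\<close>
        show "disjoint_family_on (\<lambda>i. {cl (s i)<..<cl (t i)}) {..<n}"
          by (rule disjoint_family_on_bisimulation[OF dj])
            (fastforce simp: cl_def max_def min_def disjoint_iff split: if_splits)
        have "(\<Sum>i<n. cl (t i) - cl (s i)) \<le> (\<Sum>i<n. t i - s i)"
          using st by (intro sum_mono) (force simp: cl_def max_def min_def)
        then show "(\<Sum>i<n. cl (t i) - cl (s i)) < \<delta>" using len by simp
      qed
    qed
  qed
  obtain h where h: "h \<in> borel_measurable lborel" "density lborel h = interval_measure G"
    using sigma_finite_measure.Radon_Nikodym[OF lborel.sigma_finite_measure_axioms
      mono_continuous_interval_measure_ac[OF G_mono G_cont G_ac]] by auto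
  have hb [measurable]: "h \<in> borel_measurable borel" using h(1) by simp
  \<comment> \<open>The density \<open>h\<close> may be infinite; its mass on \<open>{a..b}\<close>
    is finite, so it is finite almost everywhere there and passing to real values does not affect
    integrals over subintervals.\<close>
  define w where "w = (\<lambda>x. enn2real (h x))"
  have nn: "(\<integral>\<^sup>+y. h y * indicator {a..x} y \<partial>lborel) = ennreal (F x - F a)" if "x \<in> {a..b}" for x
  proof -
    have "(\<integral>\<^sup>+y. h y * indicator {a..x} y \<partial>lborel) = emeasure (density lborel h) {a..x}"
      by (subst emeasure_density) auto
    also have "\<dots> = ennreal (G x - G a)"
      unfolding h(2) using that by (intro emeasure_interval_measure_Icc[OF _ G_mono G_cont]) auto
    finally show ?thesis using G_eq that \<open>a \<le> b\<close> by simp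
  qed
  have "AE y in lborel. h y * indicator {a..b} y \<noteq> \<infinity>"
    using nn[of b] \<open>a \<le> b\<close> by (intro nn_integral_noteq_infinite) auto
  then have fin: "AE y in lborel. y \<in> {a..b} \<longrightarrow> h y \<noteq> \<infinity>" by eventually_elim (auto split: split_indicator)
  have int: "(w has_integral (F x - F a)) {a..x}" if x: "x \<in> {a..b}" for x
  proof -
    have "((\<lambda>y. w y * indicator {a..x} y) has_integral (F x - F a)) UNIV"
    proof (rule nn_integral_has_integral)
      show "(\<lambda>y. w y * indicator {a..x} y) \<in> borel_measurable borel" unfolding w_def by measurable
      show "0 \<le> w y * indicator {a..x} y" for y by (simp add: w_def)
      have "(\<integral>\<^sup>+y. ennreal (w y * indicator {a..x} y) \<partial>lborel) = (\<integral>\<^sup>+y. h y * indicator {a..x} y \<partial>lborel)"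
        using fin by (intro nn_integral_cong_AE, eventually_elim)
          (use x in \<open>auto simp: w_def split: split_indicator simp: less_top\<close>)
      then show "(\<integral>\<^sup>+y. ennreal (w y * indicator {a..x} y) \<partial>lborel) = ennreal (F x - F a)"
        using nn[OF x] by simp
      show "0 \<le> F x - F a" using mono[of a x] x by simp
    qed
    moreover have "(\<lambda>y. w y * indicator {a..x} y) = (\<lambda>y. if y \<in> {a..x} then w y else 0)"
      by (auto simp: indicator_def)
    ultimately show ?thesis by (simp only: has_integral_restrict_UNIV)
  qed
  show ?thesis
  proof
    show "w absolutely_integrable_on {a..b}"
      using int[of b] \<open>a \<le> b\<close> by (intro nonnegative_absolutely_integrable_1) (auto simp: w_def)
  qed (rule int)
qed


text \<open>Jordan decomposition \<open>f = V - (V - f)\<close> with \<open>V\<close> the total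
  variation: both parts are monotone and absolutely continuous, so the monotone case applies to
  each.\<close>

lemma abs_continuous_integral_real:
  fixes f :: "real \<Rightarrow> real"
  assumes f: "abs_continuous_on_interval a b f" and "a \<le> b"
  obtains w where "w absolutely_integrable_on {a..b}"
    "\<And>x. x \<in> {a..b} \<Longrightarrow> (w has_integral (f x - f a)) {a..x}"
proof -
  define V where "V = total_variation f a"
  have V: "abs_continuous_on_interval a b V"
    unfolding V_def by (rule abs_continuous_total_variation[OF f])
  have ge: "V x + \<bar>f y - f x\<bar> \<le> V y" if "a \<le> x" "x \<le> y" "y \<le> b" for x y
    unfolding V_def by (rule total_variation_ge_diff[OF f that])
  have U: "abs_continuous_on_interval a b (\<lambda>x. V x - f x)"
  proof (rule abs_continuous_on_interval_dominated[OF V f, where B = 1])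
    fix x y show "norm (V y - f y - (V x - f x)) \<le> 1 * norm (V y - V x) + 1 * norm (f y - f x)"
      using norm_triangle_ineq4[of "V y - V x" "f y - f x"] by (simp add: algebra_simps)
  qed
  have monoV: "V x \<le> V y" "V x - f x \<le> V y - f y" if "a \<le> x" "x \<le> y" "y \<le> b" for x y
    using ge[OF that] by linarith+
  obtain v where v: "v absolutely_integrable_on {a..b}"
    "\<And>x. x \<in> {a..b} \<Longrightarrow> (v has_integral (V x - V a)) {a..x}"
    using mono_abs_continuous_integral[OF V \<open>a \<le> b\<close> monoV(1)] by blast
  obtain u where u: "u absolutely_integrable_on {a..b}"
    "\<And>x. x \<in> {a..b} \<Longrightarrow> (u has_integral (V x - f x - (V a - f a))) {a..x}"
    using mono_abs_continuous_integral[OF U \<open>a \<le> b\<close> monoV(2)] by blast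
  show ?thesis
  proof
    show "(\<lambda>x. v x - u x) absolutely_integrable_on {a..b}" using v(1) u(1) by (rule set_integral_diff)
    fix x assume x: "x \<in> {a..b}"
    show "((\<lambda>x. v x - u x) has_integral f x - f a) {a..x}"
      using has_integral_diff[OF v(2)[OF x] u(2)[OF x]] by simp
  qed
qed

lemma abs_continuous_integral:
  fixes f :: "real \<Rightarrow> 'a::euclidean_space"
  assumes f: "abs_continuous_on_interval a b f" and "a \<le> b"
  obtains w where "w absolutely_integrable_on {a..b}"
    "\<And>x. x \<in> {a..b} \<Longrightarrow> (w has_integral (f x - f a)) {a..x}"
proof -
  have "\<exists>w. w absolutely_integrable_on {a..b} \<and>
      (\<forall>x\<in>{a..b}. (w has_integral (f x \<bullet> i - f a \<bullet> i)) {a..x})" if i: "i \<in> Basis" for i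
  proof -
    have "abs_continuous_on_interval a b (\<lambda>x. f x \<bullet> i)"
    proof (rule abs_continuous_on_interval_lipschitz_compose[OF f, where B = 1])
      fix x y show "norm (f y \<bullet> i - f x \<bullet> i) \<le> 1 * norm (f y - f x)"
        using Basis_le_norm[OF i, of "f y - f x"] by (simp add: inner_diff_left)
    qed
    then obtain w where "w absolutely_integrable_on {a..b}"
      "\<And>x. x \<in> {a..b} \<Longrightarrow> (w has_integral (f x \<bullet> i - f a \<bullet> i)) {a..x}"
      using abs_continuous_integral_real \<open>a \<le> b\<close> by blast
    then show ?thesis by blast
  qed
  then have "\<forall>i\<in>Basis. \<exists>w. w absolutely_integrable_on {a..b} \<and>
      (\<forall>x\<in>{a..b}. (w has_integral (f x \<bullet> i - f a \<bullet> i)) {a..x})" by blast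
  from bchoice[OF this] obtain w where w: "\<And>i. i \<in> Basis \<Longrightarrow> w i absolutely_integrable_on {a..b}"
    "\<And>i x. i \<in> Basis \<Longrightarrow> x \<in> {a..b} \<Longrightarrow> (w i has_integral (f x \<bullet> i - f a \<bullet> i)) {a..x}"
    by blast
  show ?thesis
  proof
    show "(\<lambda>x. \<Sum>i\<in>Basis. w i x *\<^sub>R i) absolutely_integrable_on {a..b}"
      using w(1) by (intro absolutely_integrable_sum finite_Basis absolutely_integrable_scaleR_right) auto
    fix x assume x: "x \<in> {a..b}"
    have "((\<lambda>x. \<Sum>i\<in>Basis. w i x *\<^sub>R i) has_integral (\<Sum>i\<in>Basis. (f x \<bullet> i - f a \<bullet> i) *\<^sub>R i)) {a..x}"
      using w(2) x by (intro has_integral_sum finite_Basis has_integral_scaleR_left) auto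
    moreover have "(\<Sum>i\<in>Basis. (f x \<bullet> i - f a \<bullet> i) *\<^sub>R i) = f x - f a"
      by (simp add: euclidean_representation flip: inner_diff_left)
    ultimately show "((\<lambda>x. \<Sum>i\<in>Basis. w i x *\<^sub>R i) has_integral f x - f a) {a..x}" by simp
  qed
qed

text \<open>The density from \<open>abs_continuous_integral\<close> is so far just some integrable
  function; Lebesgue differentiation identifies it with the derivative almost everywhere, and all
  three conclusions follow.\<close>

lemma abs_continuous_fundamental_theorem:
  fixes f :: "real \<Rightarrow> 'a::euclidean_space"
  assumes f: "abs_continuous_on_interval a b f" and "a \<le> b"
  shows "(\<lambda>x. vector_derivative f (at x)) absolutely_integrable_on {a..b}"
    and "((\<lambda>x. vector_derivative f (at x)) has_integral (f b - f a)) {a..b}"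
    and "\<exists>N. negligible N \<and> (\<forall>x\<in>{a<..<b} - N. f differentiable (at x))"
proof -
  obtain w where w: "w absolutely_integrable_on {a..b}"
    "\<And>x. x \<in> {a..b} \<Longrightarrow> (w has_integral (f x - f a)) {a..x}"
    using abs_continuous_integral[OF assms] by blast
  define w' where "w' = (\<lambda>x. if x \<in> {a..b} then w x else 0)"
  have w'_int: "w' integrable_on {c..d}" for c d
  proof -
    have "w' integrable_on UNIV"
      unfolding w'_def integrable_restrict_UNIV using w(1) by (rule set_lebesgue_integral_eq_integral(1))
    then show ?thesis by (rule integrable_on_subinterval) auto
  qed
  obtain N where N: "negligible N" "\<And>x a. x \<notin> N \<Longrightarrow> a < x \<Longrightarrow>
      ((\<lambda>x. integral {a..x} w') has_vector_derivative w' x) (at x)"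
    by (rule integral_has_vector_derivative_AE[OF w'_int]) blast
  have deriv: "(f has_vector_derivative w x) (at x)" if x: "x \<in> {a<..<b}" "x \<notin> N" for x
  proof -
    have f_eq: "f a + integral {a..y} w' = f y" if "y \<in> {a<..<b}" for y
    proof -
      have "(w' has_integral (f y - f a)) {a..y}"
        by (rule has_integral_eq[OF _ w(2)]) (use that in \<open>auto simp: w'_def\<close>)
      then show ?thesis by (simp add: integral_unique)
    qed
    have "((\<lambda>y. f a + integral {a..y} w') has_vector_derivative 0 + w' x) (at x)"
      using x by (intro has_vector_derivative_add has_vector_derivative_const N(2)) auto
    then have "(f has_vector_derivative 0 + w' x) (at x)"
      by (rule has_vector_derivative_transform_within_open[OF _ open_greaterThanLessThan x(1) f_eq])
    then show ?thesis using x by (simp add: w'_def)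
  qed
  have eq: "vector_derivative f (at x) = w x" if "x \<in> {a..b} - (N \<union> {a, b})" for x
    using deriv[of x] that by (intro vector_derivative_at) auto
  have N': "negligible (N \<union> {a, b})" using N(1) by simp
  show "(\<lambda>x. vector_derivative f (at x)) absolutely_integrable_on {a..b}"
    by (rule absolutely_integrable_spike[OF w(1) N' eq])
  show "((\<lambda>x. vector_derivative f (at x)) has_integral (f b - f a)) {a..b}"
    by (rule has_integral_spike[OF N' eq w(2)]) (use \<open>a \<le> b\<close> in auto)
  show "\<exists>N. negligible N \<and> (\<forall>x\<in>{a<..<b} - N. f differentiable (at x))"
  proof (intro exI conjI ballI)
    show "f differentiable at x" if "x \<in> {a<..<b} - N" for x
      by (rule differentiableI_vector[OF deriv]) (use that in blast)+
  qed (rule N(1))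
qed

text \<open>Uniform integrability by truncation: the excess of \<open>norm (g x)\<close> over a
  large \<open>n\<close> has integral below \<open>\<epsilon> / 2\<close> on every set, while the
  part capped at \<open>n\<close> contributes at most \<open>n\<close> times the total
  length.\<close>

lemma abs_continuous_on_interval_indefinite_integral:
  fixes g :: "real \<Rightarrow> 'a::euclidean_space"
  assumes g: "g absolutely_integrable_on {a..b}" and "a \<le> b"
    and F: "\<And>x. x \<in> {a..b} \<Longrightarrow> F x = F a + integral {a..x} g"
  shows "abs_continuous_on_interval a b F"
  unfolding abs_continuous_on_interval_def
proof (intro allI impI)
  fix \<epsilon> :: real assume \<epsilon>: "\<epsilon> > 0"
  define u where "u = (\<lambda>x. indicator {a..b} x * norm (g x))"
  have u: "integrable lebesgue u"
    using set_integrable_norm[OF g] by (simp add: u_def set_integrable_def)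
  have u0: "u x \<ge> 0" for x by (simp add: u_def)
  have um [measurable]: "u \<in> borel_measurable lebesgue" using u by auto
  have "(\<lambda>n. integral\<^sup>L lebesgue (\<lambda>x. u x - min (u x) (real n))) \<longlonglongrightarrow> integral\<^sup>L lebesgue (\<lambda>x::real. 0)"
  proof (rule integral_dominated_convergence[OF _ _ u])
    show "AE x in lebesgue. (\<lambda>n. u x - min (u x) (real n)) \<longlonglongrightarrow> 0"
    proof (rule AE_I2)
      fix x
      have "eventually (\<lambda>n. u x - min (u x) (real n) = 0) sequentially"
        using eventually_ge_at_top[of "nat \<lceil>u x\<rceil>"] by eventually_elim (simp add: nat_ceiling_le_eq)
      then show "(\<lambda>n. u x - min (u x) (real n)) \<longlonglongrightarrow> 0" by (rule tendsto_eventually)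
    qed
  qed (auto simp: u0 min_def)
  then have "eventually (\<lambda>n. integral\<^sup>L lebesgue (\<lambda>x. u x - min (u x) (real n)) < \<epsilon> / 2) sequentially"
    using \<epsilon> by (intro order_tendstoD(2)[where y = 0]) auto
  then obtain n :: nat where n: "integral\<^sup>L lebesgue (\<lambda>x. u x - min (u x) (real n)) < \<epsilon> / 2"
    by (auto simp: eventually_sequentially)
  define v where "v = (\<lambda>x. min (u x) (real n))"
  have v: "integrable lebesgue v"
    unfolding v_def by (rule Bochner_Integration.integrable_bound[OF u]) (auto simp: u0)
  define \<delta> where "\<delta> = \<epsilon> / (2 * (real n + 1))"
  show "\<exists>\<delta>>0. \<forall>(n::nat) s t. (\<forall>i<n. a \<le> s i \<and> s i \<le> t i \<and> t i \<le> b) \<longrightarrow>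
       disjoint_family_on (\<lambda>i. {s i<..<t i}) {..<n} \<longrightarrow> (\<Sum>i<n. t i - s i) < \<delta> \<longrightarrow>
       (\<Sum>i<n. norm (F (t i) - F (s i))) < \<epsilon>"
  proof (intro exI[of _ \<delta>] conjI allI impI)
    show "\<delta> > 0" using \<epsilon> by (simp add: \<delta>_def)
    fix m :: nat and s t :: "nat \<Rightarrow> real"
    assume st: "\<forall>i<m. a \<le> s i \<and> s i \<le> t i \<and> t i \<le> b"
      and dj: "disjoint_family_on (\<lambda>i. {s i<..<t i}) {..<m}" and len: "(\<Sum>i<m. t i - s i) < \<delta>"
    let ?I = "\<lambda>i x. indicator {s i<..<t i} x :: real"
    have Iu: "integrable lebesgue (\<lambda>x. ?I i x * u x)" "integrable lebesgue (\<lambda>x. ?I i x * (u x - v x))" for i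
      using integrable_mult_indicator[OF _ u, of "{s i<..<t i}"]
        integrable_mult_indicator[OF _ Bochner_Integration.integrable_diff[OF u v], of "{s i<..<t i}"] by auto
    have le: "norm (F (t i) - F (s i)) \<le> integral\<^sup>L lebesgue (\<lambda>x. ?I i x * (u x - v x)) + real n * (t i - s i)"
      if i: "i < m" for i
    proof -
      have sti: "a \<le> s i" "s i \<le> t i" "t i \<le> b" using st i by auto
      have gi: "g absolutely_integrable_on {s i..t i}"
        by (rule absolutely_integrable_on_subinterval[OF g]) (use sti in auto)
      have "F (t i) - F (s i) = integral {s i..t i} g"
        using F[of "t i"] F[of "s i"] sti
          Henstock_Kurzweil_Integration.integral_combine[of a "s i" "t i" g]
          absolutely_integrable_on_subinterval[OF g, of a "t i"]
        by (auto simp: set_lebesgue_integral_eq_integral(1) algebra_simps)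
      also have "\<dots> = (LINT x:{s i..t i}|lebesgue. g x)"
        by (rule set_lebesgue_integral_eq_integral(2)[OF gi, symmetric])
      also have "norm \<dots> \<le> (LINT x:{s i..t i}|lebesgue. norm (g x))"
        unfolding set_lebesgue_integral_def
        by (rule order.trans[OF integral_norm_bound]) simp
      also have "\<dots> = integral\<^sup>L lebesgue (\<lambda>x. ?I i x * u x)"
        unfolding set_lebesgue_integral_def
      proof (rule integral_cong_AE)
        show "(\<lambda>x. indicator {s i..t i} x *\<^sub>R norm (g x)) \<in> borel_measurable lebesgue"
          using set_integrable_norm[OF gi] by (auto simp: set_integrable_def)
        \<comment> \<open>The intervals of a family are disjoint only as open intervals, whereas the
          integrals run over closed ones; the endpoints form a null set.\<close>
        have "AE x in lebesgue. x \<notin> {s i, t i}"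
          using AE_completion[OF AE_lborel_singleton[of "s i"]] AE_completion[OF AE_lborel_singleton[of "t i"]]
          by eventually_elim auto
        then show "AE x in lebesgue. indicator {s i..t i} x *\<^sub>R norm (g x) = ?I i x * u x"
          by eventually_elim (use sti in \<open>auto simp: u_def split: split_indicator\<close>)
      qed (use Iu in auto)
      also have "\<dots> = integral\<^sup>L lebesgue (\<lambda>x. ?I i x * (u x - v x) + ?I i x * v x)"
        by (simp add: algebra_simps)
      also have "\<dots> = integral\<^sup>L lebesgue (\<lambda>x. ?I i x * (u x - v x)) + integral\<^sup>L lebesgue (\<lambda>x. ?I i x * v x)"
        using Iu(2)[of i] integrable_mult_indicator[OF _ v, of "{s i<..<t i}"]
        by (intro Bochner_Integration.integral_add) auto
      also have "integral\<^sup>L lebesgue (\<lambda>x. ?I i x * v x) \<le> integral\<^sup>L lebesgue (\<lambda>x. ?I i x * real n)"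
        using integrable_mult_indicator[OF _ v, of "{s i<..<t i}"]
      proof (intro integral_mono)
        show "integrable lebesgue (\<lambda>x. ?I i x * real n)"
          using integrable_real_mult_indicator[of "{s i<..<t i}" lebesgue "\<lambda>_. 1"] sti
          by (auto intro!: integrable_mult_left integrable_real_indicator simp: emeasure_lborel_Ioo)
      qed (auto simp: v_def split: split_indicator)
      also have "\<dots> = real n * (t i - s i)" using sti by (simp add: mult.commute)
      finally show ?thesis by simp
    qed
    have "(\<Sum>i<m. norm (F (t i) - F (s i)))
        \<le> (\<Sum>i<m. integral\<^sup>L lebesgue (\<lambda>x. ?I i x * (u x - v x)) + real n * (t i - s i))"
      using le by (intro sum_mono) auto
    also have "\<dots> = integral\<^sup>L lebesgue (\<lambda>x. \<Sum>i<m. ?I i x * (u x - v x)) + real n * (\<Sum>i<m. t i - s i)"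
      by (subst Bochner_Integration.integral_sum) (rule Iu(2), simp only: sum.distrib sum_distrib_left)
    also have "integral\<^sup>L lebesgue (\<lambda>x. \<Sum>i<m. ?I i x * (u x - v x)) \<le> integral\<^sup>L lebesgue (\<lambda>x. u x - v x)"
    proof (rule integral_mono)
      show "integrable lebesgue (\<lambda>x. \<Sum>i<m. ?I i x * (u x - v x))"
        by (rule Bochner_Integration.integrable_sum) (rule Iu(2))
      fix x
      have uv: "u x - v x \<ge> 0" by (simp add: v_def)
      show "(\<Sum>i<m. ?I i x * (u x - v x)) \<le> u x - v x"
      proof (cases "\<exists>j<m. x \<in> {s j<..<t j}")
        case True
        then obtain j where "j < m" "x \<in> {s j<..<t j}" by blast
        then have "(\<Sum>i<m. (u x - v x) * ?I i x) = u x - v x"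
          using sum_indicator_disjoint_family[OF dj, of x j "\<lambda>_. u x - v x"] by auto
        moreover have "(\<Sum>i<m. ?I i x * (u x - v x)) = (\<Sum>i<m. (u x - v x) * ?I i x)"
          by (rule sum.cong[OF refl]) (rule mult.commute)
        ultimately show ?thesis by (metis order_refl)
      next
        case False
        then have "(\<Sum>i<m. ?I i x * (u x - v x)) = 0" by (intro sum.neutral) auto
        then show ?thesis using uv by (rule ord_eq_le_trans)
      qed
    qed (use u v in auto)
    also have "\<dots> < \<epsilon> / 2" using n by (simp add: v_def)
    also have "real n * (\<Sum>i<m. t i - s i) \<le> real n * \<delta>" using len by (intro mult_left_mono) auto
    also have "\<dots> \<le> \<epsilon> / 2" using \<epsilon> by (simp add: \<delta>_def field_simps)
    finally show "(\<Sum>i<m. norm (F (t i) - F (s i))) < \<epsilon>" by simp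
  qed
qed

section \<open>Calculus of locally absolutely continuous functions on a half-line\<close>

lemma AE_lebesgue_onI:
  assumes "negligible N" "S \<in> sets lebesgue" "\<And>x. x \<in> S \<Longrightarrow> x \<notin> N \<Longrightarrow> P x"
  shows "AE x in lebesgue_on S. P x"
proof -
  have "AE x in lebesgue. x \<notin> N"
    using assms(1) by (intro AE_not_in) (simp add: negligible_iff_null_sets)
  then have "AE x in lebesgue. x \<in> S \<longrightarrow> P x" by eventually_elim (use assms(3) in blast)
  then show ?thesis using assms(2) by (simp add: AE_restrict_space_iff)
qed

lemma AE_lebesgue_onE:
  assumes "AE x in lebesgue_on S. P x" "S \<in> sets lebesgue"
  obtains N where "negligible N" "\<And>x. x \<in> S - N \<Longrightarrow> P x"
proof -
  have "AE x in lebesgue. x \<in> S \<longrightarrow> P x" using assms by (simp add: AE_restrict_space_iff)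
  then obtain N where "{x \<in> space lebesgue. \<not> (x \<in> S \<longrightarrow> P x)} \<subseteq> N" "N \<in> null_sets lebesgue"
    by (auto simp: eventually_ae_filter)
  then show ?thesis by (intro that[of N]) (auto simp: negligible_iff_null_sets)
qed

text \<open>The point \<open>c\<close> is null and has to be discarded: a two-sided derivative there
  would involve the arbitrary values of the functions to the left of \<open>c\<close>.\<close>

lemma AE_lebesgue_on_atLeast_interior:
  fixes c :: real
  assumes "AE x in lebesgue_on {c..}. P x" "\<And>x. c < x \<Longrightarrow> P x \<Longrightarrow> Q x"
  shows "AE x in lebesgue_on {c..}. Q x"
proof -
  obtain N where N: "negligible N" "\<And>x. x \<in> {c..} - N \<Longrightarrow> P x" by (rule AE_lebesgue_onE[OF assms(1)]) auto
  show ?thesis by (rule AE_lebesgue_onI[of "insert c N"]) (use N assms(2) in auto)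
qed

text \<open>A substitute for \<open>has_vector_derivative\<close> in the locally absolutely
  continuous setting. Carrying the derivative as an explicit second function, fixed only up to null
  sets, turns the calculus rules into rules for pairs.\<close>

definition ac_deriv :: "real \<Rightarrow> (real \<Rightarrow> 'a::euclidean_space) \<Rightarrow> (real \<Rightarrow> 'a) \<Rightarrow> bool"
  where "ac_deriv c f g \<longleftrightarrow> (\<forall>d\<ge>c. abs_continuous_on_interval c d f) \<and>
    (AE x in lebesgue_on {c..}. (f has_vector_derivative g x) (at x))"

definition loc_integrable :: "real \<Rightarrow> (real \<Rightarrow> 'a::euclidean_space) \<Rightarrow> bool"
  where "loc_integrable c f \<longleftrightarrow> (\<forall>d\<ge>c. f absolutely_integrable_on {c..d})"

lemma loc_integrable_Icc: "loc_integrable c f \<Longrightarrow> c \<le> a \<Longrightarrow> f absolutely_integrable_on {a..b}"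
  unfolding loc_integrable_def
  by (rule absolutely_integrable_on_subinterval[where S = "{c..max c b}"]) auto

lemma loc_integrable_Icc_integrable: "loc_integrable c f \<Longrightarrow> c \<le> a \<Longrightarrow> f integrable_on {a..b}"
  by (rule set_lebesgue_integral_eq_integral(1)[OF loc_integrable_Icc])

lemma ac_deriv_continuous_on: 
  assumes "ac_deriv c f g" shows "continuous_on {c..} f"
  unfolding continuous_on_eq_continuous_within
proof (intro ballI)
  fix x assume x: "x \<in> {c..}"
  have "continuous_on {c..x+1} f"
    using assms x by (intro abs_continuous_on_interval_imp_continuous_on) (auto simp: ac_deriv_def)
  then have "continuous (at x within {c..x+1}) f" using x by (auto simp: continuous_on_eq_continuous_within)
  moreover have "at x within {c..x+1} = at x within {c..}"
    by (rule at_within_nhd[of _ "{..<x+1}"]) auto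
  ultimately show "continuous (at x within {c..}) f" by simp
qed

lemma ac_deriv_vector_derivative:
  fixes f :: "real \<Rightarrow> 'a::euclidean_space"
  assumes "\<And>d. c \<le> d \<Longrightarrow> abs_continuous_on_interval c d f"
  shows "ac_deriv c f (\<lambda>x. vector_derivative f (at x))"
proof -
  have "\<exists>N. negligible N \<and> (\<forall>x\<in>{c<..<c + real n} - N. f differentiable (at x))" for n :: nat
    by (rule abs_continuous_fundamental_theorem(3)[OF assms]) auto
  then obtain N where N: "\<And>n. negligible (N n)"
    "\<And>n x. x \<in> {c<..<c + real n} - N n \<Longrightarrow> f differentiable (at x)" by metis
  have "AE x in lebesgue_on {c..}. (f has_vector_derivative vector_derivative f (at x)) (at x)"
  proof (rule AE_lebesgue_onI)
    show "negligible (insert c (\<Union>n. N n))" using negligible_Union_nat[OF N(1)] by simp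
    fix x assume x: "x \<in> {c..}" "x \<notin> insert c (\<Union>n. N n)"
    obtain n :: nat where "x - c < real n" using reals_Archimedean2 by blast
    then have "f differentiable (at x)" using x by (intro N(2)[of x n]) auto
    then show "(f has_vector_derivative vector_derivative f (at x)) (at x)"
      by (simp add: vector_derivative_works)
  qed auto
  then show ?thesis using assms by (simp add: ac_deriv_def)
qed

lemma ac_deriv_AE_eq:
  assumes f: "ac_deriv c f g" shows "AE x in lebesgue_on {c..}. vector_derivative f (at x) = g x"
  using f unfolding ac_deriv_def by (auto elim!: eventually_mono intro: vector_derivative_at)

lemma ac_deriv_integral:
  fixes f :: "real \<Rightarrow> 'a::euclidean_space"
  assumes f: "ac_deriv c f g" and "c \<le> a" "a \<le> b"
  shows "g absolutely_integrable_on {a..b}" "(g has_integral (f b - f a)) {a..b}"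
proof -
  obtain N where N: "negligible N" "\<And>x. x \<in> {c..} - N \<Longrightarrow> vector_derivative f (at x) = g x"
    by (rule AE_lebesgue_onE[OF ac_deriv_AE_eq[OF f]]) auto
  have ac: "abs_continuous_on_interval a b f"
    using f \<open>c \<le> a\<close> \<open>a \<le> b\<close> by (intro abs_continuous_on_interval_subset[of c b f a b]) (auto simp: ac_deriv_def)
  have eq: "g x = vector_derivative f (at x)" if "x \<in> {a..b} - N" for x
    using N(2)[of x] that \<open>c \<le> a\<close> by auto
  show "g absolutely_integrable_on {a..b}"
    by (rule absolutely_integrable_spike[OF abs_continuous_fundamental_theorem(1)[OF ac \<open>a \<le> b\<close>] N(1) eq])
  show "(g has_integral (f b - f a)) {a..b}"
    by (rule has_integral_spike[OF N(1) eq abs_continuous_fundamental_theorem(2)[OF ac \<open>a \<le> b\<close>]])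
qed

lemma ac_deriv_loc_integrable: "ac_deriv c f g \<Longrightarrow> loc_integrable c g"
  unfolding loc_integrable_def using ac_deriv_integral(1) by blast

lemma ac_deriv_eq_integral:
  "ac_deriv c f g \<Longrightarrow> c \<le> x \<Longrightarrow> f x = f c + integral {c..x} g"
  using ac_deriv_integral(2)[of c f g c x] by (simp add: integral_unique)

lemma ac_deriv_cong:
  assumes f: "ac_deriv c f g" and ff': "\<And>x. c \<le> x \<Longrightarrow> f' x = f x"
    and gg': "AE x in lebesgue_on {c..}. g' x = g x"
  shows "ac_deriv c f' g'"
proof -
  have "abs_continuous_on_interval c d f'" if "d \<ge> c" for d
    by (rule abs_continuous_on_interval_lipschitz_compose[of c d f f' 1])
      (use f that in \<open>auto simp: ac_deriv_def ff'\<close>)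
  moreover have "AE x in lebesgue_on {c..}. (f has_vector_derivative g x) (at x) \<and> g' x = g x"
    using f gg' by (auto simp: ac_deriv_def)
  then have "AE x in lebesgue_on {c..}. (f' has_vector_derivative g' x) (at x)"
  proof (rule AE_lebesgue_on_atLeast_interior)
    fix x assume x: "c < x" "(f has_vector_derivative g x) (at x) \<and> g' x = g x"
    show "(f' has_vector_derivative g' x) (at x)"
      by (rule has_vector_derivative_transform_within_open[of f _ _ "{c<..}"]) (use x ff' in auto)
  qed
  ultimately show ?thesis by (simp add: ac_deriv_def)
qed

text \<open>Converse to \<open>ac_deriv_eq_integral\<close>; the two together exchange integral
  equations for differential equations.\<close>

lemma ac_deriv_of_integral:
  fixes g :: "real \<Rightarrow> 'a::euclidean_space"
  assumes g: "loc_integrable c g" and f: "\<And>x. c \<le> x \<Longrightarrow> f x = C + integral {c..x} g"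
  shows "ac_deriv c f g"
proof -
  define g' where "g' = (\<lambda>x. if c \<le> x then g x else 0)"
  have int: "g' integrable_on {a..b}" for a b
  proof -
    have "(\<lambda>x. if x \<in> {c..max c b} then g x else 0) integrable_on UNIV"
      unfolding integrable_restrict_UNIV by (rule loc_integrable_Icc_integrable[OF g]) simp
    then have "(\<lambda>x. if x \<in> {c..max c b} then g x else 0) integrable_on {a..b}"
      by (rule integrable_on_subinterval) auto
    then show ?thesis by (rule integrable_eq) (auto simp: g'_def)
  qed
  obtain N where N: "negligible N" "\<And>x a. x \<notin> N \<Longrightarrow> a < x \<Longrightarrow>
      ((\<lambda>x. integral {a..x} g') has_vector_derivative g' x) (at x)"
    by (rule integral_has_vector_derivative_AE[OF int]) blast
  have eq: "integral {c..x} g' = integral {c..x} g" for x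
    by (rule Henstock_Kurzweil_Integration.integral_cong) (auto simp: g'_def)
  have "AE x in lebesgue_on {c..}. (f has_vector_derivative g x) (at x)"
  proof (rule AE_lebesgue_onI[of "insert c N"])
    fix x assume x: "x \<in> {c..}" "x \<notin> insert c N"
    then have "((\<lambda>x. C + integral {c..x} g') has_vector_derivative 0 + g' x) (at x)"
      by (intro has_vector_derivative_add has_vector_derivative_const N(2)) auto
    then have "(f has_vector_derivative 0 + g' x) (at x)"
      by (rule has_vector_derivative_transform_within_open[of _ _ _ "{c<..}"]) (use x f eq in auto)
    then show "(f has_vector_derivative g x) (at x)" using x by (simp add: g'_def)
  qed (use N(1) in auto)
  moreover have "abs_continuous_on_interval c d f" if d: "d \<ge> c" for d
    by (rule abs_continuous_on_interval_indefinite_integral[OF loc_integrable_Icc[OF g order_refl] d])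
      (use f f[of c] in auto)
  ultimately show ?thesis by (simp add: ac_deriv_def)
qed

text \<open>Common core of the rules for linear images, sums and exponentials: an increment estimate
  for absolute continuity and a pointwise derivative rule. The constant \<open>B\<close> may depend
  on \<open>d\<close>, since absolute continuity is required only on compact intervals.\<close>

lemma ac_deriv_dominated:
  fixes f :: "real \<Rightarrow> 'a::euclidean_space" and h :: "real \<Rightarrow> 'b::euclidean_space"
    and k :: "real \<Rightarrow> 'c::euclidean_space"
  assumes f: "ac_deriv c f f'" and h: "ac_deriv c h h'"
    and dom: "\<And>d. c \<le> d \<Longrightarrow> \<exists>B. \<forall>x y. c \<le> x \<longrightarrow> x \<le> y \<longrightarrow> y \<le> d \<longrightarrow>
        norm (k y - k x) \<le> B * norm (f y - f x) + B * norm (h y - h x)"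
    and der: "\<And>x. c < x \<Longrightarrow> (f has_vector_derivative f' x) (at x) \<Longrightarrow>
        (h has_vector_derivative h' x) (at x) \<Longrightarrow> (k has_vector_derivative k' x) (at x)"
  shows "ac_deriv c k k'"
  unfolding ac_deriv_def
proof (intro conjI allI impI)
  fix d assume d: "c \<le> d"
  obtain B where "\<forall>x y. c \<le> x \<longrightarrow> x \<le> y \<longrightarrow> y \<le> d \<longrightarrow>
        norm (k y - k x) \<le> B * norm (f y - f x) + B * norm (h y - h x)" using dom[OF d] by blast
  then show "abs_continuous_on_interval c d k"
    using f h d by (intro abs_continuous_on_interval_dominated[of c d f h k B]) (auto simp: ac_deriv_def)
next
  have "AE x in lebesgue_on {c..}. (f has_vector_derivative f' x) (at x) \<and> (h has_vector_derivative h' x) (at x)"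
    using f h by (auto simp: ac_deriv_def)
  then show "AE x in lebesgue_on {c..}. (k has_vector_derivative k' x) (at x)"
    by (rule AE_lebesgue_on_atLeast_interior) (use der in blast)
qed


lemma ac_deriv_bounded_linear:
  fixes f :: "real \<Rightarrow> 'a::euclidean_space" and L :: "'a \<Rightarrow> 'b::euclidean_space"
  assumes f: "ac_deriv c f f'" and L: "bounded_linear L"
  shows "ac_deriv c (\<lambda>x. L (f x)) (\<lambda>x. L (f' x))"
proof (rule ac_deriv_dominated[OF f f])
  obtain K where K: "\<And>x. norm (L x) \<le> norm x * K" using bounded_linear.bounded[OF L] by blast
  show "\<exists>B. \<forall>x y. c \<le> x \<longrightarrow> x \<le> y \<longrightarrow> y \<le> d \<longrightarrow>
      norm (L (f y) - L (f x)) \<le> B * norm (f y - f x) + B * norm (f y - f x)" for d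
    using K[of "f _ - f _"] by (intro exI[of _ "K/2"]) (simp add: linear_diff[OF bounded_linear.linear[OF L]] mult.commute)
  show "((\<lambda>x. L (f x)) has_vector_derivative L (f' x)) (at x)" if "(f has_vector_derivative f' x) (at x)" for x
    by (rule bounded_linear.has_vector_derivative[OF L that])
qed

lemma ac_deriv_add:
  assumes f: "ac_deriv c f f'" and h: "ac_deriv c h h'"
  shows "ac_deriv c (\<lambda>x. f x + h x) (\<lambda>x. f' x + h' x)"
proof (rule ac_deriv_dominated[OF f h])
  have "norm (f y + h y - (f x + h x)) \<le> 1 * norm (f y - f x) + 1 * norm (h y - h x)" for x y
    using norm_triangle_ineq[of "f y - f x" "h y - h x"] by (simp add: algebra_simps)
  then show "\<exists>B. \<forall>x y. c \<le> x \<longrightarrow> x \<le> y \<longrightarrow> y \<le> d \<longrightarrow>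
      norm (f y + h y - (f x + h x)) \<le> B * norm (f y - f x) + B * norm (h y - h x)" for d by blast
qed (rule has_vector_derivative_add)

lemma ac_deriv_minus: "ac_deriv c f f' \<Longrightarrow> ac_deriv c (\<lambda>x. - f x) (\<lambda>x. - f' x)"
  using ac_deriv_bounded_linear[OF _ bounded_linear_minus[OF bounded_linear_ident]] by auto

lemma ac_deriv_diff:
  "ac_deriv c f f' \<Longrightarrow> ac_deriv c h h' \<Longrightarrow> ac_deriv c (\<lambda>x. f x - h x) (\<lambda>x. f' x - h' x)"
  using ac_deriv_add[OF _ ac_deriv_minus, of c f f' h h'] by simp

lemma ac_deriv_mult:
  fixes f h :: "real \<Rightarrow> 'a::{euclidean_space, real_normed_algebra}"
  assumes f: "ac_deriv c f f'" and h: "ac_deriv c h h'"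
  shows "ac_deriv c (\<lambda>x. f x * h x) (\<lambda>x. f x * h' x + f' x * h x)"
  unfolding ac_deriv_def
proof (intro conjI allI impI)
  show "abs_continuous_on_interval c d (\<lambda>x. f x * h x)" if "c \<le> d" for d
    using f h that by (intro abs_continuous_on_interval_mult) (auto simp: ac_deriv_def)
next
  have "AE x in lebesgue_on {c..}. (f has_vector_derivative f' x) (at x) \<and> (h has_vector_derivative h' x) (at x)"
    using f h by (auto simp: ac_deriv_def)
  then show "AE x in lebesgue_on {c..}. ((\<lambda>x. f x * h x) has_vector_derivative f x * h' x + f' x * h x) (at x)"
    by eventually_elim (auto intro: has_vector_derivative_mult)
qed

lemma ac_deriv_const: "ac_deriv c (\<lambda>x. C) (\<lambda>x. 0)"
  by (rule ac_deriv_of_integral[of _ _ _ C]) (auto simp: loc_integrable_def absolutely_integrable_on_def)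

lemma ac_deriv_cmult:
  fixes f :: "real \<Rightarrow> 'a::{euclidean_space, real_normed_algebra}"
  shows "ac_deriv c f f' \<Longrightarrow> ac_deriv c (\<lambda>x. C * f x) (\<lambda>x. C * f' x)"
  using ac_deriv_mult[OF ac_deriv_const] by fastforce

lemma ac_deriv_exp:
  fixes f :: "real \<Rightarrow> real"
  assumes f: "ac_deriv c f f'"
  shows "ac_deriv c (\<lambda>x. exp (f x)) (\<lambda>x. exp (f x) * f' x)"
proof (rule ac_deriv_dominated[OF f f])
  show "((\<lambda>x. exp (f x)) has_vector_derivative exp (f x) * f' x) (at x)"
    if "(f has_vector_derivative f' x) (at x)" for x
    using that unfolding has_real_derivative_iff_has_vector_derivative[symmetric] by (rule DERIV_fun_exp)
  fix d assume d: "c \<le> d"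
  have "compact (f ` {c..d})"
    by (intro compact_continuous_image continuous_on_subset[OF ac_deriv_continuous_on[OF f]]) auto
  then have "bounded (f ` {c..d})" by (rule compact_imp_bounded)
  then obtain M where "\<forall>y\<in>f ` {c..d}. norm y \<le> M" unfolding bounded_iff by blast
  then have M: "\<bar>f x\<bar> \<le> M" if "x \<in> {c..d}" for x using that by auto
  have lip: "\<bar>exp u - exp v\<bar> \<le> exp M * \<bar>u - v\<bar>" if "\<bar>u\<bar> \<le> M" "\<bar>v\<bar> \<le> M" for u v :: real
  proof -
    have "norm (exp u - exp v) \<le> exp M * norm (u - v)"
      by (rule field_differentiable_bound[of "{-M..M}" exp exp])
        (use that in \<open>auto intro: DERIV_exp[THEN DERIV_subset]\<close>)
    then show ?thesis by simp
  qed
  show "\<exists>B. \<forall>x y. c \<le> x \<longrightarrow> x \<le> y \<longrightarrow> y \<le> d \<longrightarrow>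
        norm (exp (f y) - exp (f x)) \<le> B * norm (f y - f x) + B * norm (f y - f x)"
  proof (intro exI[of _ "exp M / 2"] allI impI)
    fix x y assume "c \<le> x" "x \<le> y" "y \<le> d"
    then show "norm (exp (f y) - exp (f x)) \<le> exp M / 2 * norm (f y - f x) + exp M / 2 * norm (f y - f x)"
      using lip[OF M M, of y x] by simp
  qed
qed

lemma ac_deriv_zero_const:
  "ac_deriv c f (\<lambda>x. 0) \<Longrightarrow> c \<le> x \<Longrightarrow> f x = f c"
  using ac_deriv_eq_integral[of c f "\<lambda>x. 0" x] by simp

lemma loc_integrable_mult_continuous:
  fixes k h :: "real \<Rightarrow> 'a::{euclidean_space, real_normed_algebra}"
  assumes k: "loc_integrable c k" and h: "continuous_on {c..} h"
  shows "loc_integrable c (\<lambda>x. h x * k x)"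
  unfolding loc_integrable_def
proof (intro allI impI)
  fix d assume "c \<le> d"
  have hc: "continuous_on {c..d} h" by (rule continuous_on_subset[OF h]) auto
  show "(\<lambda>x. h x * k x) absolutely_integrable_on {c..d}"
  proof (rule absolutely_integrable_bounded_measurable_product[where h = "(*)"])
    show "bilinear ((*) :: 'a \<Rightarrow> 'a \<Rightarrow> 'a)" by (simp add: bilinear_conv_bounded_bilinear bounded_bilinear_mult)
    show "h \<in> borel_measurable (lebesgue_on {c..d})" by (rule continuous_imp_measurable_on_sets_lebesgue[OF hc]) auto
    show "bounded (h ` {c..d})" by (rule compact_imp_bounded[OF compact_continuous_image[OF hc]]) auto
    show "k absolutely_integrable_on {c..d}" by (rule loc_integrable_Icc[OF k order_refl])
  qed auto
qed

text \<open>As \<open>h\<close> is merely continuous, its majorant \<open>H\<close> is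
  differentiated instead: \<open>H x * exp (- K x)\<close> has nonpositive derivative almost
  everywhere because \<open>h \<le> H\<close> and \<open>k \<ge> 0\<close>.\<close>

lemma gronwall_integral:
  fixes h k :: "real \<Rightarrow> real"
  assumes h: "continuous_on {c..} h" and k: "loc_integrable c k" "\<And>x. 0 \<le> k x"
    and le: "\<And>x. c \<le> x \<Longrightarrow> h x \<le> A + integral {c..x} (\<lambda>t. h t * k t)" and x: "c \<le> x"
  shows "h x \<le> A * exp (integral {c..x} k)"
proof -
  define H where "H = (\<lambda>x. A + integral {c..x} (\<lambda>t. h t * k t))"
  define K where "K = (\<lambda>x. integral {c..x} k)"
  have hk: "loc_integrable c (\<lambda>t. h t * k t)" by (rule loc_integrable_mult_continuous[OF k(1) h])
  have H: "ac_deriv c H (\<lambda>t. h t * k t)" by (rule ac_deriv_of_integral[OF hk]) (simp add: H_def)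
  have K: "ac_deriv c K k" by (rule ac_deriv_of_integral[OF k(1), of _ 0]) (simp add: K_def)
  have R: "ac_deriv c (\<lambda>x. H x * exp (- K x)) (\<lambda>x. H x * (exp (- K x) * - k x) + h x * k x * exp (- K x))"
    by (intro ac_deriv_mult H ac_deriv_exp ac_deriv_minus K)
  have "H x * exp (- K x) - H c * exp (- K c) \<le> 0"
  proof (rule has_integral_le[OF ac_deriv_integral(2)[OF R order_refl x] has_integral_0])
    fix t assume "t \<in> {c..x}"
    then have "h t \<le> H t" using le by (simp add: H_def)
    then have "(h t - H t) * (k t * exp (- K t)) \<le> 0"
      using k(2)[of t] by (intro mult_nonpos_nonneg) auto
    then show "H t * (exp (- K t) * - k t) + h t * k t * exp (- K t) \<le> 0" by (simp add: algebra_simps)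
  qed
  moreover have "H c = A" "K c = 0" by (simp_all add: H_def K_def)
  ultimately have "H x * exp (- K x) \<le> A" by simp
  then have "H x \<le> A * exp (K x)" by (simp add: exp_minus field_simps)
  then show ?thesis using le[OF x] by (simp add: H_def K_def)
qed

section \<open>Linear differential equations with integrable coefficients\<close>

text \<open>With \<open>K x\<close> the integral of \<open>k\<close> over \<open>[c,x]\<close>, the Volterra operator is a contraction
  of factor \<open>1/2\<close> for the Bielecki norm \<open>sup |exp (-2 K) w|\<close>, on the whole half-line at once.\<close>

lemma linear_volterra_exists:
  fixes A :: "real \<Rightarrow> 'a::euclidean_space \<Rightarrow> 'a" and k :: "real \<Rightarrow> real"
  assumes lin: "\<And>x. linear (A x)" and le: "\<And>x y. norm (A x y) \<le> k x * norm y"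
    and k: "loc_integrable c k" "\<And>x. 0 \<le> k x"
    and int: "\<And>y. continuous_on {c..} y \<Longrightarrow> loc_integrable c (\<lambda>t. A t (y t))"
  obtains w where "continuous_on {c..} w" "\<And>x. c \<le> x \<Longrightarrow> w x = w0 + integral {c..x} (\<lambda>t. A t (w t))"
proof -
  define K where "K = (\<lambda>x. integral {c..x} k)"
  define E where "E = (\<lambda>x. exp (2 * K x))"
  have K: "ac_deriv c K k" by (rule ac_deriv_of_integral[OF k(1), of _ 0]) (simp add: K_def)
  have E: "ac_deriv c E (\<lambda>x. exp (2 * K x) * (2 * k x))"
    unfolding E_def by (intro ac_deriv_exp ac_deriv_cmult K)
  have E_pos: "E x > 0" for x by (simp add: E_def)
  \<comment> \<open>The derivative of \<open>E\<close> is \<open>2 k E\<close>, so integrating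
    \<open>E k\<close> returns \<open>(E x - 1) / 2\<close>: this is the source of the contraction
    factor.\<close>
  have E_int: "((\<lambda>t. E t * k t) has_integral (E x - 1) / 2) {c..x}" if "c \<le> x" for x
    using has_integral_mult_left[OF ac_deriv_integral(2)[OF E order_refl that], of "1/2"]
    by (simp add: E_def K_def mult.assoc)
  define J where "J = (\<lambda>W x. integral {c..x} (\<lambda>t. A t (E t *\<^sub>R W t)))"
  have E_cont: "continuous_on {c..} E" by (rule ac_deriv_continuous_on[OF E])
  have AW: "loc_integrable c (\<lambda>t. A t (E t *\<^sub>R W t))" if "continuous_on {c..} W" for W
    by (intro int continuous_intros E_cont that)
  have J_cont: "continuous_on {c..} (J W)" if "continuous_on {c..} W" for W
    by (rule ac_deriv_continuous_on[OF ac_deriv_of_integral[OF AW[OF that], of _ 0]]) (simp add: J_def)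
  have J_diff: "J W x - J V x = J (\<lambda>t. W t - V t) x"
    if "continuous_on {c..} W" "continuous_on {c..} V" for W V x
    unfolding J_def
    using Henstock_Kurzweil_Integration.integral_diff[OF loc_integrable_Icc_integrable[OF AW[OF that(1)] order_refl]
        loc_integrable_Icc_integrable[OF AW[OF that(2)] order_refl], of x]
    by (simp add: linear_diff[OF lin] scaleR_diff_right)
  have J_le: "norm (J W x) \<le> M * ((E x - 1) / 2)"
    if W: "continuous_on {c..} W" "\<And>t. norm (W t) \<le> M" and x: "c \<le> x" for W M x
  proof -
    have "norm (J W x) \<le> integral {c..x} (\<lambda>t. M * (E t * k t))"
      unfolding J_def
    proof (rule Henstock_Kurzweil_Integration.integral_norm_bound_integral)
      show "(\<lambda>t. A t (E t *\<^sub>R W t)) integrable_on {c..x}"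
        by (rule loc_integrable_Icc_integrable[OF AW[OF W(1)] order_refl])
      show "(\<lambda>t. M * (E t * k t)) integrable_on {c..x}"
        using E_int[OF x] by (intro integrable_on_mult_right) auto
      fix t
      have "norm (A t (E t *\<^sub>R W t)) \<le> k t * (E t * norm (W t))"
        using le[of t "E t *\<^sub>R W t"] E_pos[of t] by simp
      also have "\<dots> \<le> k t * (E t * M)"
        using W(2)[of t] E_pos[of t] k(2)[of t] by (intro mult_left_mono) auto
      finally show "norm (A t (E t *\<^sub>R W t)) \<le> M * (E t * k t)" by (simp add: mult_ac)
    qed
    also have "\<dots> = M * ((E x - 1) / 2)"
      using has_integral_mult_right[OF E_int[OF x], of M] by (rule integral_unique)
    finally show ?thesis .
  qed
  \<comment> \<open>The Volterra map written for \<open>W = w / E\<close>, so that the Bielecki norm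
    becomes the plain supremum norm. Through \<open>max c x\<close> functions are continued
    constantly to the left of \<open>c\<close>, since \<open>bcontfun\<close> lives on the whole
    line.\<close>
  define \<Phi> where "\<Phi> = (\<lambda>W x. (w0 + J W (max c x)) /\<^sub>R E (max c x))"
  have \<Phi>: "\<Phi> W \<in> bcontfun" if W: "W \<in> bcontfun" for W
  proof -
    from W have Wc: "continuous_on {c..} W" and "bounded (range W)"
      by (auto simp: bcontfun_def intro: continuous_on_subset)
    then obtain M where M: "\<And>x. norm (W x) \<le> M" unfolding bounded_iff by auto
    then have "M \<ge> 0" using norm_ge_zero order.trans by blast
    have mc: "continuous_on UNIV (\<lambda>x. max c x)" by (intro continuous_intros)
    have "continuous_on UNIV (\<lambda>x. J W (max c x))"
      by (rule continuous_on_compose2[OF J_cont[OF Wc] mc]) auto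
    moreover have "continuous_on UNIV (\<lambda>x. E (max c x))"
      by (rule continuous_on_compose2[OF E_cont mc]) auto
    ultimately have "continuous_on UNIV (\<Phi> W)"
      unfolding \<Phi>_def using E_pos by (intro continuous_intros) (auto simp: less_imp_neq[symmetric])
    moreover have "norm (\<Phi> W x) \<le> norm w0 + M" for x
    proof -
      define y where "y = max c x"
      have y: "c \<le> y" by (simp add: y_def)
      have "E y \<ge> 1"
        using integral_nonneg[OF loc_integrable_Icc_integrable[OF k(1) order_refl]] k(2)
        by (simp add: E_def K_def)
      have "norm (\<Phi> W x) \<le> (norm w0 + norm (J W y)) / E y"
        using norm_triangle_ineq[of w0 "J W y"] E_pos[of y]
        by (simp add: \<Phi>_def y_def[symmetric] divide_inverse_commute mult_left_mono)
      also have "\<dots> \<le> (norm w0 * E y + M * E y) / E y"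
      proof (intro divide_right_mono add_mono)
        show "norm w0 \<le> norm w0 * E y" using \<open>E y \<ge> 1\<close> by (simp add: mult_le_cancel_left1)
        have "M * ((E y - 1) / 2) \<le> M * E y" using \<open>E y \<ge> 1\<close> \<open>M \<ge> 0\<close> by (intro mult_left_mono) auto
        then show "norm (J W y) \<le> M * E y" using J_le[OF Wc M y] by linarith
      qed (use E_pos[of y] in simp)
      also have "\<dots> = norm w0 + M" using E_pos[of y] by (simp add: add_divide_distrib)
      finally show ?thesis .
    qed
    ultimately show ?thesis by (auto simp: bcontfun_def bounded_iff)
  qed
  define T where "T = (\<lambda>W. Bcontfun (\<Phi> (apply_bcontfun W)))"
  have T_apply: "apply_bcontfun (T W) = \<Phi> (apply_bcontfun W)" for W
    unfolding T_def by (rule Bcontfun_inverse[OF \<Phi>[OF apply_bcontfun]])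
  have W_cont: "continuous_on {c..} (apply_bcontfun W)" for W :: "real \<Rightarrow>\<^sub>C 'a"
    using apply_bcontfun[of W] by (auto simp: bcontfun_def intro: continuous_on_subset)
  have "\<exists>!W. T W = W"
  proof (rule banach_fix_type[of "1/2"])
    show "\<forall>W V. dist (T W) (T V) \<le> 1/2 * dist W V"
    proof (intro allI dist_bound)
      fix W V :: "real \<Rightarrow>\<^sub>C 'a" and x
      define y where "y = max c x"
      have y: "c \<le> y" by (simp add: y_def)
      have "dist (apply_bcontfun (T W) x) (apply_bcontfun (T V) x) = norm (J (\<lambda>t. W t - V t) y /\<^sub>R E y)"
        unfolding T_apply \<Phi>_def y_def[symmetric] dist_norm J_diff[OF W_cont W_cont, symmetric]
        by (simp add: algebra_simps)
      also have "\<dots> = norm (J (\<lambda>t. W t - V t) y) / E y" using E_pos[of y] by (simp add: divide_inverse_commute)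
      also have "\<dots> \<le> (dist W V * ((E y - 1) / 2)) / E y"
      proof (rule divide_right_mono[OF J_le[OF _ _ y]])
        show "continuous_on {c..} (\<lambda>t. W t - V t)" by (intro continuous_intros W_cont)
        show "norm (W t - V t) \<le> dist W V" for t using dist_bounded[of W t V] by (simp add: dist_norm)
      qed (use E_pos[of y] in simp)
      also have "\<dots> \<le> dist W V * (E y / 2) / E y"
        using E_pos[of y] by (intro divide_right_mono mult_left_mono) auto
      also have "\<dots> = 1/2 * dist W V" using E_pos[of y] by simp
      finally show "dist (apply_bcontfun (T W) x) (apply_bcontfun (T V) x) \<le> 1/2 * dist W V" .
    qed
  qed auto
  then obtain W where W: "T W = W" by blast
  define w where "w = (\<lambda>x. E x *\<^sub>R W x)"
  show ?thesis
  proof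
    show "continuous_on {c..} w" unfolding w_def by (intro continuous_intros E_cont W_cont)
    fix x assume x: "c \<le> x"
    have "W x = (w0 + J W x) /\<^sub>R E x" using arg_cong[OF W, of "\<lambda>W. apply_bcontfun W x"] x by (simp add: T_apply \<Phi>_def max_absorb2)
    then have "w x = w0 + J W x" using E_pos[of x] by (simp add: w_def)
    then show "w x = w0 + integral {c..x} (\<lambda>t. A t (w t))" by (simp add: J_def w_def)
  qed
qed

lemma loc_integrable_bounded_linear:
  fixes L :: "'a::euclidean_space \<Rightarrow> 'b::euclidean_space"
  shows "loc_integrable c f \<Longrightarrow> bounded_linear L \<Longrightarrow> loc_integrable c (\<lambda>x. L (f x))"
  unfolding loc_integrable_def using absolutely_integrable_linear[where f = f and h = L] by (simp add: o_def)

lemma loc_integrable_add: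
  "loc_integrable c f \<Longrightarrow> loc_integrable c g \<Longrightarrow> loc_integrable c (\<lambda>x. f x + g x)"
  unfolding loc_integrable_def by (auto intro: set_integral_add(1))

lemma loc_integrable_norm:
  fixes f :: "real \<Rightarrow> 'a::euclidean_space"
  shows "loc_integrable c f \<Longrightarrow> loc_integrable c (\<lambda>x. norm (f x))"
  unfolding loc_integrable_def by (auto intro: set_integrable_norm)

lemma loc_integrable_Pair:
  assumes f: "loc_integrable c f" and g: "loc_integrable c g"
  shows "loc_integrable c (\<lambda>x. (f x, g x))"
proof -
  have "loc_integrable c (\<lambda>x. (f x, 0) + (0, g x))"
    by (intro loc_integrable_add loc_integrable_bounded_linear[OF f] loc_integrable_bounded_linear[OF g]
        bounded_linear_Pair bounded_linear_ident bounded_linear_zero)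
  then show ?thesis by simp
qed

text \<open>If the values at \<open>x\<close> differed, so would those on some
  \<open>{x<..<x+d}\<close>. This right-hand neighbourhood lies in the domain even for
  \<open>x = c\<close>, and it is not a null set.\<close>

lemma continuous_on_AE_eq:
  fixes f g :: "real \<Rightarrow> 'a::real_normed_vector"
  assumes f: "continuous_on {c..} f" and g: "continuous_on {c..} g"
    and ae: "AE x in lebesgue_on {c..}. f x = g x" and x: "c \<le> x"
  shows "f x = g x"
proof (rule ccontr)
  assume ne: "f x \<noteq> g x"
  define e where "e = norm (f x - g x)"
  have e: "e > 0" using ne by (simp add: e_def)
  have "continuous_on {c..} (\<lambda>x. f x - g x)" using f g by (intro continuous_intros)
  then obtain d where d: "d > 0" "\<And>y. y \<in> {c..} \<Longrightarrow> dist y x < d \<Longrightarrow> dist (f y - g y) (f x - g x) < e"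
    using x e unfolding continuous_on_iff by (meson atLeast_iff)
  obtain N where N: "negligible N" "\<And>y. y \<in> {c..} - N \<Longrightarrow> f y = g y"
    by (rule AE_lebesgue_onE[OF ae]) auto
  have "{x<..<x+d} \<subseteq> N"
  proof
    fix y assume y: "y \<in> {x<..<x+d}"
    have "dist (f y - g y) (f x - g x) < e" using y x by (intro d(2)) (auto simp: dist_real_def)
    then have "f y \<noteq> g y" by (auto simp: e_def dist_norm norm_minus_commute)
    then show "y \<in> N" using N(2)[of y] y x by auto
  qed
  then have "negligible {x<..<x+d}" by (rule negligible_subset[OF N(1)])
  then show False using d(1) negligible_interval(2)[of x "x + d"] by simp
qed

lemma ac_deriv_unique:
  fixes v w :: "real \<Rightarrow> 'a::euclidean_space"
  assumes "ac_deriv c v v'" "ac_deriv c w w'" "AE x in lebesgue_on {c..}. v x = w x" "c \<le> x"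
  shows "v x = w x"
  using continuous_on_AE_eq[OF ac_deriv_continuous_on[OF assms(1)] ac_deriv_continuous_on[OF assms(2)] assms(3,4)] .

section \<open>Sturm-Liouville equations\<close>

locale sturm_liouville =
  fixes p q r :: "real \<Rightarrow> real" and c :: real
  assumes r_measurable: "r \<in> borel_measurable (lebesgue_on {c..})"
    and p_pos: "AE x in lebesgue_on {c..}. p x > 0"
    and r_pos: "AE x in lebesgue_on {c..}. r x > 0"
    and p_int: "loc_integrable c (\<lambda>x. 1 / p x)"
    and q_int: "loc_integrable c q"
    and r_int: "loc_integrable c r"
begin

text \<open>First-order form of the eigenvalue equation, with \<open>v\<close> the quasi-derivative
  of \<open>u\<close>. Carrying \<open>v\<close> along bypasses the choice inside
  \<open>quasi_deriv\<close>; \<open>L2_solutions_iff\<close> is the translation.\<close>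

definition sl_sol :: "complex \<Rightarrow> (real \<Rightarrow> complex) \<Rightarrow> (real \<Rightarrow> complex) \<Rightarrow> bool"
  where "sl_sol z u v \<longleftrightarrow> ac_deriv c u (\<lambda>x. v x / of_real (p x)) \<and>
    ac_deriv c v (\<lambda>x. (of_real (q x) - z * of_real (r x)) * u x)"

lemma sl_sol_ac:
  "sl_sol z u v \<Longrightarrow> ac_deriv c u (\<lambda>x. v x / of_real (p x))"
  "sl_sol z u v \<Longrightarrow> ac_deriv c v (\<lambda>x. (of_real (q x) - z * of_real (r x)) * u x)"
  by (auto simp: sl_sol_def)

lemma sl_sol_continuous_on:
  "sl_sol z u v \<Longrightarrow> continuous_on {c..} u" "sl_sol z u v \<Longrightarrow> continuous_on {c..} v"
  by (auto dest: sl_sol_ac ac_deriv_continuous_on)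

lemma sl_sol_cong:
  assumes "sl_sol z u v" "\<And>x. c \<le> x \<Longrightarrow> u' x = u x" "\<And>x. c \<le> x \<Longrightarrow> v' x = v x"
  shows "sl_sol z u' v'"
  unfolding sl_sol_def
proof
  show "ac_deriv c u' (\<lambda>x. v' x / of_real (p x))"
    by (rule ac_deriv_cong[OF sl_sol_ac(1)[OF assms(1)] assms(2)]) (auto intro!: AE_I2 simp: assms(3))
  show "ac_deriv c v' (\<lambda>x. (of_real (q x) - z * of_real (r x)) * u' x)"
    by (rule ac_deriv_cong[OF sl_sol_ac(2)[OF assms(1)] assms(3)]) (auto intro!: AE_I2 simp: assms(2))
qed

text \<open>Bounds the coefficient matrix of the first-order system. The absolute values make it
  nonnegative at every point, whereas \<open>p\<close> and \<open>r\<close> are positive only almost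
  everywhere.\<close>

definition growth :: "complex \<Rightarrow> real \<Rightarrow> real"
  where "growth z x = \<bar>1 / p x\<bar> + (\<bar>q x\<bar> + cmod z * \<bar>r x\<bar>)"

lemma growth_nonneg: "0 \<le> growth z x" by (simp add: growth_def)

lemma growth_int: "loc_integrable c (growth z)"
  unfolding growth_def
  using loc_integrable_norm[OF p_int] loc_integrable_norm[OF q_int] loc_integrable_norm[OF r_int]
  by (intro loc_integrable_add loc_integrable_bounded_linear[OF _ bounded_linear_mult_right]) auto

lemma of_real_int:
  "loc_integrable c (\<lambda>x. of_real (1 / p x) :: complex)"
  "loc_integrable c (\<lambda>x. of_real (q x) - z * of_real (r x) :: complex)"
proof -
  show "loc_integrable c (\<lambda>x. of_real (1 / p x) :: complex)"
    by (rule loc_integrable_bounded_linear[OF p_int bounded_linear_of_real])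
  have "loc_integrable c (\<lambda>x. of_real (q x) + (- z) * of_real (r x) :: complex)"
    by (intro loc_integrable_add loc_integrable_bounded_linear[OF _ bounded_linear_mult_right]
       loc_integrable_bounded_linear[OF _ bounded_linear_of_real] q_int r_int)
  then show "loc_integrable c (\<lambda>x. of_real (q x) - z * of_real (r x) :: complex)" by simp
qed

lemma growth_bound:
  "cmod (b / of_real (p x)) \<le> \<bar>1 / p x\<bar> * cmod b"
  "cmod ((of_real (q x) - z * of_real (r x)) * a) \<le> (\<bar>q x\<bar> + cmod z * \<bar>r x\<bar>) * cmod a"
proof -
  show "cmod (b / of_real (p x)) \<le> \<bar>1 / p x\<bar> * cmod b" by (simp add: norm_divide)
  have "cmod (of_real (q x) - z * of_real (r x)) \<le> \<bar>q x\<bar> + cmod z * \<bar>r x\<bar>"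
    using norm_triangle_ineq4[of "of_real (q x)" "z * of_real (r x)"] by (simp add: norm_mult)
  then show "cmod ((of_real (q x) - z * of_real (r x)) * a) \<le> (\<bar>q x\<bar> + cmod z * \<bar>r x\<bar>) * cmod a"
    unfolding norm_mult by (rule mult_right_mono) simp
qed

text \<open>The endpoint \<open>c\<close> is regular: the coefficients are integrable up to it, so
  initial data for the first-order system may be prescribed there.\<close>

lemma sl_sol_exists:
  obtains u v where "sl_sol z u v" "u c = \<alpha>" "v c = \<beta>"
proof -
  define A :: "real \<Rightarrow> complex \<times> complex \<Rightarrow> complex \<times> complex"
    where "A = (\<lambda>x y. (snd y * of_real (1 / p x), fst y * (of_real (q x) - z * of_real (r x))))"
  have lin: "linear (A x)" for x
    by (rule linearI) (auto simp: A_def algebra_simps scaleR_conv_of_real add_divide_distrib)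
  have le: "norm (A x y) \<le> growth z x * norm y" for x y
  proof -
    have "norm (A x y) \<le> cmod (snd y / of_real (p x)) + cmod ((of_real (q x) - z * of_real (r x)) * fst y)"
      unfolding A_def using norm_Pair_le[of "snd y / of_real (p x)" "(of_real (q x) - z * of_real (r x)) * fst y"]
      by (simp add: mult.commute)
    also have "\<dots> \<le> \<bar>1 / p x\<bar> * norm y + (\<bar>q x\<bar> + cmod z * \<bar>r x\<bar>) * norm y"
      using norm_fst_le[of "fst y" "snd y"] norm_snd_le[of "snd y" "fst y"]
      by (intro add_mono order.trans[OF growth_bound(1)] order.trans[OF growth_bound(2)] mult_left_mono) auto
    finally show ?thesis by (simp add: growth_def algebra_simps)
  qed
  have int: "loc_integrable c (\<lambda>t. A t (y t))" if "continuous_on {c..} y" for y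
    unfolding A_def
    by (intro loc_integrable_Pair loc_integrable_mult_continuous of_real_int continuous_intros that)
  obtain w where w: "continuous_on {c..} w" "\<And>x. c \<le> x \<Longrightarrow> w x = (\<alpha>, \<beta>) + integral {c..x} (\<lambda>t. A t (w t))"
    by (rule linear_volterra_exists[OF lin le growth_int growth_nonneg int, of "(\<alpha>, \<beta>)"], assumption) (rule that)
  have ac: "ac_deriv c w (\<lambda>t. A t (w t))" by (rule ac_deriv_of_integral[OF int[OF w(1)] w(2)])
  show ?thesis
  proof
    show "sl_sol z (\<lambda>x. fst (w x)) (\<lambda>x. snd (w x))"
      using ac_deriv_bounded_linear[OF ac bounded_linear_fst] ac_deriv_bounded_linear[OF ac bounded_linear_snd]
      by (simp add: sl_sol_def A_def mult.commute)
    show "fst (w c) = \<alpha>" "snd (w c) = \<beta>" using w(2)[of c] by simp_all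
  qed
qed

lemma sl_sol_linear:
  assumes 1: "sl_sol z u v" and 2: "sl_sol z u' v'"
  shows "sl_sol z (\<lambda>x. a * u x + b * u' x) (\<lambda>x. a * v x + b * v' x)"
  unfolding sl_sol_def
proof
  show "ac_deriv c (\<lambda>x. a * u x + b * u' x) (\<lambda>x. (a * v x + b * v' x) / of_real (p x))"
    using ac_deriv_add[OF ac_deriv_cmult[OF sl_sol_ac(1)[OF 1], of a] ac_deriv_cmult[OF sl_sol_ac(1)[OF 2], of b]]
    by (simp add: add_divide_distrib)
  show "ac_deriv c (\<lambda>x. a * v x + b * v' x) (\<lambda>x. (of_real (q x) - z * of_real (r x)) * (a * u x + b * u' x))"
    using ac_deriv_add[OF ac_deriv_cmult[OF sl_sol_ac(2)[OF 1], of a] ac_deriv_cmult[OF sl_sol_ac(2)[OF 2], of b]]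
    by (simp add: algebra_simps)
qed

text \<open>Gronwall's inequality with initial constant 0 for \<open>cmod u + cmod v\<close>; by
  linearity this is uniqueness for the initial value problem.\<close>

lemma sl_sol_zero:
  assumes s: "sl_sol z u v" and "u c = 0" "v c = 0" and x: "c \<le> x"
  shows "u x = 0 \<and> v x = 0"
proof -
  define h where "h = (\<lambda>x. cmod (u x) + cmod (v x))"
  have h: "continuous_on {c..} h" unfolding h_def by (intro continuous_intros sl_sol_continuous_on[OF s])
  have hk: "loc_integrable c (\<lambda>t. h t * growth z t)" by (rule loc_integrable_mult_continuous[OF growth_int h])
  have "h x \<le> 0 * exp (integral {c..x} (growth z))"
  proof (rule gronwall_integral[OF h growth_int growth_nonneg _ x])
    fix x assume x: "c \<le> x"
    let ?f = "\<lambda>t. v t / of_real (p t)" and ?g = "\<lambda>t. (of_real (q t) - z * of_real (r t)) * u t"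
    have f: "?f absolutely_integrable_on {c..x}" and g: "?g absolutely_integrable_on {c..x}"
      using ac_deriv_integral(1)[OF sl_sol_ac(1)[OF s] order_refl x] ac_deriv_integral(1)[OF sl_sol_ac(2)[OF s] order_refl x] by auto
    have "h x = cmod (integral {c..x} ?f) + cmod (integral {c..x} ?g)"
      using ac_deriv_eq_integral[OF sl_sol_ac(1)[OF s] x] ac_deriv_eq_integral[OF sl_sol_ac(2)[OF s] x] assms
      by (simp add: h_def)
    also have "\<dots> \<le> integral {c..x} (\<lambda>t. cmod (?f t)) + integral {c..x} (\<lambda>t. cmod (?g t))"
      using f g by (intro add_mono Henstock_Kurzweil_Integration.integral_norm_bound_integral)
        (auto simp: absolutely_integrable_on_def)
    also have "\<dots> = integral {c..x} (\<lambda>t. cmod (?f t) + cmod (?g t))"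
      using f g by (intro Henstock_Kurzweil_Integration.integral_add[symmetric]) (auto simp: absolutely_integrable_on_def)
    also have "\<dots> \<le> integral {c..x} (\<lambda>t. h t * growth z t)"
    proof (rule integral_le)
      show "(\<lambda>t. cmod (?f t) + cmod (?g t)) integrable_on {c..x}"
        using f g by (intro integrable_add) (auto simp: absolutely_integrable_on_def)
      show "(\<lambda>t. h t * growth z t) integrable_on {c..x}" by (rule loc_integrable_Icc_integrable[OF hk order_refl])
      fix t
      have "cmod (?f t) + cmod (?g t) \<le> \<bar>1 / p t\<bar> * h t + (\<bar>q t\<bar> + cmod z * \<bar>r t\<bar>) * h t"
        by (intro add_mono order.trans[OF growth_bound(1)] order.trans[OF growth_bound(2)] mult_left_mono)
          (auto simp: h_def)
      then show "cmod (?f t) + cmod (?g t) \<le> h t * growth z t" by (simp add: growth_def algebra_simps)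
    qed
    finally show "h x \<le> 0 + integral {c..x} (\<lambda>t. h t * growth z t)" by simp
  qed
  then have "cmod (u x) + cmod (v x) \<le> 0" by (simp add: h_def)
  then show ?thesis using norm_ge_zero[of "u x"] norm_ge_zero[of "v x"] by (simp add: order_antisym_conv add_nonneg_eq_0_iff)
qed

lemma ac_deriv_imp_quasi_deriv:
  assumes u: "ac_deriv c u (\<lambda>x. v x / of_real (p x))" and v: "ac_deriv c v v'"
  shows "is_quasi_deriv p c u v"
  unfolding is_quasi_deriv_def
proof
  show "\<forall>d\<ge>c. abs_continuous_on_interval c d v" using v by (simp add: ac_deriv_def)
  have "AE x in lebesgue_on {c..}. (u has_vector_derivative (v x / of_real (p x))) (at x)"
    using u by (simp add: ac_deriv_def)
  with p_pos show "AE x in lebesgue_on {c..}. u differentiable (at x) \<and> v x = of_real (p x) * vector_derivative u (at x)"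
    by eventually_elim (auto simp: vector_derivative_at intro: differentiableI_vector)
qed

lemma quasi_deriv_imp_ac_deriv:
  assumes u: "\<And>d. c \<le> d \<Longrightarrow> abs_continuous_on_interval c d u" and v: "is_quasi_deriv p c u v"
  shows "ac_deriv c u (\<lambda>x. v x / of_real (p x))"
proof -
  have "AE x in lebesgue_on {c..}. u differentiable (at x) \<and> v x = of_real (p x) * vector_derivative u (at x)"
    using v by (simp add: is_quasi_deriv_def)
  with p_pos have "AE x in lebesgue_on {c..}. (u has_vector_derivative (v x / of_real (p x))) (at x)"
    by eventually_elim (auto simp: vector_derivative_works)
  then show ?thesis using u by (simp add: ac_deriv_def)
qed

lemma ell_regular_ac_deriv:
  assumes "ell_regular p c u"
  obtains v where "ac_deriv c u (\<lambda>x. v x / of_real (p x))"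
    "ac_deriv c v (\<lambda>x. vector_derivative v (at x))" "v = quasi_deriv p c u"
proof -
  have q: "is_quasi_deriv p c u (quasi_deriv p c u)"
    using assms unfolding ell_regular_def quasi_deriv_def by (metis someI_ex)
  show ?thesis
  proof (rule that[OF _ _ refl])
    show "ac_deriv c u (\<lambda>x. quasi_deriv p c u x / of_real (p x))"
      using assms by (intro quasi_deriv_imp_ac_deriv q) (auto simp: ell_regular_def)
    show "ac_deriv c (quasi_deriv p c u) (\<lambda>x. vector_derivative (quasi_deriv p c u) (at x))"
      using q by (intro ac_deriv_vector_derivative) (auto simp: is_quasi_deriv_def)
  qed
qed

text \<open>On \<open>{c..}\<close> the function \<open>v\<close> coincides with the chosen
  quasi-derivative: both are continuous and equal to \<open>p u'\<close> almost everywhere. Hence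
  \<open>ell\<close> can be computed from any explicit candidate.\<close>

lemma ac_deriv_ell:
  assumes u: "ac_deriv c u (\<lambda>x. v x / of_real (p x))" and v: "ac_deriv c v v'"
  shows "ell_regular p c u"
    and "AE x in lebesgue_on {c..}. ell p q r c u x = (- v' x + of_real (q x) * u x) / of_real (r x)"
proof -
  have q: "is_quasi_deriv p c u v" by (rule ac_deriv_imp_quasi_deriv[OF u v])
  then show reg: "ell_regular p c u" using u by (auto simp: ell_regular_def ac_deriv_def)
  obtain w where w: "ac_deriv c u (\<lambda>x. w x / of_real (p x))"
    "ac_deriv c w (\<lambda>x. vector_derivative w (at x))" "w = quasi_deriv p c u"
    by (rule ell_regular_ac_deriv[OF reg]) blast
  have "AE x in lebesgue_on {c..}. v x = w x"
    using p_pos ac_deriv_AE_eq[OF u] ac_deriv_AE_eq[OF w(1)] by eventually_elim auto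
  then have eq: "v x = w x" if "c \<le> x" for x by (rule ac_deriv_unique[OF v w(2) _ that])
  have "ac_deriv c w v'" by (rule ac_deriv_cong[OF v]) (auto simp: eq)
  from ac_deriv_AE_eq[OF this] show "AE x in lebesgue_on {c..}. ell p q r c u x = (- v' x + of_real (q x) * u x) / of_real (r x)"
    by eventually_elim (simp add: ell_def w(3))
qed

lemma L2_solutions_iff:
  "u \<in> L2_solutions p q r c z \<longleftrightarrow> (\<forall>x<c. u x = 0) \<and> L2_weighted r c u \<and> (\<exists>v. sl_sol z u v)"
proof (intro iffI conjI)
  assume u: "u \<in> L2_solutions p q r c z"
  then have reg: "ell_regular p c u" and eq: "AE x in lebesgue_on {c..}. ell p q r c u x = z * u x"
    by (auto simp: L2_solutions_def)
  obtain v where v: "ac_deriv c u (\<lambda>x. v x / of_real (p x))"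
    "ac_deriv c v (\<lambda>x. vector_derivative v (at x))" "v = quasi_deriv p c u"
    by (rule ell_regular_ac_deriv[OF reg]) blast
  have "AE x in lebesgue_on {c..}. (of_real (q x) - z * of_real (r x)) * u x = vector_derivative v (at x)"
    using eq r_pos by eventually_elim (auto simp: ell_def v(3) field_simps)
  then have "ac_deriv c v (\<lambda>x. (of_real (q x) - z * of_real (r x)) * u x)"
    by (rule ac_deriv_cong[OF v(2) refl])
  then show "\<exists>v. sl_sol z u v" using v(1) by (auto simp: sl_sol_def)
next
  assume R: "(\<forall>x<c. u x = 0) \<and> L2_weighted r c u \<and> (\<exists>v. sl_sol z u v)"
  then obtain v where s: "sl_sol z u v" by blast
  have "AE x in lebesgue_on {c..}. ell p q r c u x = z * u x"
    using ac_deriv_ell(2)[OF sl_sol_ac(1)[OF s] sl_sol_ac(2)[OF s]] r_pos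
    by eventually_elim (auto simp: field_simps)
  then show "u \<in> L2_solutions p q r c z"
    using R ac_deriv_ell(1)[OF sl_sol_ac(1)[OF s] sl_sol_ac(2)[OF s]] by (simp add: L2_solutions_def)
qed (auto simp: L2_solutions_def)

end

text \<open>Bridge between Bochner integrals over the half-line, in which norms and forms are
  stated, and gauge integrals over compact intervals, where the fundamental theorem
  operates.\<close>

lemma integral_lebesgue_on_atLeast_support:
  fixes g :: "real \<Rightarrow> 'a::euclidean_space"
  assumes g: "g absolutely_integrable_on {c..d}" and supp: "\<And>x. d < x \<Longrightarrow> g x = 0"
  shows "integrable (lebesgue_on {c..}) g" "integral\<^sup>L (lebesgue_on {c..}) g = integral {c..d} g"
proof -
  have eq: "(\<lambda>x. indicator {c..} x *\<^sub>R g x) = (\<lambda>x. indicator {c..d} x *\<^sub>R g x)"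
    using supp by (force simp: fun_eq_iff indicator_def)
  show "integrable (lebesgue_on {c..}) g"
    using g eq by (simp add: integrable_restrict_space set_integrable_def)
  show "integral\<^sup>L (lebesgue_on {c..}) g = integral {c..d} g"
    using set_lebesgue_integral_eq_integral(2)[OF g] eq
    by (simp add: integral_restrict_space set_lebesgue_integral_def)
qed

section \<open>Square integrable solutions: existence at nonreal parameters and Weyl's
  alternative\<close>

context sturm_liouville
begin

text \<open>Since \<open>p\<close>, \<open>q\<close> and \<open>r\<close> are real, the terms with
  \<open>p\<close> and \<open>q\<close> drop out of the derivative of \<open>Im (cnj u * v)\<close>,
  which is \<open>- Im z\<close> times the density on the left.\<close>

lemma energy_has_integral:
  assumes s: "sl_sol z u v" and z: "Im z \<noteq> 0" and x: "c \<le> x"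
  shows "((\<lambda>t. (cmod (u t))\<^sup>2 * r t) has_integral (Im (cnj (u c) * v c) - Im (cnj (u x) * v x)) / Im z) {c..x}"
proof -
  have "ac_deriv c (\<lambda>t. Im (cnj (u t) * v t))
      (\<lambda>t. Im (cnj (u t) * ((of_real (q t) - z * of_real (r t)) * u t) + cnj (v t / of_real (p t)) * v t))"
    by (intro ac_deriv_bounded_linear[OF _ bounded_linear_Im] ac_deriv_mult sl_sol_ac[OF s]
        ac_deriv_bounded_linear[OF _ bounded_linear_cnj])
  moreover have "Im (cnj (u t) * ((of_real (q t) - z * of_real (r t)) * u t) + cnj (v t / of_real (p t)) * v t)
      = - Im z * ((cmod (u t))\<^sup>2 * r t)" for t
  proof -
    have sq: "cnj w * w = of_real ((cmod w)\<^sup>2)" for w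
      by (metis complex_norm_square mult.commute of_real_power)
    have 1: "cnj (u t) * ((of_real (q t) - z * of_real (r t)) * u t)
        = (of_real (q t) - z * of_real (r t)) * of_real ((cmod (u t))\<^sup>2)"
      by (simp only: sq[symmetric] mult_ac)
    have 2: "cnj (v t / of_real (p t)) * v t = of_real (1 / p t) * of_real ((cmod (v t))\<^sup>2)"
      unfolding sq[symmetric] by simp
    show ?thesis unfolding 1 2 by (simp del: of_real_power)
  qed
  ultimately have "ac_deriv c (\<lambda>t. Im (cnj (u t) * v t)) (\<lambda>t. - Im z * ((cmod (u t))\<^sup>2 * r t))" by simp
  note I = has_integral_mult_right[OF ac_deriv_integral(2)[OF this order_refl x], of "- 1 / Im z"]
  have "- 1 / Im z * (X - Y) = (Y - X) / Im z" for X Y :: real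
    by (simp add: divide_inverse algebra_simps)
  moreover have "- 1 / Im z * (- Im z * X) = X" for X :: real using z by simp
  ultimately show ?thesis using I by (simp only:)
qed

lemma sl_sol_measurable: "sl_sol z u v \<Longrightarrow> u \<in> borel_measurable (lebesgue_on {c..})"
  by (rule continuous_imp_measurable_on_sets_lebesgue[OF sl_sol_continuous_on(1)]) auto

lemma weight_loc_integrable:
  fixes h :: "real \<Rightarrow> real"
  assumes "continuous_on {c..} h" shows "loc_integrable c (\<lambda>t. h t * r t)"
  by (rule loc_integrable_mult_continuous[OF r_int assms])

text \<open>The boundary data at \<open>c\<close> of solutions vanishing at \<open>c + n\<close> are normalised to the unit
  sphere: a limit point of them is nonzero, and the energy identity bounds the norms uniformly.\<close>

theorem weyl_solution_exists:
  assumes z: "Im z \<noteq> 0"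
  obtains u v where "sl_sol z u v" "L2_weighted r c u" "u c \<noteq> 0 \<or> v c \<noteq> 0"
proof -
  let ?M = "lebesgue_on {c..}"
  obtain \<phi> \<phi>' where \<phi>: "sl_sol z \<phi> \<phi>'" "\<phi> c = 0" "\<phi>' c = 1" by (rule sl_sol_exists)
  obtain \<theta> \<theta>' where \<theta>: "sl_sol z \<theta> \<theta>'" "\<theta> c = 1" "\<theta>' c = 0" by (rule sl_sol_exists)
  define \<psi> where "\<psi> = (\<lambda>(ab :: complex \<times> complex) x. fst ab * \<phi> x + snd ab * \<theta> x)"
  define \<psi>' where "\<psi>' = (\<lambda>(ab :: complex \<times> complex) x. fst ab * \<phi>' x + snd ab * \<theta>' x)"
  have \<psi>: "sl_sol z (\<psi> ab) (\<psi>' ab)" for ab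
    unfolding \<psi>_def \<psi>'_def by (rule sl_sol_linear[OF \<phi>(1) \<theta>(1)])
  have \<psi>c: "\<psi> ab c = snd ab" "\<psi>' ab c = fst ab" for ab by (simp_all add: \<psi>_def \<psi>'_def \<phi> \<theta>)
  \<comment> \<open>The combination \<open>a \<phi> + b \<theta>\<close> vanishes at
    \<open>c + n\<close> when \<open>(a, b)\<close> is a multiple of
    \<open>(\<theta>, - \<phi>)\<close> taken there; should that vector be 0, any unit vector will
    do.\<close>
  have "\<exists>ab \<in> sphere 0 1. \<psi> ab (c + real n) = 0" for n
  proof (cases "(\<theta> (c + real n), - \<phi> (c + real n)) = 0")
    case True
    then have "\<psi> (1, 0) (c + real n) = 0" by (simp add: \<psi>_def zero_prod_def)
    moreover have "norm (1 :: complex, 0 :: complex) = 1" by (simp add: norm_Pair)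
    ultimately show ?thesis by (intro bexI[of _ "(1, 0)"]) auto
  next
    case False
    let ?X = "(\<theta> (c + real n), - \<phi> (c + real n))"
    have "\<psi> (sgn ?X) (c + real n) = 0" by (simp add: \<psi>_def sgn_div_norm)
    moreover have "norm (sgn ?X) = 1" using False by (simp add: norm_sgn del: zero_prod_def)
    ultimately show ?thesis by (intro bexI[of _ "sgn ?X"]) auto
  qed
  then obtain X where X: "\<And>n. X n \<in> sphere 0 1" "\<And>n. \<psi> (X n) (c + real n) = 0" by metis
  obtain l \<sigma> where l: "l \<in> sphere 0 1" "strict_mono \<sigma>" "(X \<circ> \<sigma>) \<longlonglongrightarrow> l"
    using compact_sphere[of "0 :: complex \<times> complex" 1] X(1)
    unfolding compact_def by metis
  \<comment> \<open>By the choice of \<open>X n\<close> the boundary term at \<open>c + n\<close> is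
    gone, and the one at \<open>c\<close> has modulus at most 1 because the data lie on the unit
    sphere.\<close>
  have bound: "(\<integral>\<^sup>+x. ennreal (indicator {c..c + real n} x * ((cmod (\<psi> (X n) x))\<^sup>2 * r x)) \<partial>?M) \<le> ennreal (1 / \<bar>Im z\<bar>)" for n
  proof -
    let ?g = "\<lambda>x. (cmod (\<psi> (X n) x))\<^sup>2 * r x" and ?d = "c + real n"
    have g: "?g absolutely_integrable_on {c..?d}"
      by (intro loc_integrable_Icc[OF weight_loc_integrable] order_refl continuous_intros sl_sol_continuous_on[OF \<psi>])
    have gi: "(\<lambda>x. indicator {c..?d} x * ?g x) absolutely_integrable_on {c..?d}"
      by (rule absolutely_integrable_spike[OF g negligible_empty]) auto
    note I = integral_lebesgue_on_atLeast_support[OF gi]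
    have "(\<integral>\<^sup>+x. ennreal (indicator {c..?d} x * ?g x) \<partial>?M) = ennreal (integral\<^sup>L ?M (\<lambda>x. indicator {c..?d} x * ?g x))"
    proof (rule nn_integral_eq_integral[OF I(1)])
      show "AE x in ?M. 0 \<le> indicator {c..?d} x * ?g x" using r_pos by eventually_elim simp
    qed auto
    also have "integral\<^sup>L ?M (\<lambda>x. indicator {c..?d} x * ?g x) = integral {c..?d} ?g"
      by (subst I(2)) (auto intro!: Henstock_Kurzweil_Integration.integral_cong)
    also have "\<dots> = Im (cnj (snd (X n)) * fst (X n)) / Im z"
      using energy_has_integral[OF \<psi> z, of ?d "X n"] by (intro integral_unique) (simp add: X(2) \<psi>c)
    also have "\<dots> \<le> 1 / \<bar>Im z\<bar>"
    proof -
      have n1: "norm (X n) = 1" using X(1)[of n] by simp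
      have "\<bar>Im (cnj (snd (X n)) * fst (X n))\<bar> \<le> cmod (cnj (snd (X n)) * fst (X n))" by (rule abs_Im_le_cmod)
      also have "\<dots> \<le> 1 * 1"
        unfolding norm_mult using norm_fst_le[of "fst (X n)" "snd (X n)"] norm_snd_le[of "snd (X n)" "fst (X n)"] n1
        by (intro mult_mono) auto
      finally have "\<bar>Im (cnj (snd (X n)) * fst (X n)) / Im z\<bar> \<le> 1 / \<bar>Im z\<bar>"
        by (simp add: abs_divide divide_right_mono)
      then show ?thesis by linarith
    qed
    finally show ?thesis by (simp add: ennreal_leI)
  qed
  have meas: "(\<lambda>x. ennreal (indicator {c..c + real n} x * ((cmod (\<psi> ab x))\<^sup>2 * r x))) \<in> borel_measurable ?M" for n ab
  proof -
    have [measurable]: "\<psi> ab \<in> borel_measurable ?M" by (rule sl_sol_measurable[OF \<psi>])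
    have [measurable]: "r \<in> borel_measurable ?M" by (rule r_measurable)
    have [measurable]: "(indicator {c..c + real n} :: real \<Rightarrow> real) \<in> borel_measurable ?M"
      by (rule borel_measurable_indicator) (auto simp: sets_restrict_space_iff)
    show ?thesis by measurable
  qed
  have lim: "(\<lambda>k. ennreal (indicator {c..c + real (\<sigma> k)} x * ((cmod (\<psi> (X (\<sigma> k)) x))\<^sup>2 * r x)))
      \<longlonglongrightarrow> ennreal ((cmod (\<psi> l x))\<^sup>2 * r x)" if x: "c \<le> x" for x
  proof (rule tendsto_ennrealI, rule Lim_transform_eventually)
    have "(\<lambda>k. \<psi> (X (\<sigma> k)) x) \<longlonglongrightarrow> \<psi> l x"
      using l(3) unfolding \<psi>_def o_def by (intro tendsto_intros)
    then show "(\<lambda>k. (cmod (\<psi> (X (\<sigma> k)) x))\<^sup>2 * r x) \<longlonglongrightarrow> (cmod (\<psi> l x))\<^sup>2 * r x" by (intro tendsto_intros)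
    obtain N :: nat where N: "x - c \<le> real N" using real_arch_simple by blast
    show "\<forall>\<^sub>F k in sequentially. (cmod (\<psi> (X (\<sigma> k)) x))\<^sup>2 * r x =
        indicator {c..c + real (\<sigma> k)} x * ((cmod (\<psi> (X (\<sigma> k)) x))\<^sup>2 * r x)"
      using eventually_ge_at_top[of N]
    proof eventually_elim
      case (elim k)
      then have "N \<le> \<sigma> k" using seq_suble[OF l(2), of k] by linarith
      then show ?case using N x by (simp add: indicator_def)
    qed
  qed
  \<comment> \<open>Fatou's lemma: the truncated norms are bounded uniformly in \<open>n\<close>,
    and for fixed \<open>x\<close> the truncation is eventually inactive because
    \<open>\<sigma> k \<ge> k\<close>.\<close>
  have "(\<integral>\<^sup>+x. ennreal ((cmod (\<psi> l x))\<^sup>2 * r x) \<partial>?M)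
      = (\<integral>\<^sup>+x. liminf (\<lambda>k. ennreal (indicator {c..c + real (\<sigma> k)} x * ((cmod (\<psi> (X (\<sigma> k)) x))\<^sup>2 * r x))) \<partial>?M)"
    by (rule nn_integral_cong) (use lim_imp_Liminf[OF sequentially_bot lim] in \<open>simp add: space_restrict_space\<close>)
  also have "\<dots> \<le> liminf (\<lambda>k. \<integral>\<^sup>+x. ennreal (indicator {c..c + real (\<sigma> k)} x * ((cmod (\<psi> (X (\<sigma> k)) x))\<^sup>2 * r x)) \<partial>?M)"
    by (rule nn_integral_liminf[OF meas])
  also have "\<dots> \<le> liminf (\<lambda>k::nat. ennreal (1 / \<bar>Im z\<bar>))"
    by (intro Liminf_mono always_eventually allI bound)
  also have "\<dots> = ennreal (1 / \<bar>Im z\<bar>)" by (simp add: Liminf_const)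
  finally have fin: "(\<integral>\<^sup>+x. ennreal ((cmod (\<psi> l x))\<^sup>2 * r x) \<partial>?M) \<le> ennreal (1 / \<bar>Im z\<bar>)" .
  show ?thesis
  proof (rule that[OF \<psi>])
    show "L2_weighted r c (\<psi> l)"
      unfolding L2_weighted_def
    proof (intro conjI integrableI_nonneg)
      show m: "\<psi> l \<in> borel_measurable ?M" by (rule sl_sol_measurable[OF \<psi>])
      show "(\<lambda>x. (cmod (\<psi> l x))\<^sup>2 * r x) \<in> borel_measurable ?M"
        using m r_measurable by measurable
      show "AE x in ?M. 0 \<le> (cmod (\<psi> l x))\<^sup>2 * r x" using r_pos by eventually_elim simp
      show "(\<integral>\<^sup>+x. ennreal ((cmod (\<psi> l x))\<^sup>2 * r x) \<partial>?M) < \<infinity>"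
        using fin by (rule order.strict_trans1) simp
    qed
    have "l \<noteq> 0" using l(1) by auto
    then show "\<psi> l c \<noteq> 0 \<or> \<psi>' l c \<noteq> 0" unfolding \<psi>c by (cases l) (auto simp: zero_prod_def)
  qed
qed

lemma L2_weighted_dominated:
  assumes y: "y \<in> borel_measurable (lebesgue_on {c..})"
    and u: "L2_weighted r c u1" "L2_weighted r c u2"
    and le: "\<And>x. c \<le> x \<Longrightarrow> (cmod (y x))\<^sup>2 \<le> C * ((cmod (u1 x))\<^sup>2 + (cmod (u2 x))\<^sup>2)"
  shows "L2_weighted r c y"
  unfolding L2_weighted_def
proof (intro conjI y)
  let ?M = "lebesgue_on {c..}"
  have u': "integrable ?M (\<lambda>x. C * ((cmod (u1 x))\<^sup>2 * r x + (cmod (u2 x))\<^sup>2 * r x))"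
    using u unfolding L2_weighted_def by (intro integrable_mult_right Bochner_Integration.integrable_add) auto
  show "integrable ?M (\<lambda>x. (cmod (y x))\<^sup>2 * r x)"
  proof (rule Bochner_Integration.integrable_bound[OF u'])
    show "(\<lambda>x. (cmod (y x))\<^sup>2 * r x) \<in> borel_measurable ?M" using y r_measurable by measurable
    have "AE x in ?M. c \<le> x" by (rule AE_I2) (simp add: space_restrict_space)
    with r_pos show "AE x in ?M. norm ((cmod (y x))\<^sup>2 * r x) \<le> norm (C * ((cmod (u1 x))\<^sup>2 * r x + (cmod (u2 x))\<^sup>2 * r x))"
    proof eventually_elim
      case (elim x)
      have "(cmod (y x))\<^sup>2 * r x \<le> C * ((cmod (u1 x))\<^sup>2 + (cmod (u2 x))\<^sup>2) * r x"
        using le elim by (intro mult_right_mono) auto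
      then show ?case using elim by (simp add: algebra_simps)
    qed
  qed
qed

lemma L2_weighted_integral_le:
  assumes u: "L2_weighted r c u" and "continuous_on {c..} u"
  shows "integral {c..x} (\<lambda>t. (cmod (u t))\<^sup>2 * \<bar>r t\<bar>) \<le> (LINT t|lebesgue_on {c..}. (cmod (u t))\<^sup>2 * r t)"
proof -
  let ?M = "lebesgue_on {c..}"
  have "loc_integrable c (\<lambda>t. (cmod (u t))\<^sup>2 * norm (r t))"
    by (intro loc_integrable_mult_continuous loc_integrable_norm r_int continuous_intros assms)
  then have g: "(\<lambda>t. (cmod (u t))\<^sup>2 * \<bar>r t\<bar>) absolutely_integrable_on {c..x}" 
    using loc_integrable_Icc[of c _ c x] by fastforce
  have gi: "(\<lambda>t. indicator {c..x} t * ((cmod (u t))\<^sup>2 * \<bar>r t\<bar>)) absolutely_integrable_on {c..x}"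
    by (rule absolutely_integrable_spike[OF g negligible_empty]) auto
  note I = integral_lebesgue_on_atLeast_support[OF gi]
  have "integral {c..x} (\<lambda>t. (cmod (u t))\<^sup>2 * \<bar>r t\<bar>) = integral {c..x} (\<lambda>t. indicator {c..x} t * ((cmod (u t))\<^sup>2 * \<bar>r t\<bar>))"
    by (rule Henstock_Kurzweil_Integration.integral_cong) auto
  also have "\<dots> = (LINT t|?M. indicator {c..x} t * ((cmod (u t))\<^sup>2 * \<bar>r t\<bar>))"
    by (rule I(2)[symmetric]) auto
  also have "\<dots> \<le> (LINT t|?M. (cmod (u t))\<^sup>2 * r t)"
  proof (rule integral_mono_AE)
    show "integrable ?M (\<lambda>t. indicator {c..x} t * ((cmod (u t))\<^sup>2 * \<bar>r t\<bar>))" by (rule I(1)) auto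
    show "integrable ?M (\<lambda>t. (cmod (u t))\<^sup>2 * r t)" using u by (simp add: L2_weighted_def)
    show "AE t in ?M. indicator {c..x} t * ((cmod (u t))\<^sup>2 * \<bar>r t\<bar>) \<le> (cmod (u t))\<^sup>2 * r t"
      using r_pos by eventually_elim (auto simp: indicator_def)
  qed
  finally show ?thesis .
qed

lemma wronskian_const:
  assumes 1: "sl_sol z u1 v1" and 2: "sl_sol z u2 v2" and x: "c \<le> x"
  shows "u1 x * v2 x - v1 x * u2 x = u1 c * v2 c - v1 c * u2 c"
proof -
  have "ac_deriv c (\<lambda>x. u1 x * v2 x - v1 x * u2 x)
    (\<lambda>x. (u1 x * ((of_real (q x) - z * of_real (r x)) * u2 x) + v1 x / of_real (p x) * v2 x)
       - (v1 x * (v2 x / of_real (p x)) + (of_real (q x) - z * of_real (r x)) * u1 x * u2 x))"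
    by (intro ac_deriv_diff ac_deriv_mult sl_sol_ac[OF 1] sl_sol_ac[OF 2])
  then have "ac_deriv c (\<lambda>x. u1 x * v2 x - v1 x * u2 x) (\<lambda>x. 0)" by (simp add: mult_ac)
  then show ?thesis using x by (rule ac_deriv_zero_const)
qed

text \<open>Variation of constants, \<open>D y = a u1 + b u2\<close> with \<open>D\<close> the Wronskian: the coefficients \<open>a\<close> and \<open>b\<close>
  stay bounded by Gronwall's inequality.\<close>

theorem weyl_alternative:
  assumes 1: "sl_sol z u1 v1" "L2_weighted r c u1" and 2: "sl_sol z u2 v2" "L2_weighted r c u2"
    and D: "u1 c * v2 c - v1 c * u2 c \<noteq> 0" and y: "sl_sol \<mu> y w"
  shows "L2_weighted r c y"
proof -
  let ?M = "lebesgue_on {c..}"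
  define D where "D = u1 c * v2 c - v1 c * u2 c"
  \<comment> \<open>Cramer's rule: \<open>y D = a u1 + b u2\<close>, as the Wronskian is constant.
    In the derivatives of \<open>a\<close> and \<open>b\<close> the terms with \<open>p\<close> and
    \<open>q\<close> cancel, leaving multiples of \<open>(\<mu> - z) r y\<close>.\<close>
  define a where "a = (\<lambda>x. y x * v2 x - w x * u2 x)"
  define b where "b = (\<lambda>x. w x * u1 x - y x * v1 x)"
  define U where "U = (\<lambda>x. cmod (u1 x) + cmod (u2 x))"
  define S where "S = (\<lambda>x. cmod (a x) + cmod (b x))"
  \<comment> \<open>Gronwall kernel: \<open>|a'| + |b'|\<close> is at most
    \<open>|\<mu> - z| |r| U |y|\<close>, and inserting the bound \<open>S U / |D|\<close> for
    \<open>|y|\<close> turns this into \<open>S k\<close>. Its integral over the whole half-line is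
    finite because \<open>u1\<close> and \<open>u2\<close> are both square integrable.\<close>
  define k where "k = (\<lambda>x. cmod (\<mu> - z) / cmod D * (U x)\<^sup>2 * \<bar>r x\<bar>)"
  have D0: "cmod D > 0" using D by (simp add: D_def)
  have ac: "ac_deriv c a (\<lambda>x. (\<mu> - z) * of_real (r x) * y x * u2 x)"
  proof -
    have "ac_deriv c a (\<lambda>x. (y x * ((of_real (q x) - z * of_real (r x)) * u2 x) + w x / of_real (p x) * v2 x)
       - (w x * (v2 x / of_real (p x)) + (of_real (q x) - \<mu> * of_real (r x)) * y x * u2 x))"
      unfolding a_def by (intro ac_deriv_diff ac_deriv_mult sl_sol_ac[OF 2(1)] sl_sol_ac[OF y])
    then show ?thesis by (simp add: algebra_simps)
  qed
  have bc: "ac_deriv c b (\<lambda>x. (z - \<mu>) * of_real (r x) * y x * u1 x)"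
  proof -
    have "ac_deriv c b (\<lambda>x. (w x * (v1 x / of_real (p x)) + (of_real (q x) - \<mu> * of_real (r x)) * y x * u1 x)
       - (y x * ((of_real (q x) - z * of_real (r x)) * u1 x) + w x / of_real (p x) * v1 x))"
      unfolding b_def by (intro ac_deriv_diff ac_deriv_mult sl_sol_ac[OF 1(1)] sl_sol_ac[OF y])
    then show ?thesis by (simp add: algebra_simps)
  qed
  have cont: "continuous_on {c..} u1" "continuous_on {c..} u2" "continuous_on {c..} y"
    using sl_sol_continuous_on(1) 1 2 y by auto
  have U_cont: "continuous_on {c..} U" unfolding U_def by (intro continuous_intros cont)
  have S_cont: "continuous_on {c..} S"
    unfolding S_def by (intro continuous_intros ac_deriv_continuous_on[OF ac] ac_deriv_continuous_on[OF bc])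
  have k_int: "loc_integrable c k"
  proof -
    have "loc_integrable c (\<lambda>x. (cmod (\<mu> - z) / cmod D * (U x)\<^sup>2) * norm (r x))"
      by (intro loc_integrable_mult_continuous loc_integrable_norm r_int continuous_intros U_cont)
    then show ?thesis by (simp add: k_def)
  qed
  have k0: "0 \<le> k x" for x by (simp add: k_def)
  have y_le: "cmod (y x) \<le> S x * U x / cmod D" if x: "c \<le> x" for x
  proof -
    have "y x * D = y x * (u1 x * v2 x - v1 x * u2 x)"
      using wronskian_const[OF 1(1) 2(1) x] by (simp only: D_def)
    also have "\<dots> = a x * u1 x + b x * u2 x" by (simp add: a_def b_def algebra_simps)
    finally have "cmod (y x) * cmod D = cmod (a x * u1 x + b x * u2 x)" by (metis norm_mult)
    also have "\<dots> \<le> cmod (a x) * cmod (u1 x) + cmod (b x) * cmod (u2 x)"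
      by (metis norm_mult norm_triangle_ineq)
    also have "\<dots> \<le> S x * U x" by (simp add: S_def U_def algebra_simps)
    finally show ?thesis using D0 by (simp add: pos_le_divide_eq)
  qed
  have S_le: "S x \<le> S c * exp (integral {c..x} k)" if x: "c \<le> x" for x
  proof (rule gronwall_integral[OF S_cont k_int k0 _ x])
    fix x assume x: "c \<le> x"
    let ?f = "\<lambda>t. (\<mu> - z) * of_real (r t) * y t * u2 t" and ?g = "\<lambda>t. (z - \<mu>) * of_real (r t) * y t * u1 t"
    have f: "?f absolutely_integrable_on {c..x}" and g: "?g absolutely_integrable_on {c..x}"
      using ac_deriv_integral(1)[OF ac order_refl x] ac_deriv_integral(1)[OF bc order_refl x] by auto
    have "S x = cmod (a c + integral {c..x} ?f) + cmod (b c + integral {c..x} ?g)"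
      unfolding S_def using ac_deriv_eq_integral[OF ac x] ac_deriv_eq_integral[OF bc x] by simp
    also have "\<dots> \<le> (cmod (a c) + cmod (integral {c..x} ?f)) + (cmod (b c) + cmod (integral {c..x} ?g))"
      by (intro add_mono norm_triangle_ineq)
    also have "\<dots> = S c + (cmod (integral {c..x} ?f) + cmod (integral {c..x} ?g))" by (simp add: S_def)
    also have "cmod (integral {c..x} ?f) + cmod (integral {c..x} ?g)
        \<le> integral {c..x} (\<lambda>t. cmod (?f t)) + integral {c..x} (\<lambda>t. cmod (?g t))"
      using f g by (intro add_mono Henstock_Kurzweil_Integration.integral_norm_bound_integral)
        (auto simp: absolutely_integrable_on_def)
    also have "\<dots> = integral {c..x} (\<lambda>t. cmod (?f t) + cmod (?g t))"
      using f g by (intro Henstock_Kurzweil_Integration.integral_add[symmetric]) (auto simp: absolutely_integrable_on_def)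
    also have "\<dots> \<le> integral {c..x} (\<lambda>t. S t * k t)"
    proof (rule integral_le)
      show "(\<lambda>t. cmod (?f t) + cmod (?g t)) integrable_on {c..x}"
        using f g by (intro integrable_add) (auto simp: absolutely_integrable_on_def)
      show "(\<lambda>t. S t * k t) integrable_on {c..x}"
        by (rule loc_integrable_Icc_integrable[OF loc_integrable_mult_continuous[OF k_int S_cont] order_refl])
      fix t assume t: "t \<in> {c..x}"
      have "cmod (?f t) + cmod (?g t) = cmod (\<mu> - z) * \<bar>r t\<bar> * U t * cmod (y t)"
        by (simp add: norm_mult U_def norm_minus_commute[of z \<mu>] distrib_left distrib_right mult_ac)
      also have "\<dots> \<le> cmod (\<mu> - z) * \<bar>r t\<bar> * U t * (S t * U t / cmod D)"
        using t y_le by (intro mult_left_mono) (auto simp: U_def)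
      also have "\<dots> = S t * k t" by (simp add: k_def power2_eq_square)
      finally show "cmod (?f t) + cmod (?g t) \<le> S t * k t" .
    qed
    finally show "S x \<le> S c + integral {c..x} (\<lambda>t. S t * k t)" by simp
  qed
  define B where "B = cmod (\<mu> - z) / cmod D * (2 * (LINT t|?M. (cmod (u1 t))\<^sup>2 * r t) + 2 * (LINT t|?M. (cmod (u2 t))\<^sup>2 * r t))"
  have U2: "(U t)\<^sup>2 \<le> 2 * (cmod (u1 t))\<^sup>2 + 2 * (cmod (u2 t))\<^sup>2" for t
    using sum_squares_bound[of "cmod (u1 t)" "cmod (u2 t)"] by (simp add: U_def power2_sum)
  have k_le: "integral {c..x} k \<le> B" if x: "c \<le> x" for x
  proof -
    have i: "(\<lambda>t. (cmod (u t))\<^sup>2 * \<bar>r t\<bar>) integrable_on {c..x}" if "continuous_on {c..} u" for u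
    proof -
      have "loc_integrable c (\<lambda>t. (cmod (u t))\<^sup>2 * norm (r t))"
        by (intro loc_integrable_mult_continuous loc_integrable_norm r_int continuous_intros that)
      then show ?thesis using loc_integrable_Icc_integrable[of c _ c x] by fastforce
    qed
    have "integral {c..x} k \<le> integral {c..x} (\<lambda>t. cmod (\<mu> - z) / cmod D *
        (2 * ((cmod (u1 t))\<^sup>2 * \<bar>r t\<bar>) + 2 * ((cmod (u2 t))\<^sup>2 * \<bar>r t\<bar>)))"
    proof (rule integral_le)
      show "k integrable_on {c..x}" by (rule loc_integrable_Icc_integrable[OF k_int order_refl])
      show "(\<lambda>t. cmod (\<mu> - z) / cmod D * (2 * ((cmod (u1 t))\<^sup>2 * \<bar>r t\<bar>) + 2 * ((cmod (u2 t))\<^sup>2 * \<bar>r t\<bar>))) integrable_on {c..x}"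
        by (intro integrable_on_mult_right integrable_add i cont)
      fix t
      have "cmod (\<mu> - z) / cmod D * ((U t)\<^sup>2 * \<bar>r t\<bar>) \<le>
          cmod (\<mu> - z) / cmod D * ((2 * (cmod (u1 t))\<^sup>2 + 2 * (cmod (u2 t))\<^sup>2) * \<bar>r t\<bar>)"
        by (intro mult_left_mono mult_right_mono U2) auto
      then show "k t \<le> cmod (\<mu> - z) / cmod D * (2 * ((cmod (u1 t))\<^sup>2 * \<bar>r t\<bar>) + 2 * ((cmod (u2 t))\<^sup>2 * \<bar>r t\<bar>))"
        by (simp add: k_def algebra_simps)
    qed
    also have "\<dots> = cmod (\<mu> - z) / cmod D * (2 * integral {c..x} (\<lambda>t. (cmod (u1 t))\<^sup>2 * \<bar>r t\<bar>)
        + 2 * integral {c..x} (\<lambda>t. (cmod (u2 t))\<^sup>2 * \<bar>r t\<bar>))"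
      by (subst integral_mult_right, subst Henstock_Kurzweil_Integration.integral_add)
         (simp_all add: integral_mult_right integrable_on_mult_right i cont)
    also have "\<dots> \<le> B"
      unfolding B_def
      by (intro mult_left_mono add_mono L2_weighted_integral_le 1 2 cont) auto
    finally show ?thesis .
  qed
  show ?thesis
  proof (rule L2_weighted_dominated[OF sl_sol_measurable[OF y] 1(2) 2(2)])
    fix x assume x: "c \<le> x"
    have "S x \<le> S c * exp B"
      by (rule order.trans[OF S_le[OF x] mult_left_mono]) (use k_le[OF x] in \<open>auto simp: S_def\<close>)
    then have "S x * U x / cmod D \<le> S c * exp B * U x / cmod D"
      by (intro divide_right_mono mult_right_mono) (auto simp: U_def)
    then have "cmod (y x) \<le> S c * exp B / cmod D * U x" using y_le[OF x] by simp
    then have "(cmod (y x))\<^sup>2 \<le> (S c * exp B / cmod D * U x)\<^sup>2" by (intro power_mono) auto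
    also have "\<dots> = (S c * exp B / cmod D)\<^sup>2 * (U x)\<^sup>2" by (rule power_mult_distrib)
    also have "\<dots> \<le> (S c * exp B / cmod D)\<^sup>2 * (2 * (cmod (u1 x))\<^sup>2 + 2 * (cmod (u2 x))\<^sup>2)"
      by (intro mult_left_mono U2) simp
    finally show "(cmod (y x))\<^sup>2 \<le> 2 * (S c * exp B / cmod D)\<^sup>2 * ((cmod (u1 x))\<^sup>2 + (cmod (u2 x))\<^sup>2)"
      by (simp add: algebra_simps)
  qed
qed

end

section \<open>The limit point criterion\<close>

text \<open>Completeness of Lebesgue measure. It gives the measurability of
  \<open>ell p q r c f\<close>, which is accessible through an almost everywhere formula.\<close>

lemma borel_measurable_lebesgue_on_AE:
  fixes f g :: "real \<Rightarrow> 'a::euclidean_space"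
  assumes f: "f \<in> borel_measurable (lebesgue_on S)" and S: "S \<in> sets lebesgue"
    and ae: "AE x in lebesgue_on S. g x = f x"
  shows "g \<in> borel_measurable (lebesgue_on S)"
proof -
  have "AE x in lebesgue. x \<in> S \<longrightarrow> g x = f x" using ae S by (simp add: AE_restrict_space_iff)
  then have "AE x in lebesgue. (if x \<in> S then f x else 0) = (if x \<in> S then g x else 0)"
    by eventually_elim auto
  with borel_measurable_if_I[OF f S] have "(\<lambda>x. if x \<in> S then g x else 0) \<in> borel_measurable lebesgue"
    by (rule borel_measurable_AE)
  then show ?thesis by (rule borel_measurable_if_D)
qed

lemma loc_integrable_continuous: "continuous_on {c..} f \<Longrightarrow> loc_integrable c f"
  unfolding loc_integrable_def
  by (intro allI impI absolutely_integrable_continuous_real) (auto intro: continuous_on_subset)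

lemma loc_integrable_diff:
  "loc_integrable c f \<Longrightarrow> loc_integrable c g \<Longrightarrow> loc_integrable c (\<lambda>x. f x - g x)"
  unfolding loc_integrable_def by (auto intro: set_integral_diff(1))

lemma ac_deriv_lipschitz_piecewise:
  fixes f :: "real \<Rightarrow> 'a::euclidean_space"
  assumes lip: "\<And>x y. norm (f y - f x) \<le> B * \<bar>y - x\<bar>" and "finite F"
    and der: "\<And>x. x \<notin> F \<Longrightarrow> (f has_vector_derivative f' x) (at x)"
  shows "ac_deriv c f f'"
  unfolding ac_deriv_def
proof (intro conjI allI impI)
  fix d
  have "abs_continuous_on_interval c d (\<lambda>x. x)"
    unfolding abs_continuous_on_interval_def
  proof (intro allI impI)
    fix \<epsilon> :: real assume "\<epsilon> > 0"
    then show "\<exists>\<delta>>0. \<forall>(n::nat) s t. (\<forall>i<n. c \<le> s i \<and> s i \<le> t i \<and> t i \<le> d) \<longrightarrow>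
       disjoint_family_on (\<lambda>i. {s i<..<t i}) {..<n} \<longrightarrow> (\<Sum>i<n. t i - s i) < \<delta> \<longrightarrow>
       (\<Sum>i<n. norm (t i - s i)) < \<epsilon>"
      by (intro exI[of _ \<epsilon>]) (auto cong: sum.cong_simp)
  qed
  then show "abs_continuous_on_interval c d f"
  proof (rule abs_continuous_on_interval_lipschitz_compose)
    fix x y show "norm (f y - f x) \<le> B * norm (y - x)" using lip[of y x] by simp
  qed
next
  show "AE x in lebesgue_on {c..}. (f has_vector_derivative f' x) (at x)"
    by (rule AE_lebesgue_onI[of F]) (use assms in \<open>auto intro: negligible_finite\<close>)
qed

section \<open>The cutoff function\<close>

text \<open>The cubic \<open>1 - 3t\<^sup>2 + 2t\<^sup>3\<close> has vanishing derivative at 0 and 1, which makes the derivative of the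
  cutoff absolutely continuous although the ramp has kinks.\<close>

definition ramp :: "real \<Rightarrow> real \<Rightarrow> real"
  where "ramp \<rho> x = max 0 (min 1 (2 * x / \<rho> - 1))"

definition ramp' :: "real \<Rightarrow> real \<Rightarrow> real"
  where "ramp' \<rho> x = (if \<rho> / 2 < x \<and> x < \<rho> then 2 / \<rho> else 0)"

definition cutoff :: "real \<Rightarrow> real \<Rightarrow> real"
  where "cutoff \<rho> x = 1 - 3 * (ramp \<rho> x * ramp \<rho> x) + 2 * (ramp \<rho> x * (ramp \<rho> x * ramp \<rho> x))"

text \<open>The chain rule produces the factor \<open>ramp' \<rho> x\<close>; the constant
  \<open>2 / \<rho>\<close> may stand for it because \<open>6 t^2 - 6 t\<close> vanishes wherever
  the ramp is flat. In this form the derivative is a polynomial in the ramp and hence itself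
  absolutely continuous.\<close>

definition cutoff' :: "real \<Rightarrow> real \<Rightarrow> real"
  where "cutoff' \<rho> x = 2 / \<rho> * (6 * (ramp \<rho> x * ramp \<rho> x) - 6 * ramp \<rho> x)"

definition cutoff'' :: "real \<Rightarrow> real \<Rightarrow> real"
  where "cutoff'' \<rho> x = 2 / \<rho> * (12 * ramp \<rho> x - 6) * ramp' \<rho> x"

lemma ramp_simps:
  assumes "\<rho> > 0"
  shows "x \<le> \<rho> / 2 \<Longrightarrow> ramp \<rho> x = 0" "\<rho> \<le> x \<Longrightarrow> ramp \<rho> x = 1"
    "\<rho> / 2 < x \<Longrightarrow> x < \<rho> \<Longrightarrow> ramp \<rho> x = 2 * x / \<rho> - 1"
    "0 \<le> ramp \<rho> x" "ramp \<rho> x \<le> 1"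
  using assms by (auto simp: ramp_def max_def min_def field_simps)

lemma ac_deriv_ramp:
  assumes \<rho>: "\<rho> > 0" shows "ac_deriv c (ramp \<rho>) (ramp' \<rho>)"
proof (rule ac_deriv_lipschitz_piecewise[of _ "2 / \<rho>" "{\<rho> / 2, \<rho>}"])
  fix x y :: real
  have "\<bar>max 0 (min 1 u) - max 0 (min 1 v)\<bar> \<le> \<bar>u - v\<bar>" for u v :: real by (auto simp: max_def min_def)
  moreover have "2 * y / \<rho> - 1 - (2 * x / \<rho> - 1) = 2 / \<rho> * (y - x)" by (simp add: algebra_simps diff_divide_distrib)
  ultimately have "\<bar>ramp \<rho> y - ramp \<rho> x\<bar> \<le> \<bar>2 / \<rho> * (y - x)\<bar>" unfolding ramp_def by metis
  also have "\<bar>2 / \<rho> * (y - x)\<bar> = 2 / \<rho> * \<bar>y - x\<bar>"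
    unfolding abs_mult using \<rho> by simp
  finally show "norm (ramp \<rho> y - ramp \<rho> x) \<le> 2 / \<rho> * \<bar>y - x\<bar>" by simp
next
  fix x assume x: "x \<notin> {\<rho> / 2, \<rho>}"
  then consider "x < \<rho> / 2" | "\<rho> / 2 < x" "x < \<rho>" | "\<rho> < x" by fastforce
  then show "(ramp \<rho> has_vector_derivative ramp' \<rho> x) (at x)"
  proof cases
    case 1
    have "((\<lambda>x. 0) has_vector_derivative 0) (at x)" by (rule has_vector_derivative_const)
    then have "(ramp \<rho> has_vector_derivative 0) (at x)"
      by (rule has_vector_derivative_transform_within_open[of _ _ _ "{..<\<rho> / 2}"]) (use 1 \<rho> ramp_simps in auto)
    then show ?thesis using 1 by (simp add: ramp'_def)
  next
    case 2
    have "((\<lambda>x. 2 * x / \<rho> - 1) has_vector_derivative 2 / \<rho>) (at x)"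
      unfolding has_real_derivative_iff_has_vector_derivative[symmetric]
      using \<rho> by (auto intro!: derivative_eq_intros)
    then have "(ramp \<rho> has_vector_derivative 2 / \<rho>) (at x)"
      by (rule has_vector_derivative_transform_within_open[of _ _ _ "{\<rho> / 2<..<\<rho>}"]) (use 2 \<rho> ramp_simps in auto)
    then show ?thesis using 2 by (simp add: ramp'_def)
  next
    case 3
    have "((\<lambda>x. 1) has_vector_derivative 0) (at x)" by (rule has_vector_derivative_const)
    then have "(ramp \<rho> has_vector_derivative 0) (at x)"
      by (rule has_vector_derivative_transform_within_open[of _ _ _ "{\<rho><..}"]) (use 3 \<rho> ramp_simps in auto)
    then show ?thesis using 3 by (simp add: ramp'_def)
  qed
qed auto

lemma ac_deriv_cutoff:
  assumes \<rho>: "\<rho> > 0"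
  shows "ac_deriv c (cutoff \<rho>) (cutoff' \<rho>)" "ac_deriv c (cutoff' \<rho>) (cutoff'' \<rho>)"
proof -
  let ?t = "ramp \<rho>" and ?t' = "ramp' \<rho>"
  note t = ac_deriv_ramp[OF \<rho>, of c]
  have 1: "ac_deriv c (cutoff \<rho>) (\<lambda>x. 0 - 3 * (?t x * ?t' x + ?t' x * ?t x) + 
      2 * (?t x * (?t x * ?t' x + ?t' x * ?t x) + ?t' x * (?t x * ?t x)))"
    unfolding cutoff_def by (intro ac_deriv_add ac_deriv_diff ac_deriv_const ac_deriv_cmult ac_deriv_mult t)
  have "0 - 3 * (?t x * ?t' x + ?t' x * ?t x) + 
      2 * (?t x * (?t x * ?t' x + ?t' x * ?t x) + ?t' x * (?t x * ?t x)) = cutoff' \<rho> x" for x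
  proof (cases "\<rho> / 2 < x \<and> x < \<rho>")
    case True
    then show ?thesis by (simp add: cutoff'_def ramp'_def algebra_simps)
  next
    case False
    then have "ramp \<rho> x = 0 \<or> ramp \<rho> x = 1" using ramp_simps(1,2)[OF \<rho>, of x] by linarith
    then show ?thesis using False by (auto simp: cutoff'_def ramp'_def)
  qed
  with 1 show "ac_deriv c (cutoff \<rho>) (cutoff' \<rho>)" by simp
  have "ac_deriv c (cutoff' \<rho>) (\<lambda>x. 2 / \<rho> * (6 * (?t x * ?t' x + ?t' x * ?t x) - 6 * ?t' x))"
    unfolding cutoff'_def by (intro ac_deriv_diff ac_deriv_cmult ac_deriv_mult t)
  moreover have "2 / \<rho> * (6 * (?t x * ?t' x + ?t' x * ?t x) - 6 * ?t' x) = cutoff'' \<rho> x" for x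
    by (simp add: cutoff''_def algebra_simps)
  ultimately show "ac_deriv c (cutoff' \<rho>) (cutoff'' \<rho>)" by simp
qed

lemma cutoff_simps:
  assumes \<rho>: "\<rho> > 0"
  shows "x \<le> \<rho> / 2 \<Longrightarrow> cutoff \<rho> x = 1" "\<rho> \<le> x \<Longrightarrow> cutoff \<rho> x = 0"
    "x \<notin> {\<rho> / 2<..<\<rho>} \<Longrightarrow> cutoff' \<rho> x = 0" "x \<notin> {\<rho> / 2<..<\<rho>} \<Longrightarrow> cutoff'' \<rho> x = 0"
    "0 \<le> cutoff \<rho> x" "cutoff \<rho> x \<le> 1" "\<bar>cutoff' \<rho> x\<bar> \<le> 3 / \<rho>" "\<bar>cutoff'' \<rho> x\<bar> \<le> 24 / \<rho>\<^sup>2"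
proof -
  note t = ramp_simps[OF \<rho>, of x]
  let ?t = "ramp \<rho> x"
  show "x \<le> \<rho> / 2 \<Longrightarrow> cutoff \<rho> x = 1" "\<rho> \<le> x \<Longrightarrow> cutoff \<rho> x = 0" using t by (simp_all add: cutoff_def)
  show "x \<notin> {\<rho> / 2<..<\<rho>} \<Longrightarrow> cutoff' \<rho> x = 0" using t(1,2) by (cases "x \<le> \<rho> / 2") (auto simp: cutoff'_def)
  show "x \<notin> {\<rho> / 2<..<\<rho>} \<Longrightarrow> cutoff'' \<rho> x = 0" by (auto simp: cutoff''_def ramp'_def)
  \<comment> \<open>Factorisations of the cubic and of 1 minus the cubic, from which both bounds can
    be read off for \<open>t\<close> between 0 and 1.\<close>
  have "cutoff \<rho> x = (1 - ?t)\<^sup>2 * (1 + 2 * ?t)" by (simp add: cutoff_def power2_eq_square algebra_simps)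
  then show "0 \<le> cutoff \<rho> x" using t(4) by simp
  have "1 - cutoff \<rho> x = ?t\<^sup>2 * (3 - 2 * ?t)" by (simp add: cutoff_def power2_eq_square algebra_simps)
  moreover have "0 \<le> ?t\<^sup>2 * (3 - 2 * ?t)" using t(5) by (intro mult_nonneg_nonneg) auto
  ultimately show "cutoff \<rho> x \<le> 1" by linarith
  \<comment> \<open>Completing the square: \<open>6 t (1 - t)\<close> is at most \<open>3/2\<close>,
    with equality at \<open>t = 1/2\<close>.\<close>
  have "0 \<le> (2 * ?t - 1)\<^sup>2" by simp
  then have "\<bar>6 * (?t * ?t) - 6 * ?t\<bar> \<le> 3 / 2"
    using mult_nonneg_nonneg[of ?t "1 - ?t"] t(4,5) by (simp add: power2_eq_square algebra_simps abs_le_iff)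
  then have "\<bar>2 / \<rho>\<bar> * \<bar>6 * (?t * ?t) - 6 * ?t\<bar> \<le> \<bar>2 / \<rho>\<bar> * (3 / 2)" by (intro mult_left_mono) auto
  then show "\<bar>cutoff' \<rho> x\<bar> \<le> 3 / \<rho>" using \<rho> unfolding cutoff'_def abs_mult by simp
  have "\<bar>ramp' \<rho> x\<bar> \<le> 2 / \<rho>" using \<rho> by (simp add: ramp'_def)
  moreover have "\<bar>12 * ?t - 6\<bar> \<le> 6" using t(4,5) by (simp add: abs_le_iff)
  ultimately have "\<bar>2 / \<rho>\<bar> * \<bar>12 * ?t - 6\<bar> * \<bar>ramp' \<rho> x\<bar> \<le> 2 / \<rho> * 6 * (2 / \<rho>)"
    using \<rho> by (intro mult_mono) auto
  then show "\<bar>cutoff'' \<rho> x\<bar> \<le> 24 / \<rho>\<^sup>2" unfolding cutoff''_def abs_mult by (simp add: power2_eq_square)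
qed


section \<open>The lower bound of the form, tested on a cut-off solution\<close>

context sturm_liouville
begin

text \<open>The norm of \<open>y\<close> is split at \<open>\<rho> / 2\<close>. To the left the
  cutoff is 1 and the form inequality bounds that part by \<open>9 C\<close> times the tail; the
  summand 1 is the tail itself.\<close>

lemma cutoff_estimate:
  assumes p_ac: "\<And>d. c \<le> d \<Longrightarrow> abs_continuous_on_interval c d p"
    and p'r: "L1_loc {c<..} (\<lambda>x. (deriv p x)\<^sup>2 / r x)" and r1: "L1_loc {c<..} (\<lambda>x. 1 / r x)"
    and form: "\<And>u. u \<in> D_min p q r c \<Longrightarrow>
      \<gamma> * (LINT x|lebesgue_on {c..}. (cmod (u x))\<^sup>2 * r x) \<le>
      Re (LINT x|lebesgue_on {c..}. cnj (u x) * ell p q r c u x * of_real (r x))"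
    and s: "sl_sol (of_real (\<gamma> - 1)) y w" "y c = 0" and L2: "L2_weighted r c y"
    and \<rho>: "0 < \<rho>" "c < \<rho> / 2"
    and C: "0 \<le> C" "AE x in lebesgue_on {c..}. \<rho> / 2 < x \<and> x < \<rho> \<longrightarrow> p x \<le> C * \<rho>\<^sup>2 * r x"
  shows "(LINT x|lebesgue_on {c..}. (cmod (y x))\<^sup>2 * r x)
    \<le> (1 + 9 * C) * (LINT x|lebesgue_on {c..}. indicator {\<rho> / 2..} x * ((cmod (y x))\<^sup>2 * r x))"
proof -
  let ?M = "lebesgue_on {c..}"
  define z where "z = \<gamma> - 1"
  define \<phi> \<psi> \<psi>' where "\<phi> = cutoff \<rho>" and "\<psi> = cutoff' \<rho>" and "\<psi>' = cutoff'' \<rho>"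
  note cut = cutoff_simps[OF \<rho>(1), folded \<phi>_def \<psi>_def \<psi>'_def]
  have \<phi>: "ac_deriv c \<phi> \<psi>" and \<psi>: "ac_deriv c \<psi> \<psi>'"
    using ac_deriv_cutoff[OF \<rho>(1)] by (auto simp: \<phi>_def \<psi>_def \<psi>'_def)
  have p: "ac_deriv c p (deriv p)"
  proof -
    have "AE x in ?M. (p has_vector_derivative vector_derivative p (at x)) (at x)"
      using ac_deriv_vector_derivative[OF p_ac] by (simp add: ac_deriv_def)
    then have "AE x in ?M. (p has_vector_derivative deriv p x) (at x)"
    proof eventually_elim
      case (elim x)
      then show ?case
        unfolding has_real_derivative_iff_has_vector_derivative[symmetric] using DERIV_imp_deriv by metis
    qed
    then show ?thesis using p_ac by (simp add: ac_deriv_def)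
  qed
  define h where "h = (\<lambda>x. p x * \<psi>' x + deriv p x * \<psi> x)"
  have p\<psi>: "ac_deriv c (\<lambda>x. p x * \<psi> x) h" unfolding h_def by (rule ac_deriv_mult[OF p \<psi>])
  note y = sl_sol_ac(1)[OF s(1), folded z_def] and w = sl_sol_ac(2)[OF s(1), folded z_def]
  have cont: "continuous_on {c..} y" "continuous_on {c..} w" "continuous_on {c..} \<phi>"
    "continuous_on {c..} \<psi>" "continuous_on {c..} p"
    by (rule ac_deriv_continuous_on[OF y] ac_deriv_continuous_on[OF w] ac_deriv_continuous_on[OF \<phi>]
        ac_deriv_continuous_on[OF \<psi>] ac_deriv_continuous_on[OF p])+
  note creal = ac_deriv_bounded_linear[OF _ bounded_linear_of_real[where 'a = complex]]
  define f where "f = (\<lambda>x. of_real (\<phi> x) * y x)"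
  \<comment> \<open>The quasi-derivative of \<open>f\<close>:
    \<open>p (\<phi> y)' = \<phi> w + p \<psi> y\<close>.\<close>
  define g where "g = (\<lambda>x. of_real (\<phi> x) * w x + of_real (p x * \<psi> x) * y x)"
  define g' where "g' = (\<lambda>x. (of_real (\<phi> x) * ((of_real (q x) - of_real z * of_real (r x)) * y x) + of_real (\<psi> x) * w x)
      + (of_real (p x * \<psi> x) * (w x / of_real (p x)) + of_real (h x) * y x))"
  have g: "ac_deriv c g g'"
    unfolding g_def g'_def by (intro ac_deriv_add ac_deriv_mult creal[OF \<phi>] creal[OF p\<psi>] y w)
  have f: "ac_deriv c f (\<lambda>x. g x / of_real (p x))"
  proof (rule ac_deriv_cong)
    show "ac_deriv c f (\<lambda>x. of_real (\<phi> x) * (w x / of_real (p x)) + of_real (\<psi> x) * y x)"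
      unfolding f_def by (intro ac_deriv_mult creal[OF \<phi>] y)
    show "AE x in ?M. g x / of_real (p x) = of_real (\<phi> x) * (w x / of_real (p x)) + of_real (\<psi> x) * y x"
      using p_pos by eventually_elim (simp add: g_def field_simps)
  qed simp
  \<comment> \<open>The price of the cutoff: \<open>f\<close> solves the equation of
    \<open>y\<close> up to \<open>- b / r\<close>. The factor 2 arises because
    \<open>\<psi> w\<close> appears once from differentiating \<open>\<phi> w\<close> and once from
    differentiating \<open>p \<psi> y\<close>.\<close>
  define b where "b = (\<lambda>x. 2 * of_real (\<psi> x) * w x + of_real (h x) * y x)"
  have ell_f: "AE x in ?M. ell p q r c f x = of_real z * f x - b x / of_real (r x)"
    using ac_deriv_ell(2)[OF f g] p_pos r_pos
    by eventually_elim (simp add: f_def g'_def b_def field_simps)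
  \<comment> \<open>The support of \<open>b\<close> stays away from \<open>c\<close>, where \<open>1/r\<close> need not be integrable.\<close>
  have b_supp: "b x = 0" if "x \<notin> {\<rho> / 2<..<\<rho>}" for x
    using cut(3,4)[OF that] by (simp add: b_def h_def)
  have h_int: "loc_integrable c h" by (rule ac_deriv_loc_integrable[OF p\<psi>])
  have \<psi>r: "continuous_on {c..} (\<lambda>x. of_real (\<psi> x) :: complex)" "continuous_on {c..} (\<lambda>x. of_real (\<phi> x) :: complex)"
    by (intro continuous_on_of_real cont)+
  have b_int: "loc_integrable c b"
  proof -
    have "loc_integrable c (\<lambda>x. 2 * of_real (\<psi> x) * w x + y x * of_real (h x))"
      by (intro loc_integrable_add loc_integrable_mult_continuous loc_integrable_continuous continuous_intros cont \<psi>r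
          loc_integrable_bounded_linear[OF h_int bounded_linear_of_real])
    then show ?thesis by (simp add: b_def mult.commute)
  qed
  have b_meas: "b \<in> borel_measurable ?M"
    by (rule borel_measurable_integrable[OF integral_lebesgue_on_atLeast_support(1)[OF loc_integrable_Icc[OF b_int order_refl, where b = \<rho>]]])
      (simp add: b_supp)
  have y_meas: "y \<in> borel_measurable ?M" by (rule sl_sol_measurable[OF s(1)])
  have f_meas: "f \<in> borel_measurable ?M"
    unfolding f_def
    by (intro continuous_imp_measurable_on_sets_lebesgue continuous_intros cont \<psi>r) auto
  have G_meas: "(\<lambda>x. of_real z * f x - b x / of_real (r x)) \<in> borel_measurable ?M"
    using f_meas b_meas r_measurable by measurable
  have ell_meas: "ell p q r c f \<in> borel_measurable ?M"
    by (rule borel_measurable_lebesgue_on_AE[OF G_meas _ ell_f]) simp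
  have f_L2: "L2_weighted r c f"
  proof (rule L2_weighted_dominated[OF f_meas L2 L2, of 1])
    fix x
    have "cmod (f x) \<le> 1 * cmod (y x)"
      unfolding f_def norm_mult using cut(5,6) by (intro mult_right_mono) auto
    then have "(cmod (f x))\<^sup>2 \<le> (cmod (y x))\<^sup>2" by (intro power_mono) auto
    then show "(cmod (f x))\<^sup>2 \<le> 1 * ((cmod (y x))\<^sup>2 + (cmod (y x))\<^sup>2)"
      by (rule order.trans) simp
  qed
  have ell_L2: "L2_weighted r c (ell p q r c f)"
    unfolding L2_weighted_def
  proof (intro conjI ell_meas)
    let ?K = "{\<rho> / 2..\<rho>}"
    have K: "?K \<subseteq> {c..}" "?K \<subseteq> {c<..}" "compact ?K" using \<rho> by auto
    have "bounded (y ` ?K)" "bounded (w ` ?K)" "bounded (p ` ?K)"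
      using cont K by (auto intro!: compact_imp_bounded compact_continuous_image intro: continuous_on_subset)
    then obtain B1 B2 B3 where B: "\<forall>v\<in>y ` ?K. norm v \<le> B1" "\<forall>v\<in>w ` ?K. norm v \<le> B2" "\<forall>v\<in>p ` ?K. norm v \<le> B3"
      unfolding bounded_iff by blast
    \<comment> \<open>On \<open>?K\<close> the functions \<open>y\<close>, \<open>w\<close> and
      \<open>p\<close> are bounded by continuity, while \<open>deriv p\<close> need not be;
      \<open>c2\<close> is its coefficient and \<open>c1\<close> collects everything else.\<close>
    define c1 where "c1 = 6 / \<rho> * \<bar>B2\<bar> + \<bar>B3\<bar> * (24 / \<rho>\<^sup>2) * \<bar>B1\<bar>"
    define c2 where "c2 = 3 / \<rho> * \<bar>B1\<bar>"
    have b_le: "cmod (b x) \<le> c1 + c2 * \<bar>deriv p x\<bar>" if x: "x \<in> ?K" for x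
    proof -
      have bx: "cmod (y x) \<le> \<bar>B1\<bar>" "cmod (w x) \<le> \<bar>B2\<bar>" "\<bar>p x\<bar> \<le> \<bar>B3\<bar>"
        using B x by (fastforce intro: order.trans[OF _ abs_ge_self])+
      have "\<bar>h x\<bar> \<le> \<bar>p x\<bar> * \<bar>\<psi>' x\<bar> + \<bar>deriv p x\<bar> * \<bar>\<psi> x\<bar>"
        unfolding h_def by (metis abs_mult abs_triangle_ineq)
      also have "\<dots> \<le> \<bar>B3\<bar> * (24 / \<rho>\<^sup>2) + \<bar>deriv p x\<bar> * (3 / \<rho>)"
        using bx cut(7,8) by (intro add_mono mult_mono) auto
      finally have hx: "\<bar>h x\<bar> \<le> \<bar>B3\<bar> * (24 / \<rho>\<^sup>2) + \<bar>deriv p x\<bar> * (3 / \<rho>)" .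
      have "cmod (b x) \<le> 2 * \<bar>\<psi> x\<bar> * cmod (w x) + \<bar>h x\<bar> * cmod (y x)"
        unfolding b_def by (rule norm_triangle_le) (simp add: norm_mult)
      also have "\<dots> \<le> 2 * (3 / \<rho>) * \<bar>B2\<bar> + (\<bar>B3\<bar> * (24 / \<rho>\<^sup>2) + \<bar>deriv p x\<bar> * (3 / \<rho>)) * \<bar>B1\<bar>"
        using bx cut(7)[of x] hx \<rho>(1) by (intro add_mono mult_mono) auto
      also have "\<dots> = c1 + c2 * \<bar>deriv p x\<bar>" by (simp add: c1_def c2_def algebra_simps)
      finally show ?thesis .
    qed
    \<comment> \<open>Majorant of the density of \<open>ell f\<close>, from
      \<open>(s + t)^2 \<le> 2 s^2 + 2 t^2\<close> used twice. The weights \<open>1 / r\<close> and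
      \<open>(deriv p)^2 / r\<close> are those of the hypotheses, restricted to a compact set away
      from \<open>c\<close>.\<close>
    define H where "H = (\<lambda>x. 2 * z\<^sup>2 * ((cmod (f x))\<^sup>2 * r x) +
        indicator ?K x * (4 * c1\<^sup>2 * (1 / r x) + 4 * c2\<^sup>2 * ((deriv p x)\<^sup>2 / r x)))"
    have "integrable ?M (\<lambda>x. indicator ?K x * (4 * c1\<^sup>2 * (1 / r x) + 4 * c2\<^sup>2 * ((deriv p x)\<^sup>2 / r x)))"
    proof -
      have "(\<lambda>x. 1 / r x) absolutely_integrable_on ?K" "(\<lambda>x. (deriv p x)\<^sup>2 / r x) absolutely_integrable_on ?K"
        using r1 p'r K unfolding L1_loc_def by blast+
      then have "(\<lambda>x. 4 * c1\<^sup>2 * (1 / r x) + 4 * c2\<^sup>2 * ((deriv p x)\<^sup>2 / r x)) absolutely_integrable_on ?K"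
        by (intro set_integral_add(1) set_integrable_mult_right) auto
      then have "integrable lebesgue (\<lambda>x. indicator ?K x *\<^sub>R (4 * c1\<^sup>2 * (1 / r x) + 4 * c2\<^sup>2 * ((deriv p x)\<^sup>2 / r x)))"
        by (simp add: set_integrable_def)
      then have "integrable lebesgue (\<lambda>x. indicator {c..} x *\<^sub>R (indicator ?K x * (4 * c1\<^sup>2 * (1 / r x) + 4 * c2\<^sup>2 * ((deriv p x)\<^sup>2 / r x))))"
        using K(1) by (elim Bochner_Integration.integrable_cong[THEN iffD1, rotated 2]) (auto simp: indicator_def)
      then show ?thesis by (simp add: integrable_restrict_space)
    qed
    then have H: "integrable ?M H"
      unfolding H_def using f_L2 unfolding L2_weighted_def
      by (intro Bochner_Integration.integrable_add integrable_mult_right) auto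
    show "integrable ?M (\<lambda>x. (cmod (ell p q r c f x))\<^sup>2 * r x)"
    proof (rule Bochner_Integration.integrable_bound[OF H])
      show "(\<lambda>x. (cmod (ell p q r c f x))\<^sup>2 * r x) \<in> borel_measurable ?M"
        using ell_meas r_measurable by measurable
      show "AE x in ?M. norm ((cmod (ell p q r c f x))\<^sup>2 * r x) \<le> norm (H x)"
        using ell_f r_pos
      proof eventually_elim
        case (elim x)
        define bb where "bb = cmod (b x) / r x"
        have "cmod (ell p q r c f x) \<le> \<bar>z\<bar> * cmod (f x) + bb"
          unfolding elim(1) bb_def using norm_triangle_ineq4[of "of_real z * f x" "b x / of_real (r x)"] elim(2)
          by (simp add: norm_mult norm_divide)
        then have "(cmod (ell p q r c f x))\<^sup>2 \<le> (\<bar>z\<bar> * cmod (f x) + bb)\<^sup>2" by (intro power_mono) auto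
        also have "\<dots> \<le> 2 * (\<bar>z\<bar> * cmod (f x))\<^sup>2 + 2 * bb\<^sup>2"
          using sum_squares_bound[of "\<bar>z\<bar> * cmod (f x)" bb] by (simp add: power2_sum)
        finally have "(cmod (ell p q r c f x))\<^sup>2 * r x \<le> (2 * (\<bar>z\<bar> * cmod (f x))\<^sup>2 + 2 * bb\<^sup>2) * r x"
          using elim(2) by (intro mult_right_mono) auto
        also have "\<dots> = 2 * z\<^sup>2 * ((cmod (f x))\<^sup>2 * r x) + 2 * ((cmod (b x))\<^sup>2 / r x)"
          using elim(2) by (simp add: bb_def power_mult_distrib power_divide power2_eq_square field_simps)
        also have "2 * ((cmod (b x))\<^sup>2 / r x) \<le> indicator ?K x * (4 * c1\<^sup>2 * (1 / r x) + 4 * c2\<^sup>2 * ((deriv p x)\<^sup>2 / r x))"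
        proof (cases "x \<in> ?K")
          case True
          have "(cmod (b x))\<^sup>2 \<le> (c1 + c2 * \<bar>deriv p x\<bar>)\<^sup>2" using b_le[OF True] by (intro power_mono) auto
          also have "\<dots> \<le> 2 * c1\<^sup>2 + 2 * (c2 * \<bar>deriv p x\<bar>)\<^sup>2"
            using sum_squares_bound[of c1 "c2 * \<bar>deriv p x\<bar>"] by (simp add: power2_sum)
          finally have "2 * ((cmod (b x))\<^sup>2 / r x) \<le> 2 * ((2 * c1\<^sup>2 + 2 * (c2 * \<bar>deriv p x\<bar>)\<^sup>2) / r x)"
            using elim(2) by (intro mult_left_mono divide_right_mono) auto
          then show ?thesis using True by (simp add: power_mult_distrib add_divide_distrib)
        next
          case False
          then have "x \<notin> {\<rho> / 2<..<\<rho>}" by auto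
          then show ?thesis using b_supp False by simp
        qed
        finally have "(cmod (ell p q r c f x))\<^sup>2 * r x \<le> H x" by (simp add: H_def)
        moreover have "0 \<le> (cmod (ell p q r c f x))\<^sup>2 * r x" using elim(2) by simp
        ultimately show ?case by simp
      qed
    qed
  qed
  have "f \<in> D_min p q r c"
    unfolding D_min_def D_max_def
  proof (intro CollectI conjI f_L2 ell_L2 ac_deriv_ell(1)[OF f g])
    show "f c = 0" by (simp add: f_def s(2))
    have "x \<le> \<rho>" if "f x \<noteq> 0" for x using that cut(2)[of x] by (cases "x \<le> \<rho>") (auto simp: f_def)
    then have "{x \<in> {c..}. f x \<noteq> 0} \<subseteq> {c..\<rho>}" by auto
    then have "bounded {x \<in> {c..}. f x \<noteq> 0}" by (rule bounded_subset[rotated]) simp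
    then show "compact (closure {x \<in> {c..}. f x \<noteq> 0})" by simp
  qed
  note form_f = form[OF this]
  define Y where "Y = (\<lambda>x. (cmod (y x))\<^sup>2)"
  have Y_cont: "continuous_on {c..} Y" unfolding Y_def by (intro continuous_intros cont)
  have Y: "ac_deriv c Y (\<lambda>x. 2 * Re (cnj (y x) * w x) / p x)"
  proof -
    have "ac_deriv c (\<lambda>x. Re (cnj (y x) * y x)) (\<lambda>x. Re (cnj (y x) * (w x / of_real (p x)) + cnj (w x / of_real (p x)) * y x))"
      by (intro ac_deriv_bounded_linear[OF _ bounded_linear_Re] ac_deriv_mult y ac_deriv_bounded_linear[OF y bounded_linear_cnj])
    moreover have "Re (cnj (y x) * y x) = Y x" for x 
      unfolding Y_def cmod_power2 by (simp add: power2_eq_square)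
    moreover have "Re (cnj (y x) * (w x / of_real (p x)) + cnj (w x / of_real (p x)) * y x) = 2 * Re (cnj (y x) * w x) / p x" for x
      by (simp add: Re_divide_of_real Im_divide_of_real add_divide_distrib[symmetric])
    ultimately show ?thesis by simp
  qed
  \<comment> \<open>The real part of the form density is \<open>z A + B - P'\<close>, and \<open>P\<close> vanishes at both ends.\<close>
  define P where "P = (\<lambda>x. \<phi> x * (p x * \<psi> x) * Y x)"
  define P' where "P' = (\<lambda>x. \<phi> x * (p x * \<psi> x) * (2 * Re (cnj (y x) * w x) / p x) + (\<phi> x * h x + \<psi> x * (p x * \<psi> x)) * Y x)"
  have P: "ac_deriv c P P'" unfolding P_def P'_def by (intro ac_deriv_mult \<phi> p\<psi> Y)
  define A B where "A = (\<lambda>x. (\<phi> x)\<^sup>2 * Y x * r x)" and "B = (\<lambda>x. p x * (\<psi> x)\<^sup>2 * Y x)"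
  have A_int: "loc_integrable c A"
    unfolding A_def by (intro weight_loc_integrable continuous_intros cont Y_cont)
  have B_int: "loc_integrable c B"
    unfolding B_def by (intro loc_integrable_continuous continuous_intros cont Y_cont)
  have c\<rho>: "c \<le> \<rho>" using \<rho> by linarith
  have A_supp: "A x = 0" if "\<rho> < x" for x using cut(2)[of x] that by (simp add: A_def)
  have B_supp: "B x = 0" if "\<rho> < x" for x using cut(3)[of x] that by (simp add: B_def)
  have A_L: "integrable ?M A" "integral\<^sup>L ?M A = integral {c..\<rho>} A"
    using integral_lebesgue_on_atLeast_support[OF loc_integrable_Icc[OF A_int order_refl], of \<rho>] A_supp by auto
  have B_L: "integrable ?M B" "integral\<^sup>L ?M B = integral {c..\<rho>} B"
    using integral_lebesgue_on_atLeast_support[OF loc_integrable_Icc[OF B_int order_refl], of \<rho>] B_supp by auto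
  \<comment> \<open>The form density at \<open>f\<close>, with the weight \<open>r\<close> already
    cancelled against the \<open>1 / r\<close> in \<open>b / r\<close>.\<close>
  define F where "F = (\<lambda>x. of_real (z * A x) - of_real (\<phi> x) * cnj (y x) * b x)"
  have F_int: "loc_integrable c F"
    unfolding F_def
    by (intro loc_integrable_diff loc_integrable_mult_continuous b_int continuous_intros cont \<psi>r
        loc_integrable_bounded_linear[OF loc_integrable_bounded_linear[OF A_int bounded_linear_mult_right] bounded_linear_of_real])
  have F_supp: "F x = 0" if "\<rho> < x" for x using cut(2)[of x] that by (simp add: F_def A_def)
  have F_L: "integrable ?M F" "integral\<^sup>L ?M F = integral {c..\<rho>} F"
    using integral_lebesgue_on_atLeast_support[OF loc_integrable_Icc[OF F_int order_refl], of \<rho>] F_supp by auto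
  have "(LINT x|?M. cnj (f x) * ell p q r c f x * of_real (r x)) = (LINT x|?M. F x)"
  proof (rule integral_cong_AE)
    have "(\<lambda>x. cnj (f x)) \<in> borel_measurable ?M"
      unfolding f_def by (intro continuous_imp_measurable_on_sets_lebesgue continuous_intros cont \<psi>r) auto
    then show "(\<lambda>x. cnj (f x) * ell p q r c f x * of_real (r x)) \<in> borel_measurable ?M"
      using ell_meas r_measurable by measurable
    show "F \<in> borel_measurable ?M" using F_L(1) by (rule borel_measurable_integrable)
    show "AE x in ?M. cnj (f x) * ell p q r c f x * of_real (r x) = F x"
      using ell_f r_pos
    proof eventually_elim
      case (elim x)
      have "cnj (f x) * ell p q r c f x * of_real (r x) = of_real z * (cnj (f x) * f x) * of_real (r x) - cnj (f x) * b x"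
        unfolding elim(1) using elim(2) by (simp add: field_simps)
      also have "cnj (f x) * f x = of_real ((\<phi> x)\<^sup>2 * Y x)"
        unfolding f_def Y_def of_real_mult complex_norm_square by (simp add: power2_eq_square mult_ac)
      finally show ?case by (simp add: F_def A_def f_def)
    qed
  qed
  also have "Re \<dots> = integral {c..\<rho>} (\<lambda>x. Re (F x))"
    unfolding F_L(2)
    using integral_linear[OF loc_integrable_Icc_integrable[OF F_int order_refl, of \<rho>] bounded_linear_Re]
    by (simp add: o_def)
  also have "\<dots> = integral {c..\<rho>} (\<lambda>x. z * A x + B x - P' x)"
  proof -
    \<comment> \<open>In \<open>P'\<close> a factor \<open>p\<close> meets a factor
      \<open>1 / p\<close>; they cancel off the null set where \<open>p\<close> fails to be
      positive.\<close>
    obtain N where N: "negligible N" "\<And>x. x \<in> {c..} - N \<Longrightarrow> p x > 0" by (rule AE_lebesgue_onE[OF p_pos]) auto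
    show ?thesis
    proof (rule integral_spike[OF N(1)])
      fix x assume "x \<in> {c..\<rho>} - N"
      then have "p x > 0" using N(2) by auto
      then have "P' x = \<phi> x * \<psi> x * (2 * Re (cnj (y x) * w x)) + (\<phi> x * h x) * Y x + B x"
        unfolding P'_def using \<open>p x > 0\<close> by (simp add: B_def power2_eq_square distrib_right)
      moreover have "Re (F x) = z * A x - \<phi> x * (2 * \<psi> x * Re (cnj (y x) * w x) + h x * Y x)"
      proof -
        have "of_real (\<phi> x) * cnj (y x) * b x = of_real (2 * \<phi> x * \<psi> x) * (cnj (y x) * w x) + of_real (\<phi> x * h x * Y x)"
          unfolding b_def Y_def of_real_mult complex_norm_square by (simp add: algebra_simps)
        then show ?thesis unfolding F_def by (simp add: algebra_simps)
      qed
      ultimately show "z * A x + B x - P' x = Re (F x)" by (simp add: algebra_simps)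
    qed
  qed
  also have "\<dots> = z * integral {c..\<rho>} A + integral {c..\<rho>} B"
  proof -
    have "((\<lambda>x. z * A x + B x - P' x) has_integral (z * integral {c..\<rho>} A + integral {c..\<rho>} B - (P \<rho> - P c))) {c..\<rho>}"
      by (intro has_integral_diff has_integral_add has_integral_mult_right integrable_integral
          loc_integrable_Icc_integrable[OF A_int] loc_integrable_Icc_integrable[OF B_int] order_refl
          ac_deriv_integral(2)[OF P order_refl c\<rho>])
    moreover have "P \<rho> = 0" "P c = 0" using cut(2)[of \<rho>] s(2) by (simp_all add: P_def Y_def)
    ultimately show ?thesis by (simp add: integral_unique)
  qed
  finally have form_val: "Re (LINT x|?M. cnj (f x) * ell p q r c f x * of_real (r x)) = z * integral {c..\<rho>} A + integral {c..\<rho>} B" .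
  have "(\<lambda>x. (cmod (f x))\<^sup>2 * r x) = A" by (simp add: fun_eq_iff f_def A_def Y_def norm_mult power_mult_distrib)
  then have "\<gamma> * (LINT x|?M. A x) \<le> z * (LINT x|?M. A x) + (LINT x|?M. B x)"
    using form_f form_val A_L(2) B_L(2) by simp
  then have AB: "(LINT x|?M. A x) \<le> (LINT x|?M. B x)" by (simp add: z_def algebra_simps)
  have N_int: "integrable ?M (\<lambda>x. Y x * r x)" using L2 by (simp add: L2_weighted_def Y_def)
  have ind: "(indicator {\<rho> / 2..} :: real \<Rightarrow> real) \<in> borel_measurable ?M"
    by (rule borel_measurable_indicator) (use \<rho> in \<open>auto simp: sets_restrict_space_iff\<close>)
  have T_int: "integrable ?M (\<lambda>x. indicator {\<rho> / 2..} x * (Y x * r x))"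
  proof (rule Bochner_Integration.integrable_bound[OF N_int])
    show "(\<lambda>x. indicator {\<rho> / 2..} x * (Y x * r x)) \<in> borel_measurable ?M"
      by (rule borel_measurable_times[OF ind borel_measurable_integrable[OF N_int]])
  qed (auto simp: indicator_def)
  have "(LINT x|?M. B x) \<le> (LINT x|?M. 9 * C * (indicator {\<rho> / 2..} x * (Y x * r x)))"
  proof (rule integral_mono_AE[OF B_L(1)])
    show "integrable ?M (\<lambda>x. 9 * C * (indicator {\<rho> / 2..} x * (Y x * r x)))" using T_int by (rule integrable_mult_right)
    show "AE x in ?M. B x \<le> 9 * C * (indicator {\<rho> / 2..} x * (Y x * r x))"
      using C(2) r_pos p_pos
    proof eventually_elim
      case (elim x)
      show ?case
      proof (cases "\<rho> / 2 < x \<and> x < \<rho>")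
        case True
        have "(\<psi> x)\<^sup>2 \<le> (3 / \<rho>)\<^sup>2" using power_mono[OF cut(7)[of x] abs_ge_zero, of 2] by simp
        then have "p x * (\<psi> x)\<^sup>2 \<le> (C * \<rho>\<^sup>2 * r x) * (3 / \<rho>)\<^sup>2"
          using elim True C(1) by (intro mult_mono) auto
        \<comment> \<open>The growth factor \<open>\<rho>^2\<close> of \<open>p / r\<close> is
          cancelled by the square of the slope \<open>3 / \<rho>\<close>, so the constant does not
          depend on \<open>\<rho>\<close>.\<close>
        also have "\<dots> = 9 * C * r x" using \<rho>(1) by (simp add: power_divide)
        finally have "p x * (\<psi> x)\<^sup>2 * Y x \<le> 9 * C * r x * Y x" by (rule mult_right_mono) (simp add: Y_def)
        then show ?thesis using True by (simp add: B_def mult_ac)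
      next
        case False
        then have "B x = 0" using cut(3)[of x] by (simp add: B_def)
        moreover have "0 \<le> 9 * C * (indicator {\<rho> / 2..} x * (Y x * r x))"
          using C(1) elim by (simp add: Y_def)
        ultimately show ?thesis by simp
      qed
    qed
  qed
  also have "\<dots> = 9 * C * (LINT x|?M. indicator {\<rho> / 2..} x * (Y x * r x))" by simp
  finally have B_le: "(LINT x|?M. B x) \<le> 9 * C * (LINT x|?M. indicator {\<rho> / 2..} x * (Y x * r x))" .
  have "(LINT x|?M. Y x * r x - indicator {\<rho> / 2..} x * (Y x * r x)) \<le> (LINT x|?M. A x)"
  proof (rule integral_mono_AE[OF Bochner_Integration.integrable_diff[OF N_int T_int] A_L(1)])
    show "AE x in ?M. Y x * r x - indicator {\<rho> / 2..} x * (Y x * r x) \<le> A x"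
      using r_pos
    proof eventually_elim
      case (elim x)
      show ?case
      proof (cases "x < \<rho> / 2")
        case True
        then show ?thesis using cut(1)[of x] by (simp add: A_def)
      next
        case False
        then show ?thesis using elim by (simp add: A_def Y_def)
      qed
    qed
  qed
  then have "(LINT x|?M. Y x * r x) - (LINT x|?M. indicator {\<rho> / 2..} x * (Y x * r x)) \<le> (LINT x|?M. A x)"
    by (simp add: Bochner_Integration.integral_diff[OF N_int T_int])
  then have "(LINT x|?M. Y x * r x) \<le> (1 + 9 * C) * (LINT x|?M. indicator {\<rho> / 2..} x * (Y x * r x))"
    using AB B_le by (simp add: algebra_simps)
  then show ?thesis by (simp add: Y_def)
qed

end

lemma L2_weighted_cong:
  assumes "\<And>x. c \<le> x \<Longrightarrow> u x = u' x" "L2_weighted r c u"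
  shows "L2_weighted r c u'"
proof -
  have "u \<in> borel_measurable (lebesgue_on {c..}) \<longleftrightarrow> u' \<in> borel_measurable (lebesgue_on {c..})"
    by (rule measurable_cong) (simp add: space_restrict_space assms(1))
  moreover have "integrable (lebesgue_on {c..}) (\<lambda>x. (cmod (u x))\<^sup>2 * r x) \<longleftrightarrow>
      integrable (lebesgue_on {c..}) (\<lambda>x. (cmod (u' x))\<^sup>2 * r x)"
    by (rule Bochner_Integration.integrable_cong) (simp_all add: space_restrict_space assms(1))
  ultimately show ?thesis using assms(2) by (simp add: L2_weighted_def)
qed

section \<open>From the cutoff estimate to the limit point case\<close>

context sturm_liouville
begin

text \<open>If \<open>u\<close> vanished on all of \<open>{c..}\<close>, then
  \<open>v = p u'\<close> would vanish almost everywhere, and by continuity also at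
  \<open>c\<close>.\<close>

lemma sl_sol_nonzero:
  assumes s: "sl_sol z u v" and nz: "u c \<noteq> 0 \<or> v c \<noteq> 0"
  shows "\<exists>x\<ge>c. u x \<noteq> 0"
proof (rule ccontr)
  assume "\<not> ?thesis"
  then have u0: "u x = 0" if "c \<le> x" for x using that by blast
  have u_const: "ac_deriv c u (\<lambda>x. 0)" by (rule ac_deriv_cong[OF ac_deriv_const[of c 0] u0]) auto
  have "AE x in lebesgue_on {c..}. v x = 0"
    using p_pos ac_deriv_AE_eq[OF sl_sol_ac(1)[OF s]] ac_deriv_AE_eq[OF u_const]
    by eventually_elim auto
  then have "v c = 0" using ac_deriv_unique[OF sl_sol_ac(2)[OF s] ac_deriv_const[of c 0]] by blast
  with nz u0[of c] show False by simp
qed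

text \<open>Neither the left side nor the constant \<open>1 + 9 C\<close> of
  \<open>cutoff_estimate\<close> depends on \<open>\<rho>\<close>, whereas the tail integral tends
  to 0 by dominated convergence; continuity then upgrades almost everywhere to everywhere.\<close>

lemma sl_sol_L2_vanishes:
  assumes p_ac: "\<And>d. c \<le> d \<Longrightarrow> abs_continuous_on_interval c d p"
    and p'r: "L1_loc {c<..} (\<lambda>x. (deriv p x)\<^sup>2 / r x)" and r1: "L1_loc {c<..} (\<lambda>x. 1 / r x)"
    and form: "\<And>u. u \<in> D_min p q r c \<Longrightarrow>
      \<gamma> * (LINT x|lebesgue_on {c..}. (cmod (u x))\<^sup>2 * r x) \<le>
      Re (LINT x|lebesgue_on {c..}. cnj (u x) * ell p q r c u x * of_real (r x))"
    and C: "0 \<le> C" "\<forall>\<^sub>F \<rho> in at_top. AE x in lebesgue_on {c..}. \<rho> / 2 < x \<and> x < \<rho> \<longrightarrow> p x \<le> C * \<rho>\<^sup>2 * r x"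
    and s: "sl_sol (of_real (\<gamma> - 1)) y w" "y c = 0" and L2: "L2_weighted r c y" and x: "c \<le> x"
  shows "y x = 0"
proof -
  let ?M = "lebesgue_on {c..}" and ?Y = "\<lambda>x. (cmod (y x))\<^sup>2 * r x"
  have Y: "integrable ?M ?Y" using L2 by (simp add: L2_weighted_def)
  have nonneg: "AE x in ?M. 0 \<le> ?Y x" using r_pos by eventually_elim simp
  define T where "T = (\<lambda>\<rho>. LINT x|?M. indicator {\<rho> / 2..} x * ?Y x)"
  have "((\<lambda>\<rho>. T \<rho>) \<longlongrightarrow> (LINT x|?M. 0)) at_top"
    unfolding T_def
  proof (rule integral_dominated_convergence_at_top[OF _ _ Y])
    have ind: "(indicator {a..} :: real \<Rightarrow> real) \<in> borel_measurable ?M" for a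
    proof -
      have "{a..} \<inter> {c..} = {max a c..}" by auto
      then show ?thesis by (intro borel_measurable_indicator') (auto simp: sets_restrict_space_iff space_restrict_space Int_def vimage_def)
    qed
    show "(\<lambda>x. indicator {\<rho> / 2..} x * ?Y x) \<in> borel_measurable ?M" for \<rho>
      by (intro borel_measurable_times ind borel_measurable_integrable[OF Y])
    show "AE x in ?M. ((\<lambda>\<rho>. indicator {\<rho> / 2..} x * ?Y x) \<longlongrightarrow> 0) at_top"
    proof (rule AE_I2)
      fix x
      have "\<forall>\<^sub>F \<rho> in at_top. indicator {\<rho> / 2..} x * ?Y x = 0"
        using eventually_gt_at_top[of "2 * x"] by eventually_elim (simp add: indicator_def)
      then show "((\<lambda>\<rho>. indicator {\<rho> / 2..} x * ?Y x) \<longlongrightarrow> 0) at_top" by (rule tendsto_eventually)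
    qed
    show "\<forall>\<^sub>F \<rho> in at_top. AE x in ?M. norm (indicator {\<rho> / 2..} x * ?Y x) \<le> ?Y x"
    proof (rule always_eventually, rule allI)
      show "AE x in ?M. norm (indicator {\<rho> / 2..} x * ?Y x) \<le> ?Y x" for \<rho> :: real
        using nonneg by eventually_elim (auto simp: indicator_def)
    qed
  qed simp
  then have lim: "((\<lambda>\<rho>. (1 + 9 * C) * T \<rho>) \<longlongrightarrow> (1 + 9 * C) * 0) at_top" by (intro tendsto_mult_left) simp
  have "\<forall>\<^sub>F \<rho> in at_top. (LINT x|?M. ?Y x) \<le> (1 + 9 * C) * T \<rho>"
    using C(2) eventually_gt_at_top[of 0] eventually_gt_at_top[of "2 * c"]
  proof eventually_elim
    case (elim \<rho>)
    then show ?case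
      unfolding T_def by (intro cutoff_estimate[OF p_ac p'r r1 form s L2 _ _ C(1)]) auto
  qed
  then have "(LINT x|?M. ?Y x) \<le> (1 + 9 * C) * 0" by (rule tendsto_lowerbound[OF lim _ trivial_limit_at_top_linorder])
  moreover have "0 \<le> (LINT x|?M. ?Y x)" by (rule integral_nonneg_AE[OF nonneg])
  ultimately have "(LINT x|?M. ?Y x) = 0" by simp
  then have "AE x in ?M. ?Y x = 0" using integral_nonneg_eq_0_iff_AE[OF Y nonneg] by simp
  then have "AE x in ?M. y x = 0" using r_pos by eventually_elim simp
  then show ?thesis using ac_deriv_unique[OF sl_sol_ac(1)[OF s(1)] ac_deriv_const[of c 0] _ x] by simp
qed

theorem limit_point_criterion:
  assumes p_ac: "\<And>d. c \<le> d \<Longrightarrow> abs_continuous_on_interval c d p"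
    and p'r: "L1_loc {c<..} (\<lambda>x. (deriv p x)\<^sup>2 / r x)" and r1: "L1_loc {c<..} (\<lambda>x. 1 / r x)"
    and form: "T_min_bounded_below p q r c"
    and C: "0 \<le> C" "\<forall>\<^sub>F \<rho> in at_top. AE x in lebesgue_on {c..}. \<rho> / 2 < x \<and> x < \<rho> \<longrightarrow> p x \<le> C * \<rho>\<^sup>2 * r x"
  shows "limit_point_at_infinity p q r c"
  unfolding limit_point_at_infinity_def
proof (intro allI impI)
  fix z :: complex assume "z \<notin> \<real>"
  then have z: "Im z \<noteq> 0" by (simp add: complex_is_Real_iff)
  obtain \<gamma> where \<gamma>: "\<And>u. u \<in> D_min p q r c \<Longrightarrow>
      \<gamma> * (LINT x|lebesgue_on {c..}. (cmod (u x))\<^sup>2 * r x) \<le>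
      Re (LINT x|lebesgue_on {c..}. cnj (u x) * ell p q r c u x * of_real (r x))"
    using form unfolding T_min_bounded_below_def by blast
  obtain \<psi> \<psi>' where \<psi>: "sl_sol z \<psi> \<psi>'" "L2_weighted r c \<psi>" "\<psi> c \<noteq> 0 \<or> \<psi>' c \<noteq> 0"
    by (rule weyl_solution_exists[OF z])
  obtain y w where y: "sl_sol (of_real (\<gamma> - 1)) y w" "y c = 0" "w c = 1" by (rule sl_sol_exists)
  have not_L2: "\<not> L2_weighted r c y"
  proof
    assume "L2_weighted r c y"
    then have "y x = 0" if "c \<le> x" for x using sl_sol_L2_vanishes[OF p_ac p'r r1 \<gamma> C y(1,2) _ that] by blast
    moreover have "\<exists>x\<ge>c. y x \<noteq> 0" by (rule sl_sol_nonzero[OF y(1)]) (simp add: y)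
    ultimately show False by blast
  qed
  \<comment> \<open>\<open>L2_solutions\<close> consists of extensions by zero, so the values to the
    left of \<open>c\<close> have to be reset.\<close>
  define \<psi>0 where "\<psi>0 = (\<lambda>x. if x < c then 0 else \<psi> x)"
  have in_sol: "\<psi>0 \<in> L2_solutions p q r c z"
    unfolding L2_solutions_iff
  proof (intro conjI exI)
    show "\<forall>x<c. \<psi>0 x = 0" by (simp add: \<psi>0_def)
    show "L2_weighted r c \<psi>0" by (rule L2_weighted_cong[OF _ \<psi>(2)]) (simp add: \<psi>0_def)
    show "sl_sol z \<psi>0 \<psi>'" by (rule sl_sol_cong[OF \<psi>(1)]) (simp_all add: \<psi>0_def)
  qed
  have multiple: "\<exists>k. u = fun_scale k \<psi>0" if u_sol: "u \<in> L2_solutions p q r c z" for u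
  proof -
    obtain v where u: "\<And>x. x < c \<Longrightarrow> u x = 0" "L2_weighted r c u" "sl_sol z u v"
      using u_sol unfolding L2_solutions_iff by blast
    \<comment> \<open>Otherwise \<open>\<psi>\<close> and \<open>u\<close> would be independent and
      both square integrable, and \<open>weyl_alternative\<close> would make \<open>y\<close> square
      integrable at the parameter \<open>\<gamma> - 1\<close>.\<close>
    have W: "\<psi> c * v c - \<psi>' c * u c = 0"
      using weyl_alternative[OF \<psi>(1,2) u(3,2) _ y(1)] not_L2 by blast
    have "\<exists>k. u c = k * \<psi> c \<and> v c = k * \<psi>' c"
    proof (cases "\<psi> c = 0")
      case True
      then have "\<psi>' c \<noteq> 0" "u c = 0" using \<psi>(3) W by auto
      then show ?thesis using True by (intro exI[of _ "v c / \<psi>' c"]) simp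
    next
      case False
      then show ?thesis using W by (intro exI[of _ "u c / \<psi> c"]) (simp add: field_simps)
    qed
    then obtain k where k: "u c = k * \<psi> c" "v c = k * \<psi>' c" by blast
    have "u x = fun_scale k \<psi>0 x" for x
    proof (cases "x < c")
      case False
      have "1 * u x + - k * \<psi> x = 0"
        using sl_sol_zero[OF sl_sol_linear[OF u(3) \<psi>(1), of 1 "- k"], of x] k False by simp
      then show ?thesis using False by (simp add: fun_scale_def \<psi>0_def)
    qed (simp add: u fun_scale_def \<psi>0_def)
    then show ?thesis by blast
  qed
  interpret V: vector_space fun_scale by (rule vector_space_fun_scale)
  show "V.dim (L2_solutions p q r c z) = 1"
  proof (rule V.dim_unique[of "{\<psi>0}"])
    show "L2_solutions p q r c z \<subseteq> V.span {\<psi>0}"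
      using multiple V.span_scale[OF V.span_base[of \<psi>0 "{\<psi>0}"]] by fastforce
    obtain x where "c \<le> x" "\<psi> x \<noteq> 0" using sl_sol_nonzero[OF \<psi>(1,3)] by blast
    then have "\<psi>0 x \<noteq> 0" by (simp add: \<psi>0_def)
    then have "\<psi>0 \<noteq> 0" by auto
    then show "V.independent {\<psi>0}" by simp
  qed (use in_sol in auto)
qed

end

theorem theorem3p1:
  fixes c :: real and p q r :: "real \<Rightarrow> real"
  assumes "p \<in> borel_measurable (lebesgue_on {c..})"
    and "q \<in> borel_measurable (lebesgue_on {c..})"
    and "r \<in> borel_measurable (lebesgue_on {c..})"
    and "AE x in lebesgue_on {c..}. p x > 0"
    and "AE x in lebesgue_on {c..}. r x > 0"
    and "\<And>d. d \<ge> c \<Longrightarrow> (\<lambda>x. 1 / p x) absolutely_integrable_on {c..d}"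
    and "\<And>d. d \<ge> c \<Longrightarrow> q absolutely_integrable_on {c..d}"
    and "\<And>d. d \<ge> c \<Longrightarrow> r absolutely_integrable_on {c..d}"
    and "\<And>\<rho>. \<rho> > 0 \<Longrightarrow> abs_continuous_on_interval c (c + \<rho>) p"
    and "L1_loc {c<..} (\<lambda>x. (deriv p x)\<^sup>2 / r x)"
    and "L1_loc {c<..} (\<lambda>x. 1 / r x)"
    and "T_min_bounded_below p q r c"
    and "\<exists>C::real. \<forall>\<^sub>F \<rho> in at_top.
           esssup (lebesgue_on {\<rho>/2<..<\<rho>}) (\<lambda>x. ereal \<bar>p x / r x\<bar>) \<le> ereal (C * \<rho>\<^sup>2)"
  shows "limit_point_at_infinity p q r c"
proof -
  interpret sturm_liouville p q r c
    using assms(3-8) by unfold_locales (auto simp: loc_integrable_def)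
  obtain C where C: "\<forall>\<^sub>F \<rho> in at_top.
      esssup (lebesgue_on {\<rho>/2<..<\<rho>}) (\<lambda>x. ereal \<bar>p x / r x\<bar>) \<le> ereal (C * \<rho>\<^sup>2)"
    using assms(13) by blast
  show ?thesis
  proof (rule limit_point_criterion[OF _ assms(10-12)])
    \<comment> \<open>The hypothesis speaks of lengths \<open>\<rho> > 0\<close>; the
      \<open>+ 1\<close> covers the degenerate case \<open>d = c\<close>.\<close>
    show "abs_continuous_on_interval c d p" if "c \<le> d" for d
      by (rule abs_continuous_on_interval_subset[OF assms(9)[of "d - c + 1"]]) (use that in auto)
    \<comment> \<open>The hypothesis leaves the sign of \<open>C\<close> open. Passing to the
      absolute value keeps the bound, since \<open>r\<close> is positive almost everywhere.\<close>
    show "0 \<le> \<bar>C\<bar>" by simp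
    show "\<forall>\<^sub>F \<rho> in at_top. AE x in lebesgue_on {c..}. \<rho> / 2 < x \<and> x < \<rho> \<longrightarrow> p x \<le> \<bar>C\<bar> * \<rho>\<^sup>2 * r x"
      using C eventually_gt_at_top[of "2 * c"]
    proof eventually_elim
      case (elim \<rho>)
      have "AE x in lebesgue_on {\<rho>/2<..<\<rho>}. ereal \<bar>p x / r x\<bar> \<le> ereal (C * \<rho>\<^sup>2)"
        using esssup_AE[of "\<lambda>x. ereal \<bar>p x / r x\<bar>" "lebesgue_on {\<rho>/2<..<\<rho>}"]
        by eventually_elim (rule order.trans[OF _ elim(1)])
      then have "AE x in lebesgue. x \<in> {\<rho>/2<..<\<rho>} \<longrightarrow> \<bar>p x / r x\<bar> \<le> C * \<rho>\<^sup>2"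
        by (simp add: AE_restrict_space_iff)
      then have "AE x in lebesgue. x \<in> {c..} \<longrightarrow> x \<in> {\<rho>/2<..<\<rho>} \<longrightarrow> \<bar>p x / r x\<bar> \<le> C * \<rho>\<^sup>2"
        by eventually_elim simp
      then have "AE x in lebesgue_on {c..}. x \<in> {\<rho>/2<..<\<rho>} \<longrightarrow> \<bar>p x / r x\<bar> \<le> C * \<rho>\<^sup>2"
        by (simp add: AE_restrict_space_iff)
      with p_pos r_pos show ?case
      proof eventually_elim
        case (elim x)
        have "p x \<le> C * \<rho>\<^sup>2 * r x" if "\<rho> / 2 < x" "x < \<rho>"
          using elim that by (simp add: pos_divide_le_eq)
        moreover have "C * \<rho>\<^sup>2 * r x \<le> \<bar>C\<bar> * \<rho>\<^sup>2 * r x"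
          using elim by (intro mult_right_mono) auto
        ultimately show ?case by linarith
      qed
    qed
  qed
qed

end
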